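(* Let $0<p<\infty$, $\alpha>-1$, $\beta>1$, and let $\mu$ be a positive Borel measure on $[0,1)$ satisfying condition $(W_{p,\alpha})$. (i) Let $q\ge p$ and $q>1$. If $\mathcal{H}_{\mu,\beta}$ is a compact operator from $A^p_\alpha$ into $A^q_{\beta-2}$, then $\mu$ is a vanishing $\left(\frac{\alpha+2}{p}+\frac{\beta}{q'}\right)$-Carleson measure. Conversely, if $\mu$ is a vanishing $\left(\max\{\alpha+2,\beta\}\left(\frac1p+\frac1{q'}\right)\right)$-Carleson measure, then $\mathcal{H}_{\mu,\beta}$ is a compact operator from $A^p_\alpha$ into $A^q_{\beta-2}$. (ii) Let $q\ge p$ and $q=1$. Then $\mathcal{H}_{\mu,\beta}$ is a compact operator from $A^p_\alpha$ into $A^1_{\beta-2}$ if and only if $\mu$ is a vanishing $1$-logarithmic $\frac{\alpha+2}{p}$-Carleson measure.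
   Context: $\mathbb{D}$ is the open unit disc, $dA=\frac1\pi dx\,dy$. For $0<p<\infty$, $\alpha>-1$, $A^p_\alpha$ is the space of analytic $f$ on $\mathbb{D}$ with $\|f\|_{A^p_\alpha}=\left((\alpha+1)\int_{\mathbb{D}}|f|^p(1-|z|^2)^\alpha dA\right)^{1/p}<\infty$. For $q>1$, $1/q+1/q'=1$. For a positive Borel measure $\mu$ on $[0,1)$ and $\beta>0$, $\mu_{n,k,\beta}=\frac{\Gamma(n+\beta)}{n!\Gamma(\beta)}\int_{[0,1)}t^{n+k}d\mu(t)$ and for $f(z)=\sum_k a_kz^k$ analytic, $\mathcal{H}_{\mu,\beta}(f)(z)=\sum_n\left(\sum_k\mu_{n,k,\beta}a_k\right)z^n$. Compactness from $X$ into $Y$ means $\mathcal{H}_{\mu,\beta}$ maps $X$ into $Y$ and takes bounded sets to relatively compact sets. A measure $\mu$ on $[0,1)$ is regarded as a measure on $\mathbb{D}$ via $\mu(E)=\mu(E\cap[0,1))$. For an arc $I\subset\partial\mathbb{D}$ with length $|I|$, $S(I)=\{re^{i\theta}:e^{i\theta}\in I,\ 1-\frac{|I|}{2\pi}\le r\le1\}$. For $s>0$, $\mu$ is an $s$-Carleson measure if $\mu(S(I))\le C|I|^s$ for all arcs $I$ (for $\mu$ on $[0,1)$: $\mu([t,1))\le C(1-t)^s$), and a vanishing $s$-Carleson measure if $\mu(S(I))/|I|^s\to0$ as $|I|\to0$ (for $\mu$ on $[0,1)$: $\mu([t,1))=o((1-t)^s)$ as $t\to1^-$). For $\gamma\ge0$,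 $\mu$ is a vanishing $\gamma$-logarithmic $s$-Carleson measure if $\mu(S(I))\left(\log\frac{2\pi}{|I|}\right)^\gamma=o(|I|^s)$ as $|I|\to0$. Condition $(W_{p,\alpha})$: if $0<p\le1$, $\mu$ is a $\frac{\alpha+2}{p}$-Carleson measure; if $1\le p\le 2$, $\mu$ is a $\frac{\alpha+2-(p-1)^2}{p}$-Carleson measure; if $2\le p<\infty$, $\mu$ is a $\frac{\alpha+1}{p}$-Carleson measure. *)

theory Defs
  imports "HOL-Analysis.Analysis"
begin

text \<open>dA = dx dy / pi, lborel on complex is planar Lebesgue measure.\<close>

definition bergman_int :: "real \<Rightarrow> real \<Rightarrow> (complex \<Rightarrow> complex) \<Rightarrow> ennreal" where
  "bergman_int p \<alpha> f =
     ennreal ((\<alpha> + 1) / pi) *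
     (\<integral>\<^sup>+ z \<in> ball 0 1. ennreal (norm (f z) powr p * (1 - (norm z)\<^sup>2) powr \<alpha>) \<partial>lborel)"

definition bergman_space :: "real \<Rightarrow> real \<Rightarrow> (complex \<Rightarrow> complex) set" where
  "bergman_space p \<alpha> = {f. f holomorphic_on ball 0 1 \<and> bergman_int p \<alpha> f < \<infinity>}"

definition bergman_norm :: "real \<Rightarrow> real \<Rightarrow> (complex \<Rightarrow> complex) \<Rightarrow> real" where
  "bergman_norm p \<alpha> f = enn2real (bergman_int p \<alpha> f) powr (1 / p)"

definition taylor_coeff :: "(complex \<Rightarrow> complex) \<Rightarrow> nat \<Rightarrow> complex" where
  "taylor_coeff f k = (deriv ^^ k) f 0 / of_nat (fact k)"

definition mu_coeff :: "real measure \<Rightarrow> real \<Rightarrow> nat \<Rightarrow> nat \<Rightarrow> real" where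
  "mu_coeff \<mu> \<beta> n k = Gamma (real n + \<beta>) / (fact n * Gamma \<beta>) * (\<integral>t. t ^ (n + k) \<partial>\<mu>)"

definition hilbert_coeff :: "real measure \<Rightarrow> real \<Rightarrow> (complex \<Rightarrow> complex) \<Rightarrow> nat \<Rightarrow> complex" where
  "hilbert_coeff \<mu> \<beta> f n = (\<Sum>k. complex_of_real (mu_coeff \<mu> \<beta> n k) * taylor_coeff f k)"

definition hilbert_op :: "real measure \<Rightarrow> real \<Rightarrow> (complex \<Rightarrow> complex) \<Rightarrow> complex \<Rightarrow> complex" where
  "hilbert_op \<mu> \<beta> f z = (\<Sum>n. hilbert_coeff \<mu> \<beta> f n * z ^ n)"

definition hilbert_defined :: "real measure \<Rightarrow> real \<Rightarrow> (complex \<Rightarrow> complex) \<Rightarrow> bool" where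
  "hilbert_defined \<mu> \<beta> f \<longleftrightarrow>
     (\<forall>n. summable (\<lambda>k. complex_of_real (mu_coeff \<mu> \<beta> n k) * taylor_coeff f k)) \<and>
     (\<forall>z \<in> ball 0 1. summable (\<lambda>n. hilbert_coeff \<mu> \<beta> f n * z ^ n))"

text \<open>Compactness from A^p_alpha into A^q_gamma: H maps the first space into the second, and
  images of bounded sets are relatively compact, i.e. (metric space) every image sequence of a
  bounded sequence has a subsequence converging in A^q_gamma.\<close>
definition hilbert_compact ::
  "real measure \<Rightarrow> real \<Rightarrow> real \<Rightarrow> real \<Rightarrow> real \<Rightarrow> real \<Rightarrow> bool" where
  "hilbert_compact \<mu> \<beta> p \<alpha> q \<gamma> \<longleftrightarrow>
     (\<forall>f \<in> bergman_space p \<alpha>. hilbert_defined \<mu> \<beta> f \<and> hilbert_op \<mu> \<beta> f \<in> bergman_space q \<gamma>) \<and>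
     (\<forall>F :: nat \<Rightarrow> complex \<Rightarrow> complex. \<forall>M.
        (\<forall>j. F j \<in> bergman_space p \<alpha> \<and> bergman_norm p \<alpha> (F j) \<le> M) \<longrightarrow>
        (\<exists>r g. strict_mono r \<and> g \<in> bergman_space q \<gamma> \<and>
           (\<lambda>j. bergman_norm q \<gamma> (\<lambda>z. hilbert_op \<mu> \<beta> (F (r j)) z - g z)) \<longlonglongrightarrow> 0))"

definition carleson :: "real measure \<Rightarrow> real \<Rightarrow> bool" where
  "carleson \<mu> s \<longleftrightarrow> (\<exists>C. \<forall>t \<in> {0..<1}. emeasure \<mu> {t..<1} \<le> ennreal (C * (1 - t) powr s))"

definition vanishing_carleson :: "real measure \<Rightarrow> real \<Rightarrow> bool" where
  "vanishing_carleson \<mu> s \<longleftrightarrow>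
     (\<forall>\<epsilon>>0. \<exists>\<delta>>0. \<forall>t. 1 - \<delta> < t \<and> t < 1 \<longrightarrow>
        emeasure \<mu> {t..<1} \<le> ennreal (\<epsilon> * (1 - t) powr s))"

text \<open>For mu on [0,1): S(I) meets [0,1) in [t,1) with |I| = 2 pi (1-t), so
  log(2 pi/|I|) = ln(1/(1-t)).\<close>
definition vanishing_log_carleson :: "real measure \<Rightarrow> real \<Rightarrow> real \<Rightarrow> bool" where
  "vanishing_log_carleson \<mu> \<gamma> s \<longleftrightarrow>
     (\<forall>\<epsilon>>0. \<exists>\<delta>>0. \<forall>t. 1 - \<delta> < t \<and> t < 1 \<longrightarrow>
        emeasure \<mu> {t..<1} * ennreal (ln (1 / (1 - t)) powr \<gamma>) \<le> ennreal (\<epsilon> * (1 - t) powr s))"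

definition cond_W :: "real measure \<Rightarrow> real \<Rightarrow> real \<Rightarrow> bool" where
  "cond_W \<mu> p \<alpha> \<longleftrightarrow>
     (p \<le> 1 \<longrightarrow> carleson \<mu> ((\<alpha> + 2) / p)) \<and>
     (1 \<le> p \<and> p \<le> 2 \<longrightarrow> carleson \<mu> ((\<alpha> + 2 - (p - 1)\<^sup>2) / p)) \<and>
     (2 \<le> p \<longrightarrow> carleson \<mu> ((\<alpha> + 1) / p))"

end

theory Submission
  imports Defs "HOL-Complex_Analysis.Complex_Analysis"
begin

text \<open>After summing the power series, the operator is \<open>f \<mapsto> \<integral> f(t) (1 - tz)\<^bsup>-\<beta>\<^esup> d\<mu>(t)\<close>. On the disc
  \<open>\<bar>1 - tz\<bar>\<close> is comparable to \<open>(1 - t) + \<bar>1 - z\<bar>\<close>, and the weighted area of \<open>{\<bar>1 - z\<bar> \<le> \<rho>}\<close> is at most a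
  constant times \<open>\<rho>\<^sup>\<beta>\<close>, so boundedness becomes a one-dimensional Hardy-type inequality, proved by
  Schur's test, combined with a Carleson embedding on the radius; both constants are small
  when only the tail \<open>[r0, 1)\<close> of a vanishing Carleson measure is kept, which gives compactness by
  normal families. Conversely, the image of a normalised test function concentrated at \<open>a\<close> is bounded
  below on discs \<open>\<bar>z - b\<bar> \<le> \<eta> (1 - b)\<close> with \<open>b \<le> a\<close>, whereas the limit of a convergent subsequence
  of such images has small norm near \<open>1\<close>. A single disc yields the power condition and, for \<open>q = 1\<close>,
  all dyadic discs together yield the logarithm.\<close>

section \<open>Planar Lebesgue measure\<close>

text \<open>Write q' for the exponent conjugate to q > 1. The two estimates behind sufficiency meet
  in L^r of mu with r = 1 + p/q'. Since r/p = 1/p + 1/q', embedding the Bergman space into L^r asks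
  for the Carleson exponent (\<alpha>+2)(1/p + 1/q'); since (\<beta>/q') r' = \<beta>(1/p + 1/q'),
  Schur's test from L^r into the target space asks for growth with that exponent. This is the origin
  of max{\<alpha>+2, \<beta>}; and p \<le> q is equivalent both to p \<le> r and to r \<le> q. The
  operator is defined by a double series, so its integral formula rests on convergence of the sum of
  |a_k| t^k against mu, which is stronger than integrability of f along the radius. Coefficients are
  therefore estimated by averages of |f| over annuli close to the circle. For p < 1 neither duality
  nor convexity is available; mean value and growth estimates for |f|^p take their place. Nearly all
  estimates live in the extended nonnegative reals, where Tonelli applies before anything is known
  to be finite.\<close>

lemma nn_integral_lborel_shift:
  fixes F :: "'a::euclidean_space \<Rightarrow> ennreal"
  assumes [measurable]: "F \<in> borel_measurable borel"
  shows "(\<integral>\<^sup>+x. F (c + x) \<partial>lborel) = (\<integral>\<^sup>+x. F x \<partial>lborel)"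
proof -
  have "(\<integral>\<^sup>+x. F x \<partial>lborel) = (\<integral>\<^sup>+x. F x \<partial>distr lborel borel ((+) c))"
    by (simp add: lborel_distr_plus)
  also have "\<dots> = (\<integral>\<^sup>+x. F (c + x) \<partial>lborel)"
    by (subst nn_integral_distr) simp_all
  finally show ?thesis by simp
qed

text \<open>Uniqueness of Haar measure: convolve with the unit ball, which \<open>T\<close> preserves.\<close>
lemma nn_integral_lborel_isometry:
  fixes T :: "'a::euclidean_space \<Rightarrow> 'a" and F :: "'a \<Rightarrow> ennreal"
  assumes T: "linear T" "\<And>x. norm (T x) = norm x" and F[measurable]: "F \<in> borel_measurable borel"
  shows "(\<integral>\<^sup>+x. F (T x) \<partial>lborel) = (\<integral>\<^sup>+x. F x \<partial>lborel)"
proof -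
  have inj: "inj T"
    using T by (metis linear_injective_0 norm_eq_zero)
  then have surj: "surj T" using linear_injective_imp_surjective T(1) by blast
  have [measurable]: "T \<in> borel \<rightarrow>\<^sub>M borel"
    by (intro borel_measurable_continuous_onI linear_continuous_on linear_conv_bounded_linear[THEN iffD1] T)
  define V where "V = emeasure lborel (cball (0::'a) 1)"
  have V: "V \<noteq> 0" "V \<noteq> \<infinity>"
    unfolding V_def using unit_ball_vol_pos[of "real DIM('a)"]
        by (auto simp: emeasure_cball ennreal_eq_0_iff not_le)
  define B :: "'a \<Rightarrow> ennreal" where "B = indicator (cball 0 1)"
  have [measurable]: "B \<in> borel_measurable borel"
    unfolding B_def by (intro borel_measurable_indicator) simp
  have VB: "V = (\<integral>\<^sup>+y. B y \<partial>lborel)" unfolding V_def B_def by simp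
  \<comment> \<open>\<open>T\<close> is onto, so translating by \<open>y\<close> after
    \<open>T\<close> amounts to translating by some \<open>c\<close> before it, and Lebesgue measure
    does not see the latter.\<close>
  have shiftT: "(\<integral>\<^sup>+x. F (T x + y) \<partial>lborel) = (\<integral>\<^sup>+x. F (T x) \<partial>lborel)" for y
  proof -
    obtain c where c: "y = T c" using surj by blast
    have "(\<integral>\<^sup>+x. F (T (c + x)) \<partial>lborel) = (\<integral>\<^sup>+x. F (T x) \<partial>lborel)"
      by (rule nn_integral_lborel_shift) simp
    then show ?thesis unfolding c by (simp add: linear_add[OF T(1)] add.commute)
  qed
  have "(\<integral>\<^sup>+x. F (T x) \<partial>lborel) * V = (\<integral>\<^sup>+y. B y * (\<integral>\<^sup>+x. F (T x + y) \<partial>lborel) \<partial>lborel)"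
    unfolding VB shiftT by (simp add: nn_integral_multc mult.commute)
  also have "\<dots> = (\<integral>\<^sup>+y. \<integral>\<^sup>+x. B y * F (T x + y) \<partial>lborel \<partial>lborel)"
    by (simp add: nn_integral_cmult)
  also have "\<dots> = (\<integral>\<^sup>+x. \<integral>\<^sup>+y. B y * F (T x + y) \<partial>lborel \<partial>lborel)"
    by (rule lborel_pair.Fubini') simp
  also have "\<dots> = (\<integral>\<^sup>+x. \<integral>\<^sup>+y. B (y - T x) * F y \<partial>lborel \<partial>lborel)"
  proof (rule nn_integral_cong)
    fix x :: 'a
    have "(\<integral>\<^sup>+y. (\<lambda>y. B (y - T x) * F y) (T x + y) \<partial>lborel) = (\<integral>\<^sup>+y. B (y - T x) * F y \<partial>lborel)"
      by (rule nn_integral_lborel_shift) simp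
    then show "(\<integral>\<^sup>+y. B y * F (T x + y) \<partial>lborel) = (\<integral>\<^sup>+y. B (y - T x) * F y \<partial>lborel)"
      by simp
  qed
  also have "\<dots> = (\<integral>\<^sup>+y. \<integral>\<^sup>+x. B (y - T x) * F y \<partial>lborel \<partial>lborel)"
    by (rule lborel_pair.Fubini') simp
  also have "\<dots> = (\<integral>\<^sup>+y. (\<integral>\<^sup>+x. B (y - T x) \<partial>lborel) * F y \<partial>lborel)"
    by (simp add: nn_integral_multc)
  also have "\<dots> = (\<integral>\<^sup>+y. V * F y \<partial>lborel)"
  proof (rule nn_integral_cong)
    fix y :: 'a
    obtain c where c: "y = T c" using surj by blast
    \<comment> \<open>Norm preservation gives |y - T x| = |c - x|, so the inner integral is once
      more the volume of the unit ball.\<close>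
    have "B (y - T x) = B (- c + x)" for x
      unfolding c linear_diff[OF T(1), symmetric] B_def
      by (auto simp: indicator_def T(2) norm_minus_commute)
    then have "(\<integral>\<^sup>+x. B (y - T x) \<partial>lborel) = (\<integral>\<^sup>+x. B (- c + x) \<partial>lborel)" by simp
    also have "\<dots> = V" unfolding VB by (rule nn_integral_lborel_shift) simp
    finally show "(\<integral>\<^sup>+x. B (y - T x) \<partial>lborel) * F y = V * F y" by simp
  qed
  also have "\<dots> = (\<integral>\<^sup>+x. F x \<partial>lborel) * V"
    by (simp add: nn_integral_cmult mult.commute)
  finally show ?thesis using V
    using mult_divide_eq_ennreal[of V] by (metis infinity_ennreal_def)
qed

text \<open>Each rotation is a linear isometry, so averaging over the angle changes nothing. This
  stands in for polar coordinates: a circle estimate valid at every z can be integrated over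
  area.\<close>

lemma nn_integral_rotation_average:
  fixes F :: "complex \<Rightarrow> ennreal"
  assumes [measurable]: "F \<in> borel_measurable borel"
  shows "(\<integral>\<^sup>+z. F z \<partial>lborel) = (\<integral>\<^sup>+z. (\<integral>\<^sup>+x\<in>{0..1}. F (cis (2 * pi * x) * z) \<partial>lborel) \<partial>lborel)"
proof -
  have [measurable]: "(\<lambda>x. cis (2 * pi * x)) \<in> borel_measurable borel"
    by (intro borel_measurable_continuous_onI continuous_intros)
  have rot: "(\<integral>\<^sup>+z. F (cis (2 * pi * x) * z) \<partial>lborel) = (\<integral>\<^sup>+z. F z \<partial>lborel)" for x
  proof (rule nn_integral_lborel_isometry)
    show "linear ((*) (cis (2 * pi * x)))"
      by (rule bounded_linear.linear[OF bounded_linear_mult_right])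
  qed (simp_all add: norm_mult)
  have "(\<integral>\<^sup>+z. (\<integral>\<^sup>+x\<in>{0..1}. F (cis (2 * pi * x) * z) \<partial>lborel) \<partial>lborel)
      = (\<integral>\<^sup>+x. (\<integral>\<^sup>+z. F (cis (2 * pi * x) * z) * indicator {0..1} x \<partial>lborel) \<partial>lborel)"
    by (rule lborel_pair.Fubini') simp
  also have "\<dots> = (\<integral>\<^sup>+x. (\<integral>\<^sup>+z. F z \<partial>lborel) * indicator {0..1::real} x \<partial>lborel)"
    by (simp add: nn_integral_multc rot)
  also have "\<dots> = (\<integral>\<^sup>+z. F z \<partial>lborel)"
    by (simp add: nn_integral_cmult)
  finally show ?thesis by simp
qed

lemma lborel_complex: "lborel = distr (lborel \<Otimes>\<^sub>M lborel) borel (\<lambda>(x, y). Complex x y)"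
proof (rule lborel_eqI)
  have [measurable]: "(\<lambda>(x, y). Complex x y) \<in> borel_measurable (lborel \<Otimes>\<^sub>M lborel)"
    unfolding Complex_eq case_prod_beta by measurable
  fix l u :: complex assume le: "\<And>b. b \<in> Basis \<Longrightarrow> l \<bullet> b \<le> u \<bullet> b"
  have "Re l \<le> Re u" "Im l \<le> Im u"
    using le[of 1] le[of \<i>] by (auto simp: Basis_complex_def inner_complex_def)
  have "(\<lambda>(x, y). Complex x y) -` box l u = {Re l<..<Re u} \<times> {Im l<..<Im u}"
    by (auto simp: box_def Basis_complex_def inner_complex_def)
  then have "emeasure (distr (lborel \<Otimes>\<^sub>M lborel) borel (\<lambda>(x, y). Complex x y)) (box l u)
     = emeasure (lborel \<Otimes>\<^sub>M lborel) ({Re l<..<Re u} \<times> {Im l<..<Im u})"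
    by (simp add: emeasure_distr space_pair_measure)
  also have "\<dots> = ennreal ((Re u - Re l) * (Im u - Im l))"
    using \<open>Re l \<le> Re u\<close> \<open>Im l \<le> Im u\<close> by (simp add: lborel.emeasure_pair_measure_Times ennreal_mult)
  finally show "emeasure (distr (lborel \<Otimes>\<^sub>M lborel) borel (\<lambda>(x, y). Complex x y)) (box l u) =
    ennreal (\<Prod>b\<in>Basis. (u - l) \<bullet> b)"
    by (simp add: Basis_complex_def inner_complex_def)
qed simp

text \<open>Slicing by horizontal lines, used to measure thin regions at the boundary point
  1.\<close>

lemma emeasure_lborel_complex:
  assumes [measurable]: "A \<in> sets (borel :: complex measure)"
  shows "emeasure lborel A = (\<integral>\<^sup>+y. emeasure lborel {x. Complex x y \<in> A} \<partial>lborel)"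
proof -
  have [measurable]: "(\<lambda>(x, y). Complex x y) \<in> borel_measurable (lborel \<Otimes>\<^sub>M lborel)"
    unfolding Complex_eq case_prod_beta by measurable
  have "emeasure lborel A = (\<integral>\<^sup>+z. indicator A z \<partial>lborel)" by simp
  also have "\<dots> = (\<integral>\<^sup>+p. indicator A (case p of (x, y) \<Rightarrow> Complex x y) \<partial>(lborel \<Otimes>\<^sub>M lborel))"
    by (subst lborel_complex, subst nn_integral_distr) auto
  also have "\<dots> = (\<integral>\<^sup>+y. \<integral>\<^sup>+x. indicator A (Complex x y) \<partial>lborel \<partial>lborel)"
    by (subst lborel_pair.nn_integral_snd[symmetric]) auto
  also have "\<dots> = (\<integral>\<^sup>+y. emeasure lborel {x. Complex x y \<in> A} \<partial>lborel)"
  proof (rule nn_integral_cong)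
    fix y :: real
    have [measurable]: "(\<lambda>x. Complex x y) \<in> borel \<rightarrow>\<^sub>M borel"
      unfolding Complex_eq by measurable
    have "(\<integral>\<^sup>+x. indicator A (Complex x y) \<partial>lborel) = (\<integral>\<^sup>+x. indicator {x. Complex x y \<in> A} x \<partial>lborel)"
      by (simp add: indicator_def)
    also have "\<dots> = emeasure lborel {x. Complex x y \<in> A}"
      by (rule nn_integral_indicator) measurable
    finally show "(\<integral>\<^sup>+x. indicator A (Complex x y) \<partial>lborel) = emeasure lborel {x. Complex x y \<in> A}" .
  qed
  finally show ?thesis .
qed

lemma emeasure_lborel_le_diameter:
  fixes S :: "real set"
  assumes "\<And>x y. x \<in> S \<Longrightarrow> y \<in> S \<Longrightarrow> \<bar>x - y\<bar> \<le> d" "0 \<le> d"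
  shows "emeasure lborel S \<le> ennreal (2 * d)"
proof (cases "S = {}")
  case False
  then obtain x where "x \<in> S" by blast
  then have "S \<subseteq> {x - d..x + d}" using assms(1)[of x] by (force simp: abs_le_iff)
  then have "emeasure lborel S \<le> emeasure lborel {x - d..x + d}"
    by (rule emeasure_mono) simp
  then show ?thesis using assms(2) by simp
qed simp

lemma emeasure_annulus:
  assumes "0 \<le> r" "r \<le> R"
  shows "emeasure lborel (cball (0::complex) R - ball 0 r) = ennreal (pi * (R\<^sup>2 - r\<^sup>2))"
proof -
  have "emeasure lborel (cball (0::complex) R - ball 0 r)
      = emeasure lborel (cball (0::complex) R) - emeasure lborel (ball (0::complex) r)"
    using assms by (intro emeasure_Diff) (auto simp: emeasure_ball)
  also have "\<dots> = ennreal (pi * R\<^sup>2) - ennreal (pi * r\<^sup>2)"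
    using assms by (simp add: emeasure_ball emeasure_cball unit_ball_vol_2)
  also have "\<dots> = ennreal (pi * R\<^sup>2 - pi * r\<^sup>2)"
    using assms by (intro ennreal_minus) auto
  finally show ?thesis by (simp add: algebra_simps)
qed

section \<open>Area measure and standard weights on the unit disc\<close>

definition disc :: "complex measure" where
  "disc = restrict_space lborel (ball 0 1)"

text \<open>The normalising factor of \<open>bergman_int\<close> is left out here;
  \<open>bergman_int_eq\<close> restores it.\<close>

definition wdisc :: "real \<Rightarrow> complex measure" where
  "wdisc \<gamma> = density disc (\<lambda>z. ennreal ((1 - (norm z)\<^sup>2) powr \<gamma>))"

abbreviation (input) bergman_mass :: "real \<Rightarrow> real \<Rightarrow> (complex \<Rightarrow> complex) \<Rightarrow> ennreal" where
  "bergman_mass p \<alpha> f \<equiv> (\<integral>\<^sup>+z. ennreal (norm (f z) powr p) \<partial>wdisc \<alpha>)"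

lemma space_disc [simp]: "space disc = ball 0 1" "space (wdisc \<gamma>) = ball 0 1"
  by (simp_all add: disc_def wdisc_def space_restrict_space)

lemma sets_wdisc [simp, measurable_cong]: "sets (wdisc \<gamma>) = sets disc"
  by (simp add: wdisc_def)

lemma sets_disc_iff: "A \<in> sets disc \<longleftrightarrow> A \<in> sets borel \<and> A \<subseteq> ball 0 1"
  unfolding disc_def by (auto simp: sets_restrict_space_iff)

lemma measurable_disc: "f \<in> borel_measurable borel \<Longrightarrow> f \<in> borel_measurable disc"
  unfolding disc_def by (rule measurable_restrict_space1) simp

lemma measurable_disc_ident [measurable]: "(\<lambda>z. z) \<in> borel_measurable disc"
  by (rule measurable_disc) simp

lemma continuous_on_measurable_disc:
  fixes f :: "complex \<Rightarrow> 'b::topological_space"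
  shows "continuous_on (ball 0 1) f \<Longrightarrow> f \<in> borel_measurable disc"
  using borel_measurable_continuous_on_restrict[of "ball 0 1" f]
    measurable_cong_sets[OF sets_restrict_space_cong[OF sets_lborel] refl]
  unfolding disc_def by blast

lemma nn_integral_disc: "(\<integral>\<^sup>+z. F z \<partial>disc) = (\<integral>\<^sup>+z\<in>ball 0 1. F z \<partial>lborel)"
  unfolding disc_def by (simp add: nn_integral_restrict_space)

lemma nn_integral_wdisc:
  assumes "F \<in> borel_measurable disc"
  shows "(\<integral>\<^sup>+z. F z \<partial>wdisc \<gamma>) = (\<integral>\<^sup>+z. ennreal ((1 - (norm z)\<^sup>2) powr \<gamma>) * F z \<partial>disc)"
  unfolding wdisc_def by (rule nn_integral_density[OF measurable_disc assms]) simp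

text \<open>For \<rho> \<le> 1/2 a horizontal slice at height y is empty unless |y| \<le> \<rho>;
  otherwise x \<ge> 1/2 on it and x^2 stays in an interval of length 2\<delta>, so its length is
  O(\<delta>). For larger \<rho> the area of the whole annulus, at most 8\<delta>, is already good
  enough.\<close>

lemma emeasure_thin_disc:
  assumes "0 < \<rho>" "0 < \<delta>"
  shows "emeasure disc {z \<in> ball 0 1. norm (1 - z) \<le> \<rho> \<and> 1 - norm z \<le> \<delta>} \<le> ennreal (16 * \<rho> * \<delta>)"
proof -
  define A where "A = {z \<in> ball (0::complex) 1. norm (1 - z) \<le> \<rho> \<and> 1 - norm z \<le> \<delta>}"
  have A[measurable]: "A \<in> sets borel"
    unfolding A_def by measurable
  have e: "emeasure disc A = emeasure lborel A"
    unfolding disc_def by (intro emeasure_restrict_space) (auto simp: A_def)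
  have "emeasure lborel A \<le> ennreal (16 * \<rho> * \<delta>)"
  proof (cases "\<rho> \<le> 1/2")
    case True
    have sect: "emeasure lborel {x. Complex x y \<in> A} \<le> ennreal (8 * \<delta>) * indicator {-\<rho>..\<rho>} y" for y
    proof (cases "\<bar>y\<bar> \<le> \<rho>")
      case False
      have "{x. Complex x y \<in> A} = {}"
      proof (rule ccontr)
        assume "{x. Complex x y \<in> A} \<noteq> {}"
        then obtain x where "norm (1 - Complex x y) \<le> \<rho>" by (auto simp: A_def)
        with abs_Im_le_cmod[of "1 - Complex x y"] False show False by simp
      qed
      then show ?thesis by simp
    next
      case y: True
      have key: "\<bar>x - x'\<bar> \<le> 4 * \<delta>" if "Complex x y \<in> A" "Complex x' y \<in> A" for x x'
      proof -
        have *: "1/2 \<le> x \<and> x\<^sup>2 + y\<^sup>2 \<le> 1 \<and> 1 - 2 * \<delta> \<le> x\<^sup>2 + y\<^sup>2" if "Complex x y \<in> A" for x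
        proof -
          have "\<bar>1 - x\<bar> \<le> \<rho>" using that abs_Re_le_cmod[of "1 - Complex x y"] by (simp add: A_def)
          then have "1/2 \<le> x" using True by linarith
          moreover have n: "x\<^sup>2 + y\<^sup>2 = (norm (Complex x y))\<^sup>2" by (simp add: cmod_power2)
          moreover have "norm (Complex x y) < 1" "1 - norm (Complex x y) \<le> \<delta>"
            using that unfolding A_def by auto
          moreover have "(norm (Complex x y))\<^sup>2 \<le> 1" using calculation by (simp add: power_le_one)
          moreover have "1 - 2 * \<delta> \<le> (norm (Complex x y))\<^sup>2"
          proof -
            have "2 * norm (Complex x y) - 1 \<le> (norm (Complex x y))\<^sup>2"
              using zero_le_power2[of "norm (Complex x y) - 1"] by (simp add: power2_eq_square algebra_simps)
            then show ?thesis using \<open>1 - norm (Complex x y) \<le> \<delta>\<close> by linarith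
          qed
          ultimately show ?thesis by linarith
        qed
        note x = *[OF that(1)] *[OF that(2)]
        \<comment> \<open>Both abscissas are at least 1/2, so x + x' \<ge> 1 and the difference of
          squares dominates |x - x'|.\<close>
        have "\<bar>x - x'\<bar> * 1 \<le> \<bar>x - x'\<bar> * (x + x')"
          using x by (intro mult_left_mono) auto
        also have "\<dots> = \<bar>x\<^sup>2 - x'\<^sup>2\<bar>"
          using x by (simp add: square_diff_square_factored power2_eq_square abs_mult)
        also have "\<dots> \<le> 2 * \<delta>" using x by linarith
        finally show ?thesis using assms by simp
      qed
      have "emeasure lborel {x. Complex x y \<in> A} \<le> ennreal (2 * (4 * \<delta>))"
        using key assms by (intro emeasure_lborel_le_diameter) auto
      then show ?thesis using y by (simp add: abs_le_iff)
    qed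
    have "emeasure lborel A \<le> (\<integral>\<^sup>+y. ennreal (8 * \<delta>) * indicator {-\<rho>..\<rho>} y \<partial>lborel)"
      by (subst emeasure_lborel_complex[OF A]) (intro nn_integral_mono sect)
    also have "\<dots> = ennreal (8 * \<delta>) * ennreal (2 * \<rho>)"
      using assms by (simp add: nn_integral_cmult)
    also have "\<dots> = ennreal (16 * \<rho> * \<delta>)"
      using assms by (simp add: ennreal_mult'[symmetric] algebra_simps)
    finally show ?thesis .
  next
    case False
    have "emeasure lborel A \<le> emeasure lborel (cball (0::complex) 1 - ball 0 (max 0 (1 - \<delta>)))"
    proof (rule emeasure_mono)
      show "A \<subseteq> cball 0 1 - ball 0 (max 0 (1 - \<delta>))"
      proof
        fix z assume "z \<in> A"
        then have "norm z < 1" "1 - \<delta> \<le> norm z" by (auto simp: A_def)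
        then show "z \<in> cball 0 1 - ball 0 (max 0 (1 - \<delta>))" by (auto simp: max_def)
      qed
    qed simp
    also have "\<dots> = ennreal (pi * (1 - (max 0 (1 - \<delta>))\<^sup>2))"
      using assms emeasure_annulus[of "max 0 (1 - \<delta>)" 1] by simp
    also have "\<dots> \<le> ennreal (4 * (2 * \<delta>))"
    proof (intro ennreal_leI mult_mono)
      show "1 - (max 0 (1 - \<delta>))\<^sup>2 \<le> 2 * \<delta>"
        using assms by (auto simp: max_def power2_eq_square algebra_simps)
      show "pi \<le> 4" using pi_less_4 by simp
      show "0 \<le> 1 - (max 0 (1 - \<delta>))\<^sup>2" using assms by (simp add: power_le_one)
    qed simp
    also have "\<dots> \<le> ennreal (16 * \<rho> * \<delta>)" using False assms by (intro ennreal_leI) simp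
    finally show ?thesis .
  qed
  then show ?thesis using e unfolding A_def by simp
qed

section \<open>Power weights against measures of polynomial growth\<close>

lemma powr_dyadic_bound:
  fixes x d A :: real
  assumes "d / 2 < x" "x \<le> d"
  shows "x powr A \<le> max 1 (2 powr (- A)) * d powr A"
proof (cases "A \<ge> 0")
  case True
  have "x powr A \<le> 1 * d powr A" using assms True by (simp add: powr_mono2)
  also have "\<dots> \<le> max 1 (2 powr (- A)) * d powr A" by (intro mult_right_mono) auto
  finally show ?thesis .
next
  case False
  have "x powr A \<le> (d / 2) powr A" using assms False by (intro powr_mono2') auto
  also have "\<dots> = 2 powr (- A) * d powr A" using assms by (simp add: powr_divide powr_minus field_simps)
  also have "\<dots> \<le> max 1 (2 powr (- A)) * d powr A" by (intro mult_right_mono) auto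
  finally show ?thesis .
qed

lemma term_le_suminf_ennreal: "f k \<le> suminf f" for f :: "nat \<Rightarrow> ennreal"
  using sum_le_suminf[of f "{k}"] by simp

text \<open>On the shell (d_k/2, d_k] with d_k = y \<theta>^k the weight is about d_k^A and the mass
  at most K d_k^\<sigma>, so the shells sum to a geometric series of ratio \<theta>^(A+\<sigma>).
  Small values of \<open>x\<close> call for \<theta> = 1/2, large ones for \<theta> = 2; the sign of
  \<open>A + \<sigma>\<close> decides which series converges.\<close>

lemma powr_weight_dyadic:
  fixes m :: "'a measure" and x :: "'a \<Rightarrow> real"
  assumes [measurable]: "x \<in> borel_measurable m"
    and growth: "\<And>d. 0 < d \<Longrightarrow> emeasure m {w \<in> space m. x w \<le> d} \<le> ennreal (K * d powr \<sigma>)"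
    and K: "0 \<le> K" and y: "0 < y" and \<theta>: "0 < \<theta>" "\<theta> powr (A + \<sigma>) < 1"
    and cover: "\<And>w. w \<in> S \<Longrightarrow> \<exists>k. y * \<theta> ^ k / 2 < x w \<and> x w \<le> y * \<theta> ^ k"
  shows "(\<integral>\<^sup>+w. ennreal (x w powr A) * indicator S w \<partial>m)
    \<le> ennreal (max 1 (2 powr (- A)) / (1 - \<theta> powr (A + \<sigma>)) * K * y powr (A + \<sigma>))"
proof -
  define c where "c = max 1 (2 powr (- A))"
  define d where "d k = y * \<theta> ^ k" for k :: nat
  have c: "0 < c" unfolding c_def by simp
  have d: "0 < d k" for k unfolding d_def using y \<theta> by simp
  have pt: "ennreal (x w powr A) * indicator S w
      \<le> (\<Sum>k. ennreal (c * d k powr A) * indicator {w \<in> space m. x w \<le> d k} w)" if "w \<in> space m" for w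
  proof (cases "w \<in> S")
    case True
    then obtain k where k: "d k / 2 < x w" "x w \<le> d k" using cover d_def by metis
    then have "x w powr A \<le> c * d k powr A" unfolding c_def by (rule powr_dyadic_bound)
    then have "ennreal (x w powr A) * indicator S w
        \<le> ennreal (c * d k powr A) * indicator {w \<in> space m. x w \<le> d k} w"
      using True k that by (simp add: ennreal_leI)
    also have "\<dots> \<le> (\<Sum>k. ennreal (c * d k powr A) * indicator {w \<in> space m. x w \<le> d k} w)"
      by (rule term_le_suminf_ennreal)
    finally show ?thesis .
  qed simp
  have "(\<integral>\<^sup>+w. ennreal (x w powr A) * indicator S w \<partial>m)
     \<le> (\<integral>\<^sup>+w. (\<Sum>k. ennreal (c * d k powr A) * indicator {w \<in> space m. x w \<le> d k} w) \<partial>m)"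
    by (intro nn_integral_mono pt)
  also have "\<dots> = (\<Sum>k. ennreal (c * d k powr A) * emeasure m {w \<in> space m. x w \<le> d k})"
    by (subst nn_integral_suminf) (auto intro!: suminf_cong simp: nn_integral_cmult)
  also have "\<dots> \<le> (\<Sum>k. ennreal (c * K * y powr (A + \<sigma>) * (\<theta> powr (A + \<sigma>)) ^ k))"
  proof (intro suminf_le summableI)
    fix k
    have "ennreal (c * d k powr A) * emeasure m {w \<in> space m. x w \<le> d k}
       \<le> ennreal (c * d k powr A) * ennreal (K * d k powr \<sigma>)"
      by (intro mult_left_mono growth d) auto
    also have "\<dots> = ennreal (c * K * d k powr (A + \<sigma>))"
      using c K by (simp add: ennreal_mult'[symmetric] powr_add algebra_simps)
    also have "d k powr (A + \<sigma>) = y powr (A + \<sigma>) * (\<theta> powr (A + \<sigma>)) ^ k"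
    proof -
      have "\<theta> ^ k = \<theta> powr real k" using \<theta>(1) by (simp add: powr_realpow)
      then show ?thesis unfolding d_def using \<theta>(1) by (simp add: powr_mult powr_powr powr_power mult.commute)
    qed
    finally show "ennreal (c * d k powr A) * emeasure m {w \<in> space m. x w \<le> d k}
       \<le> ennreal (c * K * y powr (A + \<sigma>) * (\<theta> powr (A + \<sigma>)) ^ k)" by (simp add: mult.assoc)
  qed
  also have "\<dots> = ennreal (\<Sum>k. c * K * y powr (A + \<sigma>) * (\<theta> powr (A + \<sigma>)) ^ k)"
    using c K \<theta> by (intro suminf_ennreal2) (auto intro!: summable_mult summable_geometric)
  also have "(\<Sum>k. c * K * y powr (A + \<sigma>) * (\<theta> powr (A + \<sigma>)) ^ k)
      = c * K * y powr (A + \<sigma>) * (1 / (1 - \<theta> powr (A + \<sigma>)))"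
    using \<theta> by (subst suminf_mult) (auto simp: suminf_geometric)
  finally show ?thesis unfolding c_def by (simp add: field_simps)
qed

lemma powr_weight_near:
  fixes m :: "'a measure" and x :: "'a \<Rightarrow> real"
  assumes "x \<in> borel_measurable m"
    and "\<And>d. 0 < d \<Longrightarrow> emeasure m {w \<in> space m. x w \<le> d} \<le> ennreal (K * d powr \<sigma>)"
    and "0 \<le> K" "0 < A + \<sigma>" and y: "0 < y"
  shows "(\<integral>\<^sup>+w. ennreal (x w powr A) * indicator {w. 0 < x w \<and> x w \<le> y} w \<partial>m)
    \<le> ennreal (max 1 (2 powr (- A)) / (1 - 2 powr (- (A + \<sigma>))) * K * y powr (A + \<sigma>))"
proof -
  have half: "(1 / 2) powr b = (2::real) powr (- b)" for b by (simp add: powr_divide powr_minus_divide)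
  have "\<exists>k. y * (1 / 2) ^ k / 2 < x w \<and> x w \<le> y * (1 / 2) ^ k" if w: "w \<in> {w. 0 < x w \<and> x w \<le> y}" for w
  proof -
    obtain n where "(1 / 2) ^ n < x w / y"
      using real_arch_pow_inv[of "x w / y" "1/2"] w y by auto
    then have ex: "\<exists>n. y * (1 / 2) ^ n < x w" using y by (auto simp: field_simps)
    \<comment> \<open>The least such \<open>n\<close> is not 0 because \<open>x w \<le> y\<close>;
      its predecessor is the scale looked for.\<close>
    define n where "n = (LEAST n. y * (1 / 2) ^ n < x w)"
    have n: "y * (1 / 2) ^ n < x w" unfolding n_def using ex by (rule LeastI_ex)
    then obtain k where k: "n = Suc k" using w by (cases n) auto
    then have "\<not> y * (1 / 2) ^ k < x w" using not_less_Least[of k "\<lambda>n. y * (1 / 2) ^ n < x w"] n_def by simp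
    then show ?thesis using n k by (intro exI[of _ k]) simp
  qed
  then show ?thesis
    using powr_weight_dyadic[OF assms(1-3) y, where \<theta> = "1 / 2" and A = A
        and S = "{w. 0 < x w \<and> x w \<le> y}"] assms(4)
    unfolding half by (simp add: powr_less_one)
qed

lemma powr_weight_far:
  fixes m :: "'a measure" and x :: "'a \<Rightarrow> real"
  assumes "x \<in> borel_measurable m"
    and "\<And>d. 0 < d \<Longrightarrow> emeasure m {w \<in> space m. x w \<le> d} \<le> ennreal (K * d powr \<sigma>)"
    and "0 \<le> K" "A + \<sigma> < 0" and y: "0 < y"
  shows "(\<integral>\<^sup>+w. ennreal (x w powr A) * indicator {w. y < x w} w \<partial>m)
    \<le> ennreal (max 1 (2 powr (- A)) * 2 powr (A + \<sigma>) / (1 - 2 powr (A + \<sigma>)) * K * y powr (A + \<sigma>))"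
proof -
  \<comment> \<open>The scales start at 2y since (y, 2y] is the first shell beyond y.\<close>
  have "\<exists>k. 2 * y * 2 ^ k / 2 < x w \<and> x w \<le> 2 * y * 2 ^ k" if w: "w \<in> {w. y < x w}" for w
  proof -
    obtain n where "x w / y < 2 ^ n"
      using real_arch_pow[of 2 "x w / y"] by auto
    then have ex: "\<exists>n. x w \<le> y * 2 ^ n" using y by (auto simp: field_simps intro!: exI[of _ n])
    define n where "n = (LEAST n. x w \<le> y * 2 ^ n)"
    have n: "x w \<le> y * 2 ^ n" unfolding n_def using ex by (rule LeastI_ex)
    then obtain k where k: "n = Suc k" using w by (cases n) auto
    then have "\<not> x w \<le> y * 2 ^ k" using not_less_Least[of k "\<lambda>n. x w \<le> y * 2 ^ n"] n_def by simp
    then show ?thesis using n k by (intro exI[of _ k]) simp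
  qed
  then show ?thesis
    using powr_weight_dyadic[OF assms(1-3), where y = "2 * y" and \<theta> = 2 and A = A
        and S = "{w. y < x w}"] assms(4) y
    by (simp add: powr_less_one powr_mult mult_ac)
qed

text \<open>The first summand is the constant of \<open>powr_weight_near\<close> for the exponent
  \<open>A\<close>, the second that of \<open>powr_weight_far\<close> for
  \<open>A - B\<close>.\<close>

definition weight_const :: "real \<Rightarrow> real \<Rightarrow> real \<Rightarrow> real" where
  "weight_const A B \<sigma> = max 1 (2 powr (- A)) / (1 - 2 powr (- (A + \<sigma>))) +
     max 1 (2 powr (- (A - B))) * 2 powr (A - B + \<sigma>) / (1 - 2 powr (A - B + \<sigma>))"

lemma weight_const_pos: "0 < A + \<sigma> \<Longrightarrow> A + \<sigma> < B \<Longrightarrow> 0 < weight_const A B \<sigma>"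
  unfolding weight_const_def
  by (intro add_pos_pos divide_pos_pos mult_pos_pos) (auto simp: powr_less_one powr_minus
      inverse_less_1_iff less_max_iff_disj)

text \<open>Split at x = y: below, x + y is replaced by y, above by x. The conditions
  \<open>0 < A + \<sigma>\<close> and \<open>A + \<sigma> < B\<close> make the two pieces converge,
  and both scale like y^(A+\<sigma>-B). It is applied on the radius with x = 1 - t and on the disc
  with x = |1 - z|.\<close>

lemma powr_weight_kernel:
  fixes m :: "'a measure" and x :: "'a \<Rightarrow> real"
  assumes [measurable]: "x \<in> borel_measurable m"
    and growth: "\<And>d. 0 < d \<Longrightarrow> emeasure m {w \<in> space m. x w \<le> d} \<le> ennreal (K * d powr \<sigma>)"
    and pos: "\<And>w. w \<in> space m \<Longrightarrow> 0 < x w"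
    and "0 \<le> K" "0 < A + \<sigma>" "A + \<sigma> < B" "0 \<le> B" "0 < y"
  shows "(\<integral>\<^sup>+w. ennreal (x w powr A * (x w + y) powr (- B)) \<partial>m)
    \<le> ennreal (weight_const A B \<sigma> * K * y powr (A + \<sigma> - B))"
proof -
  have "ennreal (x w powr A * (x w + y) powr (- B))
      \<le> ennreal (y powr (- B)) * (ennreal (x w powr A) * indicator {w. 0 < x w \<and> x w \<le> y} w)
        + ennreal (x w powr (A - B)) * indicator {w. y < x w} w" if "w \<in> space m" for w
  proof (cases "x w \<le> y")
    case True
    have "(x w + y) powr (- B) \<le> y powr (- B)" using assms pos[OF that] by (intro powr_mono2') auto
    then have "x w powr A * (x w + y) powr (- B) \<le> y powr (- B) * x w powr A"
      using mult_right_mono[of "(x w + y) powr (- B)" "y powr (- B)" "x w powr A"] by (simp add: mult.commute)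
    then show ?thesis using True pos[OF that] by (simp add: ennreal_mult'[symmetric] ennreal_leI)
  next
    case False
    have "(x w + y) powr (- B) \<le> x w powr (- B)" using assms pos[OF that] by (intro powr_mono2') auto
    then have "x w powr A * (x w + y) powr (- B) \<le> x w powr (A - B)"
      using mult_left_mono[of "(x w + y) powr (- B)" "x w powr (- B)" "x w powr A"]
          by (simp add: powr_add[symmetric])
    then show ?thesis using False by (simp add: ennreal_leI)
  qed
  then have "(\<integral>\<^sup>+w. ennreal (x w powr A * (x w + y) powr (- B)) \<partial>m)
    \<le> (\<integral>\<^sup>+w. ennreal (y powr (- B)) * (ennreal (x w powr A) * indicator {w. 0 < x w \<and> x w \<le> y} w)
        + ennreal (x w powr (A - B)) * indicator {w. y < x w} w \<partial>m)"
    by (intro nn_integral_mono)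
  also have "\<dots> = ennreal (y powr (- B)) * (\<integral>\<^sup>+w. ennreal (x w powr A) * indicator {w. 0 < x w \<and> x w \<le> y} w \<partial>m)
        + (\<integral>\<^sup>+w. ennreal (x w powr (A - B)) * indicator {w. y < x w} w \<partial>m)"
    by (subst nn_integral_add) (auto simp: nn_integral_cmult)
  also have "\<dots> \<le> ennreal (y powr (- B)) * ennreal (max 1 (2 powr (- A)) / (1 - 2 powr (- (A
      + \<sigma>))) * K * y powr (A + \<sigma>))
      + ennreal (max 1 (2 powr (- (A - B))) * 2 powr (A - B + \<sigma>) / (1 - 2 powr (A - B
          + \<sigma>)) * K * y powr (A - B + \<sigma>))"
    using assms by (intro add_mono mult_left_mono powr_weight_near powr_weight_far) auto
  also have "\<dots> = ennreal (y powr (- B) * (max 1 (2 powr (- A)) / (1 - 2 powr (- (A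
      + \<sigma>))) * K * y powr (A + \<sigma>))
      + max 1 (2 powr (- (A - B))) * 2 powr (A - B + \<sigma>) / (1 - 2 powr (A - B + \<sigma>)) * K * y powr (A - B + \<sigma>))"
    using assms by (subst ennreal_plus)
      (auto simp: ennreal_mult'[symmetric] powr_less_one powr_minus inverse_less_1_iff less_imp_le
        intro!: mult_nonneg_nonneg divide_nonneg_nonneg)
  also have "y powr (- B) * (max 1 (2 powr (- A)) / (1 - 2 powr (- (A + \<sigma>))) * K * y powr (A + \<sigma>))
      + max 1 (2 powr (- (A - B))) * 2 powr (A - B + \<sigma>) / (1 - 2 powr (A - B + \<sigma>)) * K * y powr (A - B + \<sigma>)
      = weight_const A B \<sigma> * K * y powr (A + \<sigma> - B)"
  proof -
    have "y powr (- B) * y powr (A + \<sigma>) = y powr (A + \<sigma> - B)" by (simp add: powr_add[symmetric] algebra_simps)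
    moreover have "A - B + \<sigma> = A + \<sigma> - B" by simp
    ultimately show ?thesis unfolding weight_const_def by (simp add: algebra_simps)
  qed
  finally show ?thesis .
qed

text \<open>The critical case, in which the decay of the kernel equals the growth exponent: every
  dyadic scale contributes the same amount, and about log(1/y) of them fit between y and 2.\<close>

lemma powr_weight_log:
  fixes m :: "'a measure" and x :: "'a \<Rightarrow> real"
  assumes [measurable]: "x \<in> borel_measurable m"
    and growth: "\<And>d. 0 < d \<Longrightarrow> emeasure m {w \<in> space m. x w \<le> d} \<le> ennreal (K * d powr \<sigma>)"
    and range: "\<And>w. w \<in> space m \<Longrightarrow> 0 \<le> x w \<and> x w \<le> 2"
    and "0 \<le> K" "0 < \<sigma>" "0 < y" "y \<le> 1"
  shows "(\<integral>\<^sup>+w. ennreal ((x w + y) powr (- \<sigma>)) \<partial>m) \<le> ennreal (4 * 2 powr \<sigma> * K * (1 + ln (1 / y)))"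
proof -
  define d where "d k = y * 2 ^ k" for k :: nat
  \<comment> \<open>After \<open>N\<close> doublings the scale has risen from y to at least 2, the
    upper bound for \<open>x\<close>.\<close>
  define N where "N = nat \<lceil>log 2 (2 / y)\<rceil>"
  have d: "0 < d k" for k unfolding d_def using assms by simp
  have "log 2 (2 / y) \<le> real N" unfolding N_def by linarith
  then have "2 / y \<le> 2 powr real N" using assms by (subst (asm) log_le_iff) auto
  then have N: "2 \<le> d N" using assms by (simp add: powr_realpow d_def field_simps)
  have ly: "0 \<le> ln (1 / y)" using assms by (simp add: ln_div)
  have "real N \<le> log 2 (2 / y) + 1" unfolding N_def using assms by (simp add: log_def ln_div) 
  also have "log 2 (2 / y) = 1 + ln (1 / y) / ln 2" using assms
      by (simp add: log_def ln_div diff_divide_distrib)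
  also have "ln (1 / y) / ln 2 \<le> 2 * ln (1 / y)"
  proof -
    have "1 / 2 \<le> ln (2::real)" using ln2_ge_two_thirds by simp
    then have "ln (1 / y) * 1 \<le> ln (1 / y) * (2 * ln 2)" using ly by (intro mult_left_mono) auto
    then show ?thesis by (simp add: field_simps)
  qed
  finally have N': "real N \<le> 2 + 2 * ln (1 / y)" by simp
  have pt: "ennreal ((x w + y) powr (- \<sigma>)) \<le> (\<Sum>k\<in>{..N}. ennreal ((d k / 2) powr (- \<sigma>))
      * indicator {w \<in> space m. x w \<le> d k} w)"
    if "w \<in> space m" for w
  proof -
    have ex: "\<exists>n. x w \<le> d n" using N range[OF that] by (intro exI[of _ N]) auto
    define n where "n = (LEAST n. x w \<le> d n)"
    have n: "x w \<le> d n" unfolding n_def using ex by (rule LeastI_ex)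
    have nN: "n \<le> N" unfolding n_def using N range[OF that] by (intro Least_le) auto
    \<comment> \<open>For n = 0 the summand y alone suffices; otherwise minimality gives
      \<open>x w\<close> > d (n - 1) = d n / 2.\<close>
    have "d n / 2 \<le> x w + y"
    proof (cases n)
      case 0 then show ?thesis using range[OF that] assms by (auto simp: d_def)
    next
      case (Suc k)
      then have "\<not> x w \<le> d k" using not_less_Least[of k "\<lambda>n. x w \<le> d n"] n_def by simp
      then show ?thesis using Suc assms by (auto simp: d_def)
    qed
    then have "(x w + y) powr (- \<sigma>) \<le> (d n / 2) powr (- \<sigma>)"
      using d[of n] assms by (intro powr_mono2') auto
    then have "ennreal ((x w + y) powr (- \<sigma>)) \<le> (\<Sum>k\<in>{n}. ennreal ((d k / 2) powr (- \<sigma>))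
        * indicator {w \<in> space m. x w \<le> d k} w)"
      using n that by (simp add: ennreal_leI)
    also have "\<dots> \<le> (\<Sum>k\<in>{..N}. ennreal ((d k / 2) powr (- \<sigma>)) * indicator {w \<in> space m. x w \<le> d k} w)"
      using nN by (intro sum_mono2) auto
    finally show ?thesis .
  qed
  have "(\<integral>\<^sup>+w. ennreal ((x w + y) powr (- \<sigma>)) \<partial>m)
      \<le> (\<integral>\<^sup>+w. (\<Sum>k\<in>{..N}. ennreal ((d k / 2) powr (- \<sigma>)) * indicator {w \<in> space m. x w \<le> d k} w) \<partial>m)"
    by (intro nn_integral_mono pt)
  also have "\<dots> = (\<Sum>k\<in>{..N}. ennreal ((d k / 2) powr (- \<sigma>)) * emeasure m {w \<in> space m. x w \<le> d k})"
    by (subst nn_integral_sum) (auto intro!: sum.cong simp: nn_integral_cmult)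
  also have "\<dots> \<le> (\<Sum>k\<in>{..N}. ennreal (2 powr \<sigma> * K))"
  proof (intro sum_mono)
    fix k
    have "ennreal ((d k / 2) powr (- \<sigma>)) * emeasure m {w \<in> space m. x w \<le> d k}
      \<le> ennreal ((d k / 2) powr (- \<sigma>)) * ennreal (K * d k powr \<sigma>)"
      by (intro mult_left_mono growth d) auto
    also have "\<dots> = ennreal (2 powr \<sigma> * K)"
      using d[of k] assms by (simp add: ennreal_mult'[symmetric] powr_divide powr_minus field_simps)
    finally show "ennreal ((d k / 2) powr (- \<sigma>)) * emeasure m {w \<in> space m. x w \<le> d k}
        \<le> ennreal (2 powr \<sigma> * K)" .
  qed
  also have "\<dots> = ennreal (real (Suc N) * (2 powr \<sigma> * K))"
    using assms by (simp add: ennreal_mult ennreal_of_nat_eq_real_of_nat)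
  also have "\<dots> \<le> ennreal (4 * 2 powr \<sigma> * K * (1 + ln (1 / y)))"
  proof (rule ennreal_leI)
    have "real (Suc N) * (2 powr \<sigma> * K) \<le> (4 * (1 + ln (1 / y))) * (2 powr \<sigma> * K)"
      using N' ly assms(4) by (intro mult_right_mono) (simp_all add: algebra_simps)
    then show "real (Suc N) * (2 powr \<sigma> * K) \<le> 4 * 2 powr \<sigma> * K * (1 + ln (1 / y))"
        by (simp add: algebra_simps)
  qed
  finally show ?thesis .
qed

section \<open>The weighted measures on the disc near a boundary point\<close>

text \<open>From 1 - n^2 = (1 + n)(1 - n) with 1 \<le> 1 + n < 2; the modulus in the exponent covers
  both signs of \<gamma>.\<close>

lemma disc_weight_bounds:
  fixes n \<gamma> :: real
  assumes "0 \<le> n" "n < 1"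
  shows "(1 - n\<^sup>2) powr \<gamma> \<le> 2 powr \<bar>\<gamma>\<bar> * (1 - n) powr \<gamma>"
    and "(1 - n) powr \<gamma> \<le> 2 powr \<bar>\<gamma>\<bar> * (1 - n\<^sup>2) powr \<gamma>"
proof -
  have e: "(1 - n\<^sup>2) powr \<gamma> = (1 + n) powr \<gamma> * (1 - n) powr \<gamma>"
    using assms by (subst powr_mult[symmetric]) (auto simp: power2_eq_square algebra_simps)
  have 1: "(1 + n) powr \<gamma> \<le> 2 powr \<bar>\<gamma>\<bar>"
  proof -
    have "(1 + n) powr \<gamma> \<le> (1 + n) powr \<bar>\<gamma>\<bar>" using assms by (intro powr_mono) auto
    also have "\<dots> \<le> 2 powr \<bar>\<gamma>\<bar>" using assms by (intro powr_mono2) auto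
    finally show ?thesis .
  qed
  have 2: "1 \<le> 2 powr \<bar>\<gamma>\<bar> * (1 + n) powr \<gamma>"
  proof -
    have "(1 + n) powr (- \<gamma>) \<le> (1 + n) powr \<bar>\<gamma>\<bar>" using assms by (intro powr_mono) auto
    also have "\<dots> \<le> 2 powr \<bar>\<gamma>\<bar>" using assms by (intro powr_mono2) auto
    finally have "(1 + n) powr (- \<gamma>) * (1 + n) powr \<gamma> \<le> 2 powr \<bar>\<gamma>\<bar> * (1 + n) powr \<gamma>"
      by (intro mult_right_mono) auto
    then show ?thesis using assms by (simp add: powr_add[symmetric])
  qed
  show "(1 - n\<^sup>2) powr \<gamma> \<le> 2 powr \<bar>\<gamma>\<bar> * (1 - n) powr \<gamma>"
    unfolding e using 1 by (intro mult_right_mono) auto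
  have "1 * (1 - n) powr \<gamma> \<le> (2 powr \<bar>\<gamma>\<bar> * (1 + n) powr \<gamma>) * (1 - n) powr \<gamma>"
    using 2 by (intro mult_right_mono) auto
  then show "(1 - n) powr \<gamma> \<le> 2 powr \<bar>\<gamma>\<bar> * (1 - n\<^sup>2) powr \<gamma>"
    unfolding e by (simp add: mult.assoc)
qed

text \<open>Inside |1 - z| \<le> \<rho> the thin-disc estimate says that 1 - |z| has linear growth
  with constant 16\<rho>. Integrating (1 - |z|)^\<gamma> up to \<rho> against this gives \<rho>
  times \<rho>^(\<gamma>+1); convergence at the circle is where \<open>-1 < \<gamma>\<close>
  enters.\<close>

lemma emeasure_wdisc_near_one:
  assumes "-1 < \<gamma>"
  obtains V where "0 < V"
    "\<And>\<rho>. 0 < \<rho> \<Longrightarrow> emeasure (wdisc \<gamma>) {z \<in> space (wdisc \<gamma>). norm (1 - z) \<le> \<rho>} \<le> ennreal (V * \<rho> powr (\<gamma> + 2))"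
proof
  define c where "c = max 1 (2 powr (- \<gamma>)) / (1 - 2 powr (- (\<gamma> + 1))) * 16"
  have c: "0 < c" unfolding c_def
    using assms by (intro mult_pos_pos divide_pos_pos) (auto simp: powr_less_one less_max_iff_disj)
  show "0 < 2 powr \<bar>\<gamma>\<bar> * c" using c by simp
  fix \<rho> :: real assume \<rho>: "0 < \<rho>"
  define S where "S = {z \<in> ball (0::complex) 1. norm (1 - z) \<le> \<rho>}"
  have S: "S \<in> sets disc"
    unfolding sets_disc_iff S_def by auto
  define m where "m = density disc (indicator S)"
  have sm: "sets m = sets disc" "space m = ball 0 1" unfolding m_def by auto
  have x: "(\<lambda>z. 1 - norm z) \<in> borel_measurable disc" by (intro measurable_disc) measurable
  have xm: "(\<lambda>z. 1 - norm z) \<in> borel_measurable m"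
    using x by (simp add: measurable_cong_sets[OF sm(1) refl])
  have growth: "emeasure m {z \<in> space m. 1 - norm z \<le> d} \<le> ennreal (16 * \<rho> * d powr 1)" if "0 < d" for d
  proof -
    have "{z \<in> space disc. 1 - norm z \<le> d} \<in> sets disc" using x by measurable
    then have "emeasure m {z \<in> space m. 1 - norm z \<le> d} = emeasure disc (S \<inter> {z \<in> space disc. 1 - norm z
        \<le> d})"
      using S sm unfolding m_def
      by (subst emeasure_density) (auto simp: nn_integral_indicator[symmetric]
          indicator_inter_arith[symmetric] simp del: nn_integral_indicator intro!: nn_integral_cong)
    also have "S \<inter> {z \<in> space disc. 1 - norm z \<le> d} = {z \<in> ball 0 1. norm (1 - z) \<le> \<rho> \<and> 1 - norm z \<le> d}"
      by (auto simp: S_def)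
    finally show ?thesis using emeasure_thin_disc[OF \<rho> that] that by simp
  qed
  have near: "(\<integral>\<^sup>+z. ennreal ((1 - norm z) powr \<gamma>) * indicator {z. 0 < 1 - norm z \<and> 1 - norm z \<le> \<rho>} z \<partial>m)
     \<le> ennreal (max 1 (2 powr (- \<gamma>)) / (1 - 2 powr (- (\<gamma> + 1))) * (16 * \<rho>) * \<rho> powr (\<gamma> + 1))"
    using assms \<rho> by (intro powr_weight_near[OF xm growth]) auto
  have Sw: "{z \<in> space (wdisc \<gamma>). norm (1 - z) \<le> \<rho>} = S" unfolding S_def by auto
  have wm: "(\<lambda>z. ennreal ((1 - (norm z)\<^sup>2) powr \<gamma>)) \<in> borel_measurable disc"
    by (rule measurable_disc) measurable
  have "emeasure (wdisc \<gamma>) S = (\<integral>\<^sup>+z. ennreal ((1 - (norm z)\<^sup>2) powr \<gamma>) * indicator S z \<partial>disc)"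
    unfolding wdisc_def by (rule emeasure_density[OF wm S])
  also have "\<dots> \<le> (\<integral>\<^sup>+z. indicator S z * (ennreal (2 powr \<bar>\<gamma>\<bar>) * (ennreal ((1 - norm z) powr \<gamma>)
      * indicator {z. 0 < 1 - norm z \<and> 1 - norm z \<le> \<rho>} z)) \<partial>disc)"
  proof (intro nn_integral_mono)
    fix z :: complex assume "z \<in> space disc"
    show "ennreal ((1 - (norm z)\<^sup>2) powr \<gamma>) * indicator S z
      \<le> indicator S z * (ennreal (2 powr \<bar>\<gamma>\<bar>) * (ennreal ((1 - norm z) powr \<gamma>)
          * indicator {z. 0 < 1 - norm z \<and> 1 - norm z \<le> \<rho>} z))"
    proof (cases "z \<in> S")
      case True
      then have "norm z < 1" "norm (1 - z) \<le> \<rho>" by (auto simp: S_def)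
      then have "1 - norm z \<le> \<rho>" using norm_triangle_ineq2[of 1 z] by simp
      then show ?thesis using True disc_weight_bounds(1)[of "norm z" \<gamma>] \<open>norm z < 1\<close>
        by (simp add: ennreal_mult'[symmetric] ennreal_leI)
    qed simp
  qed
  also have "\<dots> = (\<integral>\<^sup>+z. ennreal (2 powr \<bar>\<gamma>\<bar>) * (ennreal ((1 - norm z) powr \<gamma>)
      * indicator {z. 0 < 1 - norm z \<and> 1 - norm z \<le> \<rho>} z) \<partial>m)"
    unfolding m_def
    by (rule nn_integral_density[symmetric]) (use S in \<open>auto intro!: measurable_disc\<close>)
  also have "\<dots> = ennreal (2 powr \<bar>\<gamma>\<bar>) * (\<integral>\<^sup>+z. (ennreal ((1 - norm z) powr \<gamma>)
      * indicator {z. 0 < 1 - norm z \<and> 1 - norm z \<le> \<rho>} z) \<partial>m)"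
    by (rule nn_integral_cmult, subst measurable_cong_sets[OF sm(1) refl], rule measurable_disc, measurable)
  also have "\<dots> \<le> ennreal (2 powr \<bar>\<gamma>\<bar>) * ennreal (max 1 (2 powr (- \<gamma>)) / (1 - 2 powr (- (\<gamma>
      + 1))) * (16 * \<rho>) * \<rho> powr (\<gamma> + 1))"
    by (intro mult_left_mono near) simp
  also have "\<dots> = ennreal (2 powr \<bar>\<gamma>\<bar> * c * \<rho> powr (\<gamma> + 2))"
  proof -
    have "\<rho> * \<rho> powr (\<gamma> + 1) = \<rho> powr (\<gamma> + 2)"
      using \<rho> powr_add[of \<rho> 1 "\<gamma> + 1"] by (simp add: add.commute add.left_commute)
    then show ?thesis unfolding c_def by (simp add: ennreal_mult'[symmetric] mult_ac flip: \<open>\<rho>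
        * \<rho> powr (\<gamma> + 1) = \<rho> powr (\<gamma> + 2)\<close>)
  qed
  finally show "emeasure (wdisc \<gamma>) {z \<in> space (wdisc \<gamma>). norm (1 - z) \<le> \<rho>}
      \<le> ennreal (2 powr \<bar>\<gamma>\<bar> * c * \<rho> powr (\<gamma> + 2))"
    unfolding Sw .
qed

lemma finite_wdisc:
  assumes "-1 < \<gamma>"
  shows "finite_measure (wdisc \<gamma>)"
proof
  \<comment> \<open>Radius 2 about the point 1 covers the whole disc.\<close>
  obtain V where V: "0 < V" "emeasure (wdisc \<gamma>) {z \<in> space (wdisc \<gamma>). norm (1 - z) \<le> 2}
      \<le> ennreal (V * 2 powr (\<gamma> + 2))"
    using emeasure_wdisc_near_one[OF assms] by (metis zero_less_numeral)
  have "norm (1 - z) \<le> 2" if "norm z < 1" for z :: complex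
    using norm_triangle_ineq4[of 1 z] that by simp
  then have "{z \<in> space (wdisc \<gamma>). norm (1 - z) \<le> 2} = space (wdisc \<gamma>)" by auto
  with V(2) show "emeasure (wdisc \<gamma>) (space (wdisc \<gamma>)) \<noteq> \<infinity>"
    by (auto simp: top_unique)
qed

lemma finite_disc: "finite_measure disc"
proof
  have "emeasure disc (ball 0 1) = emeasure lborel (ball (0::complex) 1)"
    unfolding disc_def by (intro emeasure_restrict_space) auto
  then show "emeasure disc (space disc) \<noteq> \<infinity>" by (simp add: emeasure_ball)
qed

lemma nn_integral_disc_radial_powr_finite:
  assumes "-1 < \<gamma>"
  shows "(\<integral>\<^sup>+z. ennreal ((1 - norm z) powr \<gamma>) \<partial>disc) < \<infinity>"
proof -
  have m: "(\<lambda>z. ennreal ((1 - (norm z)\<^sup>2) powr \<gamma>)) \<in> borel_measurable disc"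
    by (rule measurable_disc) measurable
  have "(\<integral>\<^sup>+z. ennreal ((1 - norm z) powr \<gamma>) \<partial>disc)
      \<le> (\<integral>\<^sup>+z. ennreal (2 powr \<bar>\<gamma>\<bar>) * ennreal ((1 - (norm z)\<^sup>2) powr \<gamma>) \<partial>disc)"
    using disc_weight_bounds(2)
    by (intro nn_integral_mono) (auto simp: ennreal_mult'[symmetric] intro!: ennreal_leI)
  also have "\<dots> = ennreal (2 powr \<bar>\<gamma>\<bar>) * (\<integral>\<^sup>+z. ennreal ((1 - (norm z)\<^sup>2) powr \<gamma>) \<partial>disc)"
    by (rule nn_integral_cmult[OF m])
  also have "(\<integral>\<^sup>+z. ennreal ((1 - (norm z)\<^sup>2) powr \<gamma>) \<partial>disc) = (\<integral>\<^sup>+z. 1 \<partial>wdisc \<gamma>)"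
    by (subst nn_integral_wdisc) auto
  also have "\<dots> = emeasure (wdisc \<gamma>) (space (wdisc \<gamma>))" by simp
  also have "ennreal (2 powr \<bar>\<gamma>\<bar>) * \<dots> < \<infinity>"
    using finite_measure.emeasure_finite[OF finite_wdisc[OF assms], of "ball 0 1"]
    by (simp add: ennreal_mult_less_top less_top)
  finally show ?thesis .
qed

text \<open>Writing 1 - z = (1 - tz) - (1 - t)z bounds |1 - z| by 2|1 - tz|, because 1 - t \<le> |1
  - tz|; the same inequality supplies the third copy.\<close>

lemma kernel_comparison:
  fixes z :: complex and t :: real
  assumes "norm z < 1" "0 \<le> t" "t < 1"
  shows "(1 - t) + norm (1 - z) \<le> 3 * norm (1 - of_real t * z)" "0 < norm (1 - of_real t * z)"
    "1 - norm z \<le> norm (1 - of_real t * z)" "1 - t \<le> norm (1 - of_real t * z)"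
proof -
  have n: "norm (of_real t * z) = t * norm z" using assms by (simp add: norm_mult)
  have "1 - t * norm z \<le> norm (1 - of_real t * z)"
    using norm_triangle_ineq2[of 1 "of_real t * z"] n by simp
  moreover have "t * norm z \<le> t" "t * norm z \<le> norm z"
    using assms by (auto simp: mult_left_le mult_left_le_one_le)
  ultimately show 1: "1 - norm z \<le> norm (1 - of_real t * z)" and 2: "1 - t \<le> norm (1 - of_real t * z)"
    by auto
  show "0 < norm (1 - of_real t * z)" using 2 assms by linarith
  have e: "1 - z = (1 - of_real t * z) - of_real (1 - t) * z" by (simp add: algebra_simps)
  have "norm (of_real (1 - t) * z) = (1 - t) * norm z"
    using assms by (simp only: norm_mult norm_of_real)
  then have "norm (1 - z) \<le> norm (1 - of_real t * z) + (1 - t) * norm z"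
    using norm_triangle_ineq4[of "1 - of_real t * z" "of_real (1 - t) * z"] unfolding e[symmetric] by simp
  moreover have "(1 - t) * norm z \<le> 1 - t" using assms by (simp add: mult_left_le)
  ultimately show "(1 - t) + norm (1 - z) \<le> 3 * norm (1 - of_real t * z)" using 2 by linarith
qed

section \<open>Mean value estimates\<close>

text \<open>Integrating the tangent line inequality for \<open>t \<mapsto> t\<^sup>s\<close> at the mean value gives Jensen's inequality
  in a form that needs neither integrability of \<open>\<phi>\<close> nor a normalised weight.\<close>
lemma jensen_powr_nn_integral:
  fixes \<phi> w :: "'a \<Rightarrow> real"
  assumes [measurable]: "\<phi> \<in> borel_measurable m" "w \<in> borel_measurable m"
    and pos: "\<And>x. x \<in> space m \<Longrightarrow> 0 \<le> \<phi> x" "\<And>x. x \<in> space m \<Longrightarrow> 0 \<le> w x"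
    and W: "(\<integral>\<^sup>+x. ennreal (w x) \<partial>m) \<le> ennreal W" "0 < W"
    and s: "1 \<le> s" and i: "0 \<le> i" "ennreal i \<le> (\<integral>\<^sup>+x. ennreal (\<phi> x * w x) \<partial>m)"
  shows "ennreal (i powr s) \<le> ennreal (W powr (s - 1)) * (\<integral>\<^sup>+x. ennreal (\<phi> x powr s * w x) \<partial>m)"
proof (cases "i = 0")
  case False
  then have i0: "0 < i" using i by simp
  define l where "l = i / W"
  have l: "0 < l" unfolding l_def using i0 W by simp
  \<comment> \<open>The tangent line at \<open>l\<close> is read off from Young's inequality with
    conjugate exponents s and s/(s-1), applied to t and l^(s-1).\<close>
  have tangent: "s * l powr (s - 1) * t \<le> t powr s + (s - 1) * l powr s" if "0 \<le> t" for t
  proof (cases "s = 1")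
    case True then show ?thesis using that l by simp
  next
    case False
    then have s1: "1 < s" using s by simp
    have "t * l powr (s - 1) \<le> t powr s / s + (l powr (s - 1)) powr (s / (s - 1)) / (s / (s - 1))"
      using s1 that by (intro Youngs_inequality) (auto simp: field_simps)
    also have "(l powr (s - 1)) powr (s / (s - 1)) = l powr s" using s1 by (simp add: powr_powr)
    finally show ?thesis using s1 by (simp add: field_simps)
  qed
  have "ennreal (s * l powr (s - 1) * i) = ennreal (s * l powr (s - 1)) * ennreal i"
    using s by (simp add: ennreal_mult')
  also have "\<dots> \<le> ennreal (s * l powr (s - 1)) * (\<integral>\<^sup>+x. ennreal (\<phi> x * w x) \<partial>m)"
    by (intro mult_left_mono i) simp
  also have "\<dots> = (\<integral>\<^sup>+x. ennreal (s * l powr (s - 1)) * ennreal (\<phi> x * w x) \<partial>m)"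
    by (simp add: nn_integral_cmult)
  also have "\<dots> \<le> (\<integral>\<^sup>+x. ennreal (\<phi> x powr s * w x) + ennreal ((s - 1) * l powr s) * ennreal (w x) \<partial>m)"
  proof (intro nn_integral_mono)
    fix x assume x: "x \<in> space m"
    have "(s * l powr (s - 1) * \<phi> x) * w x \<le> (\<phi> x powr s + (s - 1) * l powr s) * w x"
      using pos x by (intro mult_right_mono tangent) auto
    then have "ennreal (s * l powr (s - 1) * (\<phi> x * w x))
        \<le> ennreal (\<phi> x powr s * w x + (s - 1) * l powr s * w x)"
      by (intro ennreal_leI) (simp add: algebra_simps)
    then show "ennreal (s * l powr (s - 1)) * ennreal (\<phi> x * w x)
        \<le> ennreal (\<phi> x powr s * w x) + ennreal ((s - 1) * l powr s) * ennreal (w x)"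
      using pos[OF x] s by (simp add: ennreal_mult')
  qed
  also have "\<dots> = (\<integral>\<^sup>+x. ennreal (\<phi> x powr s * w x) \<partial>m)
      + ennreal ((s - 1) * l powr s) * (\<integral>\<^sup>+x. ennreal (w x) \<partial>m)"
    by (subst nn_integral_add) (auto simp: nn_integral_cmult)
  also have "\<dots> \<le> (\<integral>\<^sup>+x. ennreal (\<phi> x powr s * w x) \<partial>m) + ennreal ((s - 1) * l powr s) * ennreal W"
    using W by (intro add_left_mono mult_left_mono) auto
  finally have le: "ennreal (s * l powr (s - 1) * i)
      \<le> (\<integral>\<^sup>+x. ennreal (\<phi> x powr s * w x) \<partial>m) + ennreal ((s - 1) * l powr s * W)"
    using s W by (simp add: ennreal_mult')
  have e1: "s * l powr (s - 1) * i = s * (l powr s * W)"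
    unfolding l_def using i0 W by (simp add: powr_diff)
  \<comment> \<open>The term (s-1) l^s W can be subtracted once the integral is finite; an infinite
    integral leaves nothing to show.\<close>
  have "ennreal (l powr s * W) \<le> (\<integral>\<^sup>+x. ennreal (\<phi> x powr s * w x) \<partial>m)"
  proof (cases "(\<integral>\<^sup>+x. ennreal (\<phi> x powr s * w x) \<partial>m)")
    case (real v)
    then have "s * (l powr s * W) \<le> v + (s - 1) * l powr s * W"
      using le s W unfolding e1 by (simp add: ennreal_plus[symmetric] del: ennreal_plus)
    then have "l powr s * W \<le> v" by (simp add: algebra_simps)
    then show ?thesis unfolding real(2) by (rule ennreal_leI)
  qed simp
  then have "ennreal (W powr (s - 1)) * ennreal (l powr s * W)
      \<le> ennreal (W powr (s - 1)) * (\<integral>\<^sup>+x. ennreal (\<phi> x powr s * w x) \<partial>m)"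
    by (intro mult_left_mono) auto
  moreover have "W powr (s - 1) * (l powr s * W) = i powr s"
    unfolding l_def using i0 W by (simp add: powr_diff powr_divide)
  ultimately show ?thesis by (simp add: ennreal_mult'[symmetric])
qed (use s in simp)

text \<open>Cauchy's formula on the unit circle, parametrised over [0,1] so that the bound fits the
  inner integral of \<open>nn_integral_rotation_average\<close>.\<close>

lemma norm_taylor_coeff_le_average:
  assumes hol: "g holomorphic_on S" and S: "open S" "cball 0 1 \<subseteq> S"
  shows "ennreal (norm (taylor_coeff g k)) \<le> (\<integral>\<^sup>+x\<in>{0..1}. ennreal (norm (g (cis (2 * pi * x)))) \<partial>lborel)"
proof -
  have cont: "continuous_on (cball 0 1) g"
    using hol S holomorphic_on_imp_continuous_on continuous_on_subset by blast
  have cp: "circlepath 0 1 x = cis (2 * pi * x)" for x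
    by (simp add: circlepath cis_conv_exp mult_ac)
  \<comment> \<open>The Cauchy integrand after inserting \<open>circlepath 0 1\<close> and its
    derivative.\<close>
  define f0 where "f0 x = g (cis (2 * pi * x)) / cis (2 * pi * x) ^ Suc k * (2 * pi * \<i> * cis (2 * pi
      * x))" for x
  have "((\<lambda>u. g u / (u - 0) ^ Suc k) has_contour_integral (2 * pi * \<i>) / fact k
      * (deriv ^^ k) g 0) (circlepath 0 1)"
    using S(2) by (intro Cauchy_has_contour_integral_higher_derivative_circlepath cont
        holomorphic_on_subset[OF hol]) (auto intro: order_trans[OF ball_subset_cball])
  then have hi: "(f0 has_integral (2 * pi * \<i>) / fact k * (deriv ^^ k) g 0) {0..1}"
    unfolding has_contour_integral_def f0_def
    by (rule has_integral_eq[rotated])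
      (simp add: vector_derivative_circlepath01 cp, simp add: cis_conv_exp mult_ac)
  have cf0: "continuous_on {0..1} f0"
    unfolding f0_def
    by (intro continuous_intros continuous_on_compose2[OF cont]) auto
  have si: "set_integrable lborel {0..1} f0"
    by (rule borel_integrable_atLeastAtMost') (rule cf0)
  have "(LINT x:{0..1}|lborel. f0 x) = (2 * pi * \<i>) / fact k * (deriv ^^ k) g 0"
    using set_borel_integral_eq_integral(2)[OF si] integral_unique[OF hi] by simp
  then have "ennreal (norm ((2 * pi * \<i>) / fact k * (deriv ^^ k) g 0))
      \<le> (\<integral>\<^sup>+x. ennreal (norm (indicator {0..1} x *\<^sub>R f0 x)) \<partial>lborel)"
    using integral_norm_bound_ennreal[OF si[unfolded set_integrable_def]]
        unfolding set_lebesgue_integral_def by simp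
  also have "\<dots> = (\<integral>\<^sup>+x. ennreal (2 * pi) * (ennreal (norm (g (cis (2 * pi * x))))
      * indicator {0..1} x) \<partial>lborel)"
    by (intro nn_integral_cong)
      (auto simp: f0_def norm_mult norm_divide norm_power ennreal_mult'[symmetric] indicator_def mult_ac)
  also have "\<dots> = ennreal (2 * pi) * (\<integral>\<^sup>+x\<in>{0..1}. ennreal (norm (g (cis (2 * pi * x)))) \<partial>lborel)"
  proof (rule nn_integral_cmult)
    have "continuous_on {0..1} (\<lambda>x::real. norm (g (cis (2 * pi * x))))"
      by (intro continuous_intros continuous_on_compose2[OF cont]) auto
    then have "(\<lambda>x::real. indicator {0..1} x *\<^sub>R norm (g (cis (2 * pi * x)))) \<in> borel_measurable borel"
      by (intro borel_measurable_continuous_on_indicator) auto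
    then have "(\<lambda>x::real. ennreal (indicator {0..1} x *\<^sub>R norm (g (cis (2 * pi
        * x))))) \<in> borel_measurable lborel"
      by simp
    then show "(\<lambda>x. ennreal (norm (g (cis (2 * pi * x)))) * indicator {0..1} x) \<in> borel_measurable lborel"
      by (rule measurable_cong[THEN iffD1, rotated]) (auto simp: indicator_def)
  qed
  also have "norm ((2 * pi * \<i>) / fact k * (deriv ^^ k) g 0) = 2 * pi * norm (taylor_coeff g k)"
    by (simp add: taylor_coeff_def norm_mult norm_divide)
  finally have "ennreal (2 * pi) * ennreal (norm (taylor_coeff g k))
      \<le> ennreal (2 * pi) * (\<integral>\<^sup>+x\<in>{0..1}. ennreal (norm (g (cis (2 * pi * x)))) \<partial>lborel)"
    by (simp add: ennreal_mult'[symmetric])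
  then show ?thesis
    by (subst (asm) ennreal_mult_le_mult_iff) auto
qed

text \<open>For z in \<open>E\<close> the function u -> g(zu) has k-th coefficient z^k a_k, and on
  the unit circle it takes the values of g on the orbit of z, which stays in \<open>E\<close>.
  Integrating the circle estimate over z and undoing the rotation average gives an area estimate.
  Discs with k = 0 yield the mean value property, thin annuli the coefficient bounds.\<close>

lemma taylor_coeff_area_bound:
  assumes hol: "g holomorphic_on ball 0 R"
    and E: "E \<in> sets borel" "E \<subseteq> ball 0 R" "\<And>z \<theta>. z \<in> E \<Longrightarrow> cis \<theta> * z \<in> E"
  shows "ennreal (norm (taylor_coeff g k)) * (\<integral>\<^sup>+z\<in>E. ennreal (norm z ^ k) \<partial>lborel)
     \<le> (\<integral>\<^sup>+z\<in>E. ennreal (norm (g z)) \<partial>lborel)"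
proof -
  define F where "F z = ennreal (norm (g z)) * indicator E z" for z
  have cont: "continuous_on E (\<lambda>z. norm (g z))"
    using hol E holomorphic_on_imp_continuous_on continuous_on_subset by (intro continuous_intros) blast
  have "(\<lambda>z. indicator E z *\<^sub>R norm (g z)) \<in> borel_measurable borel"
    by (intro borel_measurable_continuous_on_indicator E cont)
  then have "(\<lambda>z. ennreal (indicator E z *\<^sub>R norm (g z))) \<in> borel_measurable borel" by measurable
  then have F: "F \<in> borel_measurable borel"
    by (rule measurable_cong[THEN iffD1, rotated]) (auto simp: F_def indicator_def)
  have "ennreal (norm (taylor_coeff g k)) * (\<integral>\<^sup>+z\<in>E. ennreal (norm z ^ k) \<partial>lborel)
     = (\<integral>\<^sup>+z. ennreal (norm (taylor_coeff g k)) * (ennreal (norm z ^ k) * indicator E z) \<partial>lborel)"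
    using E(1) by (intro nn_integral_cmult[symmetric] borel_measurable_times_ennreal
        borel_measurable_indicator) auto
  also have "\<dots> \<le> (\<integral>\<^sup>+z. (\<integral>\<^sup>+x\<in>{0..1}. F (cis (2 * pi * x) * z) \<partial>lborel) \<partial>lborel)"
  proof (intro nn_integral_mono)
    fix z :: complex
    show "ennreal (norm (taylor_coeff g k)) * (ennreal (norm z ^ k) * indicator E z)
        \<le> (\<integral>\<^sup>+x\<in>{0..1}. F (cis (2 * pi * x) * z) \<partial>lborel)"
    proof (cases "z \<in> E")
      case True
      define S where "S = (\<lambda>u. z * u) -` ball 0 R"
      have "norm z < R" using True E by auto
      have S: "open S" unfolding S_def
        by (intro open_vimage) (auto intro!: continuous_intros)
      have sub: "cball 0 1 \<subseteq> S"
      proof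
        fix u :: complex assume "u \<in> cball 0 1"
        then have "norm z * norm u \<le> norm z" by (simp add: mult_left_le)
        then show "u \<in> S" using \<open>norm z < R\<close> by (simp add: S_def norm_mult)
      qed
      have h: "(\<lambda>u. g (z * u)) holomorphic_on S"
      proof -
        have "(g \<circ> (\<lambda>u. z * u)) holomorphic_on S"
          by (intro holomorphic_on_compose_gen[OF _ hol]) (auto simp: S_def intro!: holomorphic_intros)
        then show ?thesis by (simp add: o_def)
      qed
      have "0 \<in> S" using sub by auto
      have "(deriv ^^ k) (\<lambda>u. g (z * u)) 0 = z ^ k * (deriv ^^ k) g (z * 0)"
        by (rule higher_deriv_compose_linear[OF hol S _ \<open>0 \<in> S\<close>]) (auto simp: S_def)
      then have "taylor_coeff (\<lambda>u. g (z * u)) k = z ^ k * taylor_coeff g k"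
        by (simp add: taylor_coeff_def)
      then have "ennreal (norm (taylor_coeff g k)) * ennreal (norm z ^ k)
          = ennreal (norm (taylor_coeff (\<lambda>u. g (z * u)) k))"
        by (simp add: norm_mult norm_power ennreal_mult mult.commute)
      also have "\<dots> \<le> (\<integral>\<^sup>+x\<in>{0..1}. ennreal (norm (g (z * cis (2 * pi * x)))) \<partial>lborel)"
        by (rule norm_taylor_coeff_le_average[OF h S sub])
      also have "\<dots> = (\<integral>\<^sup>+x\<in>{0..1}. F (cis (2 * pi * x) * z) \<partial>lborel)"
        using True E(3) by (intro nn_integral_cong) (auto simp: F_def mult.commute)
      finally show ?thesis using True by simp
    qed simp
  qed
  also have "\<dots> = (\<integral>\<^sup>+z. F z \<partial>lborel)"
    by (rule nn_integral_rotation_average[OF F, symmetric])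
  finally show ?thesis by (simp add: F_def)
qed

text \<open>The coefficient bound with k = 0 on a disc, after translating \<open>w\<close> to the
  origin.\<close>

lemma area_mean_value:
  assumes hol: "f holomorphic_on ball w R" and R: "0 < d" "d < R"
  shows "ennreal (norm (f w) * (pi * d\<^sup>2)) \<le> (\<integral>\<^sup>+z\<in>cball w d. ennreal (norm (f z)) \<partial>lborel)"
proof -
  define g where "g u = f (w + u)" for u
  have g: "g holomorphic_on ball 0 R"
  proof -
    have "(f \<circ> (\<lambda>u. w + u)) holomorphic_on ball 0 R"
      using R by (intro holomorphic_on_compose_gen[OF _ hol]) (auto simp: dist_norm intro!:
          holomorphic_intros)
    then show ?thesis by (simp add: o_def g_def[abs_def])
  qed
  have "ennreal (norm (taylor_coeff g 0)) * (\<integral>\<^sup>+z\<in>cball (0::complex) d. ennreal (norm z ^ 0) \<partial>lborel)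
     \<le> (\<integral>\<^sup>+z\<in>cball 0 d. ennreal (norm (g z)) \<partial>lborel)"
    using R by (intro taylor_coeff_area_bound[OF g]) (auto simp: norm_mult)
  also have "(\<integral>\<^sup>+z\<in>cball (0::complex) d. ennreal (norm z ^ 0) \<partial>lborel) = ennreal (pi * d\<^sup>2)"
    using R by (simp add: emeasure_cball unit_ball_vol_2)
  also have "(\<integral>\<^sup>+z\<in>cball 0 d. ennreal (norm (g z)) \<partial>lborel)
      = (\<integral>\<^sup>+u. (\<lambda>v. ennreal (norm (f v)) * indicator (cball w d) v) (w + u) \<partial>lborel)"
    by (intro nn_integral_cong) (auto simp: g_def indicator_def dist_norm)
  also have "\<dots> = (\<integral>\<^sup>+z\<in>cball w d. ennreal (norm (f z)) \<partial>lborel)"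
  proof (rule nn_integral_lborel_shift)
    have "cball w d \<subseteq> ball w R" using R by auto
    then have "continuous_on (cball w d) (\<lambda>z. norm (f z))"
      using hol holomorphic_on_imp_continuous_on continuous_on_subset by (intro continuous_intros) blast
    then have "(\<lambda>z. indicator (cball w d) z *\<^sub>R norm (f z)) \<in> borel_measurable borel"
      by (intro borel_measurable_continuous_on_indicator) auto
    then have "(\<lambda>z. ennreal (indicator (cball w d) z *\<^sub>R norm (f z))) \<in> borel_measurable borel" by measurable
    then show "(\<lambda>v. ennreal (norm (f v)) * indicator (cball w d) v) \<in> borel_measurable borel"
      by (rule measurable_cong[THEN iffD1, rotated]) (auto simp: indicator_def)
  qed
  finally show ?thesis by (simp add: taylor_coeff_def g_def ennreal_mult'[symmetric])
qed

lemma powr_comparable: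
  fixes u v a :: real
  assumes "0 < u" "0 < v" "u \<le> 4 * v" "v \<le> 4 * u"
  shows "u powr a \<le> 4 powr \<bar>a\<bar> * v powr a"
proof -
  have "(u / v) powr a \<le> 4 powr \<bar>a\<bar>"
  proof (cases "a \<ge> 0")
    case True then show ?thesis using assms by (simp add: powr_mono2 field_simps)
  next
    case False
    have "(u / v) powr a = (v / u) powr (- a)" using assms by (simp add: powr_divide powr_minus field_simps)
    also have "\<dots> \<le> 4 powr (- a)" using assms False by (intro powr_mono2) (auto simp: field_simps)
    finally show ?thesis using False by simp
  qed
  then show ?thesis using assms by (simp add: powr_divide field_simps)
qed

text \<open>For \<open>p < 1\<close> there is no convexity; instead evaluate the mean value inequality for \<open>\<bar>f\<bar>\<close> at a point
  maximising \<open>\<bar>f u\<bar> (d - \<bar>u - w\<bar>)\<^bsup>2/p\<^esup>\<close>, where \<open>\<bar>f\<bar>\<close> is controlled on a comparable disc.\<close>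
lemma subharmonic_powr_le_one:
  assumes hol: "f holomorphic_on ball w R" and R: "0 < d" "d < R" and p: "0 < p" "p \<le> 1"
  shows "ennreal (norm (f w) powr p * d\<^sup>2) \<le> ennreal (4 * 2 powr (2 * (1 - p) / p))
      * (\<integral>\<^sup>+z\<in>cball w d. ennreal (norm (f z) powr p) \<partial>lborel)"
proof -
  \<comment> \<open>The exponent 2/p is chosen so that h^p is |f|^p times the squared distance to
    the rim; at the centre this is the left-hand side of the claim.\<close>
  define h where "h u = norm (f u) * (d - norm (u - w)) powr (2 / p)" for u
  have sub: "cball w d \<subseteq> ball w R" using R by auto
  have cont: "continuous_on (cball w d) f"
    using hol sub holomorphic_on_imp_continuous_on continuous_on_subset by blast
  have "continuous_on (cball w d) h"
    unfolding h_def using p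
    by (intro continuous_on_mult continuous_on_powr' continuous_intros cont) (auto simp: dist_norm
        norm_minus_commute)
  then obtain v where v: "v \<in> cball w d" and max: "\<And>u. u \<in> cball w d \<Longrightarrow> h u \<le> h v"
    using continuous_attains_sup[OF compact_cball, of w d h] R by auto
  show ?thesis
  proof (cases "f w = 0")
    case False
    have hw: "h w = norm (f w) * d powr (2 / p)" by (simp add: h_def)
    have "0 < h w" unfolding hw using False R by simp
    then have hv: "0 < h v" using max[of w] R by simp
    \<comment> \<open>Half the distance from the maximiser to the rim: throughout
      \<open>cball v e\<close> that distance is at least e, against 2e at v, whence the factor
      2^(2/p) in \<open>bound\<close>.\<close>
    define e where "e = (d - norm (v - w)) / 2"
    have e: "0 < e" and fv: "0 < norm (f v)"
      using hv v p unfolding h_def e_def by (auto simp: zero_less_mult_iff dist_norm norm_minus_commute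
          powr_eq_0_iff order.order_iff_strict)
    have nv: "norm (v - w) + 2 * e = d" by (simp add: e_def field_simps)
    have sube: "cball v e \<subseteq> cball w d"
    proof
      fix u assume "u \<in> cball v e"
      then have "norm (u - v) \<le> e" by (simp add: dist_norm norm_minus_commute)
      then show "u \<in> cball w d" using nv e norm_triangle_ineq[of "u - v" "v - w"]
          by (simp add: dist_norm norm_minus_commute)
    qed
    have bound: "norm (f u) \<le> 2 powr (2 / p) * norm (f v)" if "u \<in> cball v e" for u
    proof -
      have "norm (u - v) \<le> e" using that by (simp add: dist_norm norm_minus_commute)
      then have "e \<le> d - norm (u - w)" using nv norm_triangle_ineq[of "u - v" "v - w"] by simp
      then have "norm (f u) * e powr (2 / p) \<le> h u"
        unfolding h_def using p e by (intro mult_left_mono powr_mono2) auto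
      also have "\<dots> \<le> h v" using max sube that by blast
      also have "h v = norm (f v) * (2 * e) powr (2 / p)" by (simp add: h_def nv[symmetric])
      also have "\<dots> = (2 powr (2 / p) * norm (f v)) * e powr (2 / p)" using e by (simp add: powr_mult)
      finally show ?thesis using e by simp
    qed
    define L where "L = 2 powr (2 / p) * norm (f v)"
    have L: "0 < L" unfolding L_def using fv by simp
    \<comment> \<open>Trading 1 - p powers of |f| for the uniform bound \<open>L\<close> turns the
      first-power mean into a p-th power integral.\<close>
    have pt: "norm (f u) \<le> L powr (1 - p) * norm (f u) powr p" if "u \<in> cball v e" for u
    proof (cases "f u = 0")
      case False
      then have "norm (f u) = norm (f u) powr (1 - p) * norm (f u) powr p" by (simp add: powr_add[symmetric])
      also have "\<dots> \<le> L powr (1 - p) * norm (f u) powr p"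
        using bound[OF that] p unfolding L_def by (intro mult_right_mono powr_mono2) auto
      finally show ?thesis .
    qed simp
    have "ball v (e + (R - d)) \<subseteq> ball w R"
    proof
      fix u assume "u \<in> ball v (e + (R - d))"
      then have "norm (u - v) < e + (R - d)" by (simp add: dist_norm norm_minus_commute)
      then show "u \<in> ball w R" using nv e norm_triangle_ineq[of "u - v" "v - w"]
          by (simp add: dist_norm norm_minus_commute)
    qed
    then have "f holomorphic_on ball v (e + (R - d))" using hol holomorphic_on_subset by blast
    then have "ennreal (norm (f v) * (pi * e\<^sup>2)) \<le> (\<integral>\<^sup>+z\<in>cball v e. ennreal (norm (f z)) \<partial>lborel)"
      using e R by (intro area_mean_value) auto
    also have "\<dots> \<le> (\<integral>\<^sup>+z. ennreal (L powr (1 - p)) * (ennreal (norm (f z) powr p)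
        * indicator (cball w d) z) \<partial>lborel)"
      using pt sube by (intro nn_integral_mono) (auto simp: indicator_def ennreal_mult'[symmetric]
          intro!: ennreal_leI)
    also have "\<dots> = ennreal (L powr (1 - p)) * (\<integral>\<^sup>+z\<in>cball w d. ennreal (norm (f z) powr p) \<partial>lborel)"
    proof (rule nn_integral_cmult)
      have "continuous_on (cball w d) (\<lambda>z. norm (f z))" by (intro continuous_intros cont)
      then have "(\<lambda>z. indicator (cball w d) z *\<^sub>R norm (f z)) \<in> borel_measurable borel"
        by (intro borel_measurable_continuous_on_indicator) auto
      then have "(\<lambda>z. ennreal ((indicator (cball w d) z *\<^sub>R norm (f z)) powr p)) \<in> borel_measurable
          lborel" by simp
      then show "(\<lambda>v. ennreal (norm (f v) powr p) * indicator (cball w d) v) \<in> borel_measurable lborel"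
        by (rule measurable_cong[THEN iffD1, rotated]) (use p in \<open>auto simp: indicator_def\<close>)
    qed
    finally have main: "ennreal (norm (f v) * (pi * e\<^sup>2))
        \<le> ennreal (L powr (1 - p)) * (\<integral>\<^sup>+z\<in>cball w d. ennreal (norm (f z) powr p) \<partial>lborel)" .
    \<comment> \<open>Converts |f v| \<pi> e^2 into |f v|^p (2e)^2; its factor |f v|^(p-1) cancels
      the power of |f v| contained in L^(1-p).\<close>
    define c where "c = 4 / pi * norm (f v) powr (p - 1)"
    have c: "0 \<le> c" unfolding c_def by simp
    have "norm (f w) powr p * d\<^sup>2 = h w powr p" using R p unfolding hw
        by (simp add: powr_mult powr_powr powr_numeral)
    also have "\<dots> \<le> h v powr p" using max[of w] R p \<open>0 < h w\<close> by (intro powr_mono2) auto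
    also have "\<dots> = norm (f v) powr p * (2 * e)\<^sup>2"
      using e p by (simp add: h_def nv[symmetric] powr_mult powr_powr powr_numeral)
    also have "\<dots> = c * (norm (f v) * (pi * e\<^sup>2))"
      using fv unfolding c_def by (simp add: powr_diff field_simps power2_eq_square)
    finally have "ennreal (norm (f w) powr p * d\<^sup>2) \<le> ennreal c * ennreal (norm (f v) * (pi * e\<^sup>2))"
      using c by (simp add: ennreal_mult'[symmetric] ennreal_leI)
    also have "\<dots> \<le> ennreal c * (ennreal (L powr (1 - p))
        * (\<integral>\<^sup>+z\<in>cball w d. ennreal (norm (f z) powr p) \<partial>lborel))"
      by (intro mult_left_mono main) simp
    also have "\<dots> = ennreal (c * L powr (1 - p)) * (\<integral>\<^sup>+z\<in>cball w d. ennreal (norm (f z) powr p) \<partial>lborel)"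
      using c by (simp add: ennreal_mult' mult.assoc)
    also have "\<dots> \<le> ennreal (4 * 2 powr (2 * (1 - p) / p))
        * (\<integral>\<^sup>+z\<in>cball w d. ennreal (norm (f z) powr p) \<partial>lborel)"
    proof (intro mult_right_mono ennreal_leI)
      have "L powr (1 - p) = 2 powr (2 * (1 - p) / p) * norm (f v) powr (1 - p)"
        unfolding L_def by (simp add: powr_mult powr_powr)
      then have "c * L powr (1 - p) = 4 / pi * 2 powr (2 * (1 - p) / p) * (norm (f v) powr (p - 1)
          * norm (f v) powr (1 - p))"
        unfolding c_def by simp
      also have "norm (f v) powr (p - 1) * norm (f v) powr (1 - p) = 1" using fv
          by (simp add: powr_add[symmetric])
      also have "4 / pi * 2 powr (2 * (1 - p) / p) * 1 \<le> 4 * 2 powr (2 * (1 - p) / p)"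
        using pi_ge_two by (simp add: field_simps)
      finally show "c * L powr (1 - p) \<le> 4 * 2 powr (2 * (1 - p) / p)" .
    qed simp
    finally show ?thesis .
  qed (use p in simp)
qed

text \<open>Now t^p is convex, and Jensen's inequality with the indicator of the disc as weight
  lifts the mean value inequality to p-th powers; the surplus factor \<pi> \<ge> 1 is
  dropped.\<close>

lemma subharmonic_powr_ge_one:
  assumes hol: "f holomorphic_on ball w R" and R: "0 < d" "d < R" and p: "1 \<le> p"
  shows "ennreal (norm (f w) powr p * d\<^sup>2) \<le> (\<integral>\<^sup>+z\<in>cball w d. ennreal (norm (f z) powr p) \<partial>lborel)"
proof -
  define F where "F z = indicator (cball w d) z *\<^sub>R norm (f z)" for z
  have sub: "cball w d \<subseteq> ball w R" using R by auto
  have "continuous_on (cball w d) f"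
    using hol sub holomorphic_on_imp_continuous_on continuous_on_subset by blast
  then have F: "F \<in> borel_measurable borel"
    unfolding F_def by (intro borel_measurable_continuous_on_indicator continuous_intros) auto
  have eq: "ennreal (F z powr a * indicat_real (cball w d) z)
      = ennreal (norm (f z) powr a) * indicator (cball w d) z" for a z
    by (auto simp: F_def indicator_def)
  have W: "(\<integral>\<^sup>+z. ennreal (indicat_real (cball w d) z) \<partial>lborel) = ennreal (pi * d\<^sup>2)"
    using R by (simp add: ennreal_indicator emeasure_cball unit_ball_vol_2)
  have mv: "ennreal (norm (f w) * (pi * d\<^sup>2)) \<le> (\<integral>\<^sup>+z. ennreal (F z * indicat_real (cball w d) z) \<partial>lborel)"
    using area_mean_value[OF hol R] by (rule order_trans) (auto intro!: nn_integral_mono simp: F_def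
        indicator_def)
  have "ennreal ((norm (f w) * (pi * d\<^sup>2)) powr p)
     \<le> ennreal ((pi * d\<^sup>2) powr (p - 1)) * (\<integral>\<^sup>+z. ennreal (F z powr p * indicat_real (cball w d) z) \<partial>lborel)"
  proof (rule jensen_powr_nn_integral)
    show "F \<in> borel_measurable lborel" using F by simp
    show "indicat_real (cball w d) \<in> borel_measurable lborel"
      by (simp, intro borel_measurable_indicator) simp
  qed (use R p W mv in \<open>auto simp: F_def\<close>)
  then have "ennreal ((pi * d\<^sup>2) powr (1 - p)) * ennreal ((norm (f w) * (pi * d\<^sup>2)) powr p)
     \<le> ennreal ((pi * d\<^sup>2) powr (1 - p)) * (ennreal ((pi * d\<^sup>2) powr (p - 1))
         * (\<integral>\<^sup>+z. ennreal (F z powr p * indicat_real (cball w d) z) \<partial>lborel))"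
    by (intro mult_left_mono) auto
  also have "\<dots> = ennreal ((pi * d\<^sup>2) powr (1 - p) * (pi * d\<^sup>2) powr (p - 1))
      * (\<integral>\<^sup>+z. ennreal (F z powr p * indicat_real (cball w d) z) \<partial>lborel)"
    by (simp add: ennreal_mult' mult.assoc)
  also have "(pi * d\<^sup>2) powr (1 - p) * (pi * d\<^sup>2) powr (p - 1) = 1" using R by (simp add: powr_add[symmetric])
  finally have *: "ennreal ((pi * d\<^sup>2) powr (1 - p) * (norm (f w) * (pi * d\<^sup>2)) powr p)
     \<le> (\<integral>\<^sup>+z. ennreal (norm (f z) powr p) * indicator (cball w d) z \<partial>lborel)"
    unfolding eq by (simp add: ennreal_mult')
  have "(pi * d\<^sup>2) powr (1 - p) * (norm (f w) * (pi * d\<^sup>2)) powr p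
    = norm (f w) powr p * ((pi * d\<^sup>2) powr (1 - p) * (pi * d\<^sup>2) powr p)" by (simp add: powr_mult)
  also have "(pi * d\<^sup>2) powr (1 - p) * (pi * d\<^sup>2) powr p = pi * d\<^sup>2" using R
      by (subst powr_add[symmetric]) simp
  finally have "norm (f w) powr p * d\<^sup>2 \<le> (pi * d\<^sup>2) powr (1 - p) * (norm (f w) * (pi * d\<^sup>2)) powr p"
    using pi_ge_two by (simp add: mult_left_mono mult_le_cancel_right1 order_trans[OF _
        mult_right_mono[of 1 pi]])
  then show ?thesis by (intro order_trans[OF ennreal_leI *])
qed

section \<open>Carleson embeddings on the radius\<close>

abbreviation (input) on_radius :: "real measure \<Rightarrow> bool" where
  "on_radius \<mu> \<equiv> sets \<mu> = sets (restrict_space borel {0..<1})"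

text \<open>Points whose distance to the circle is comparable to x. The factors leave room both for
  the disc of radius x/2 about a point at distance x and for the annulus 1 - x/2 \<le> |w| \<le> 1 -
  x/4 of the coefficient estimate. Only |w| matters, so that membership in
  \<open>shell (1 - t)\<close> can be read as a condition on t.\<close>

definition shell :: "real \<Rightarrow> complex set" where
  "shell x = {w. norm w < 1 \<and> x / 4 \<le> 1 - norm w \<and> 1 - norm w \<le> 2 * x}"

lemma shell_borel [measurable]: "shell x \<in> sets borel"
  unfolding shell_def by measurable

lemma nn_integral_shell: "(\<integral>\<^sup>+w\<in>shell x. F w \<partial>lborel) = (\<integral>\<^sup>+w\<in>shell x. F w \<partial>disc)"
  unfolding nn_integral_disc by (intro nn_integral_cong) (auto simp: indicator_def shell_def)

lemma holomorphic_disc_measurable: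
  "f holomorphic_on ball 0 1 \<Longrightarrow> f \<in> borel_measurable disc"
  by (intro continuous_on_measurable_disc holomorphic_on_imp_continuous_on)

lemma subharmonic_shell:
  assumes "0 < p"
  obtains C where "0 < C" "\<And>f z. f holomorphic_on ball 0 1 \<Longrightarrow> norm z < 1 \<Longrightarrow>
    ennreal (norm (f z) powr p) \<le> ennreal (C / (1 - norm z)\<^sup>2)
        * (\<integral>\<^sup>+w\<in>shell (1 - norm z). ennreal (norm (f w) powr p) \<partial>disc)"
proof
  \<comment> \<open>One constant for p \<le> 1 and p > 1; the factor 4 in front of it comes from the
    radius x/2.\<close>
  define c where "c = max 1 (4 * 2 powr (2 * (1 - p) / p))"
  show "0 < 4 * c" unfolding c_def by (simp add: less_max_iff_disj)
  fix f :: "complex \<Rightarrow> complex" and z :: complex assume hol: "f holomorphic_on ball 0 1" and z: "norm z < 1"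
  define x where "x = 1 - norm z"
  have x: "0 < x" unfolding x_def using z by simp
  have "ball z x \<subseteq> ball 0 1"
  proof
    fix u assume "u \<in> ball z x"
    then have "norm (u - z) < 1 - norm z" by (simp add: x_def dist_norm norm_minus_commute)
    then show "u \<in> ball 0 1" using norm_triangle_ineq[of "u - z" z] by simp
  qed
  then have h: "f holomorphic_on ball z x" using hol holomorphic_on_subset by blast
  define I where "I = (\<integral>\<^sup>+u\<in>cball z (x / 2). ennreal (norm (f u) powr p) \<partial>lborel)"
  have "ennreal (norm (f z) powr p * (x / 2)\<^sup>2) \<le> ennreal c * I"
  proof (cases "p \<le> 1")
    case True
    have "ennreal (norm (f z) powr p * (x / 2)\<^sup>2) \<le> ennreal (4 * 2 powr (2 * (1 - p) / p)) * I"
      unfolding I_def using x assms True by (intro subharmonic_powr_le_one[OF h]) auto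
    also have "\<dots> \<le> ennreal c * I" unfolding c_def by (intro mult_right_mono ennreal_leI) auto
    finally show ?thesis .
  next
    case False
    have "ennreal (norm (f z) powr p * (x / 2)\<^sup>2) \<le> ennreal 1 * I"
      unfolding I_def using x False subharmonic_powr_ge_one[OF h, of "x / 2" p] by simp
    also have "\<dots> \<le> ennreal c * I" unfolding c_def by (intro mult_right_mono ennreal_leI) auto
    finally show ?thesis .
  qed
  also have "I \<le> (\<integral>\<^sup>+w\<in>shell x. ennreal (norm (f w) powr p) \<partial>lborel)"
    unfolding I_def
  proof (intro nn_integral_mono mult_left_mono)
    fix u show "indicator (cball z (x / 2)) u \<le> (indicator (shell x) u :: ennreal)"
    proof (cases "u \<in> cball z (x / 2)")
      case True
      then have "norm (u - z) \<le> x / 2" by (simp add: dist_norm norm_minus_commute)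
      then have "norm u \<le> norm z + x / 2" "norm z \<le> norm u + x / 2"
        using norm_triangle_ineq2[of u z] norm_triangle_ineq2[of z u] by (auto simp: norm_minus_commute)
      then show ?thesis using x True unfolding shell_def by (auto simp: indicator_def x_def field_simps)
    qed simp
  qed simp
  finally have "ennreal (4 / x\<^sup>2) * ennreal (norm (f z) powr p * (x / 2)\<^sup>2)
      \<le> ennreal (4 / x\<^sup>2) * (ennreal c * (\<integral>\<^sup>+w\<in>shell x. ennreal (norm (f w) powr p) \<partial>disc))"
    unfolding nn_integral_shell by (simp add: mult_left_mono)
  then show "ennreal (norm (f z) powr p) \<le> ennreal (4 * c / (1 - norm z)\<^sup>2)
      * (\<integral>\<^sup>+w\<in>shell (1 - norm z). ennreal (norm (f w) powr p) \<partial>disc)"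
    using x unfolding x_def[symmetric]
    by (simp add: ennreal_mult'[symmetric] mult.assoc[symmetric] power2_eq_square)
qed

text \<open>On the shell the weight is comparable to x^\<alpha>, so the x^(-2) of the mean value
  estimate becomes x^(-(\<alpha>+2)). Here \<open>N\<close> bounds the p-th power mass, not its
  root.\<close>

lemma bergman_pointwise_bound:
  assumes "0 < p"
  obtains C where "0 < C" "\<And>f N z. f holomorphic_on ball 0 1 \<Longrightarrow> 0 \<le> N \<Longrightarrow>
     bergman_mass p \<alpha> f \<le> ennreal N \<Longrightarrow> norm z < 1 \<Longrightarrow>
     norm (f z) powr p \<le> C * N * (1 - norm z) powr (- (\<alpha> + 2))"
proof -
  obtain C where C: "0 < C" "\<And>f z. f holomorphic_on ball 0 1 \<Longrightarrow> norm z < 1 \<Longrightarrow>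
    ennreal (norm (f z) powr p) \<le> ennreal (C / (1 - norm z)\<^sup>2)
        * (\<integral>\<^sup>+w\<in>shell (1 - norm z). ennreal (norm (f w) powr p) \<partial>disc)"
    using subharmonic_shell[OF assms] by blast
  define c where "c = 4 powr \<bar>\<alpha>\<bar> * 2 powr \<bar>\<alpha>\<bar>"
  have c: "0 < c" unfolding c_def by simp
  have "norm (f z) powr p \<le> C * c * N * (1 - norm z) powr (- (\<alpha> + 2))"
    if f: "f holomorphic_on ball 0 1" and N: "0 \<le> N" "bergman_mass p \<alpha> f \<le> ennreal N" and z: "norm z < 1"
    for f N z
  proof -
    define x where "x = 1 - norm z"
    have x: "0 < x" unfolding x_def using z by simp
    have [measurable]: "f \<in> borel_measurable disc" by (rule holomorphic_disc_measurable[OF f])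
    have wm: "(\<lambda>w. ennreal ((1 - (norm w)\<^sup>2) powr \<alpha>)) \<in> borel_measurable disc"
      by (rule measurable_disc) measurable
    have "(\<integral>\<^sup>+w\<in>shell x. ennreal (norm (f w) powr p) \<partial>disc)
       \<le> (\<integral>\<^sup>+w. ennreal (c * x powr (- \<alpha>)) * (ennreal ((1 - (norm w)\<^sup>2) powr \<alpha>)
           * ennreal (norm (f w) powr p)) \<partial>disc)"
    proof (intro nn_integral_mono)
      fix w assume "w \<in> space disc"
      then have w: "norm w < 1" by simp
      show "ennreal (norm (f w) powr p) * indicator (shell x) w
        \<le> ennreal (c * x powr (- \<alpha>)) * (ennreal ((1 - (norm w)\<^sup>2) powr \<alpha>) * ennreal (norm (f w) powr p))"
      proof (cases "w \<in> shell x")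
        case True
        then have "x / 4 \<le> 1 - norm w" "1 - norm w \<le> 2 * x" by (auto simp: shell_def)
        then have "x powr \<alpha> \<le> 4 powr \<bar>\<alpha>\<bar> * (1 - norm w) powr \<alpha>"
          using x w by (intro powr_comparable) auto
        also have "\<dots> \<le> 4 powr \<bar>\<alpha>\<bar> * (2 powr \<bar>\<alpha>\<bar> * (1 - (norm w)\<^sup>2) powr \<alpha>)"
          using w by (intro mult_left_mono disc_weight_bounds) auto
        finally have "x powr (- \<alpha>) * x powr \<alpha> \<le> x powr (- \<alpha>) * (c * (1 - (norm w)\<^sup>2) powr \<alpha>)"
          unfolding c_def by (intro mult_left_mono) (auto simp: mult.assoc)
        then have "1 \<le> c * x powr (- \<alpha>) * (1 - (norm w)\<^sup>2) powr \<alpha>"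
          using x by (simp add: powr_add[symmetric] mult_ac)
        then have "1 * norm (f w) powr p \<le> (c * x powr (- \<alpha>) * (1 - (norm w)\<^sup>2) powr \<alpha>) * norm (f w) powr p"
          by (intro mult_right_mono) auto
        then have "ennreal (norm (f w) powr p) \<le> ennreal (c * x powr (- \<alpha>) * ((1 - (norm w)\<^sup>2) powr \<alpha>
            * norm (f w) powr p))"
          by (intro ennreal_leI) (simp add: mult.assoc)
        then show ?thesis using True c by (simp add: ennreal_mult')
      qed simp
    qed
    also have "\<dots> = ennreal (c * x powr (- \<alpha>)) * bergman_mass p \<alpha> f"
      using wm by (subst nn_integral_cmult) (auto simp: nn_integral_wdisc)
    also have "\<dots> \<le> ennreal (c * x powr (- \<alpha>)) * ennreal N" by (intro mult_left_mono N) simp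
    finally have *: "(\<integral>\<^sup>+w\<in>shell x. ennreal (norm (f w) powr p) \<partial>disc) \<le> ennreal (c * x powr (- \<alpha>) * N)"
      using c by (simp add: ennreal_mult')
    have "ennreal (norm (f z) powr p) \<le> ennreal (C / x\<^sup>2) * ennreal (c * x powr (- \<alpha>) * N)"
      using C(2)[OF f z] unfolding x_def[symmetric] by (rule order_trans) (intro mult_left_mono *, simp)
    also have "\<dots> = ennreal (C / x\<^sup>2 * (c * x powr (- \<alpha>) * N))" using C
        by (intro ennreal_mult'[symmetric]) simp
    finally have "norm (f z) powr p \<le> C / x\<^sup>2 * (c * x powr (- \<alpha>) * N)"
      using C c N by (subst (asm) ennreal_le_iff) auto
    also have "\<dots> = C * c * N * x powr (- (\<alpha> + 2))"
      using x by (simp add: powr_diff powr_minus powr_add powr_numeral field_simps)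
    finally show ?thesis by (simp add: x_def)
  qed
  then show ?thesis using that[of "C * c"] C c by simp
qed

text \<open>With x = 1 - t the annulus \<open>E\<close> has inner radius 1 - x/2 > t. Hence |a_k| is
  at most (2/x)(1 - x/2)^(-k) times the integral over the shell, and the sum over k is geometric
  with ratio \<theta> = t/(1 - x/2), where 1 - \<theta> \<ge> x/2. The absolute values sit inside
  the sum because the double series behind the operator demands it.\<close>

lemma taylor_coeff_sum_shell:
  assumes hol: "f holomorphic_on ball 0 1" and t: "0 \<le> t" "t < 1"
  shows "(\<Sum>k. ennreal (norm (taylor_coeff f k) * t ^ k))
      \<le> ennreal (4 / (1 - t)\<^sup>2) * (\<integral>\<^sup>+w\<in>shell (1 - t). ennreal (norm (f w)) \<partial>disc)"
proof -
  define x where "x = 1 - t"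
  have x: "0 < x" "x \<le> 1" unfolding x_def using t by auto
  define E where "E = cball (0::complex) (1 - x / 4) - ball 0 (1 - x / 2)"
  define I where "I = (\<integral>\<^sup>+w\<in>shell x. ennreal (norm (f w)) \<partial>disc)"
  have E: "E \<in> sets borel" "E \<subseteq> ball 0 1" unfolding E_def using x by auto
  have "E \<subseteq> shell x" unfolding E_def shell_def using x by auto
  then have EI: "(\<integral>\<^sup>+z\<in>E. ennreal (norm (f z)) \<partial>lborel) \<le> I"
    unfolding I_def nn_integral_shell[symmetric] by (intro nn_integral_mono mult_left_mono) (auto simp:
        indicator_def)
  \<comment> \<open>The radii differ by x/4 and add up to at least 5/4, so the area is of order
    x.\<close>
  have lE: "ennreal (x / 2) \<le> emeasure lborel E"
  proof -
    have "emeasure lborel E = ennreal (pi * ((1 - x / 4)\<^sup>2 - (1 - x / 2)\<^sup>2))"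
      unfolding E_def using x by (intro emeasure_annulus) auto
    moreover have "x / 2 \<le> pi * ((1 - x / 4)\<^sup>2 - (1 - x / 2)\<^sup>2)"
    proof -
      have "x / 2 \<le> 2 * ((x / 4) * (2 - 3 * x / 4))" using x by (simp add: field_simps)
      also have "\<dots> \<le> pi * ((x / 4) * (2 - 3 * x / 4))" using x pi_ge_two by (intro mult_right_mono) auto
      also have "(x / 4) * (2 - 3 * x / 4) = (1 - x / 4)\<^sup>2 - (1 - x / 2)\<^sup>2"
          by (simp add: power2_eq_square field_simps)
      finally show ?thesis .
    qed
    ultimately show ?thesis by (simp add: ennreal_leI)
  qed
  define \<theta> where "\<theta> = t / (1 - x / 2)"
  have \<theta>: "0 \<le> \<theta>" "\<theta> < 1" unfolding \<theta>_def using t x by (auto simp: x_def field_simps)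
  have coeff: "ennreal (norm (taylor_coeff f k) * t ^ k) \<le> ennreal (2 / x * \<theta> ^ k) * I" for k
  proof -
    have "ennreal (norm (taylor_coeff f k) * ((1 - x / 2) ^ k * (x / 2)))
       = ennreal (norm (taylor_coeff f k)) * (ennreal ((1 - x / 2) ^ k) * ennreal (x / 2))"
      using x by (simp add: ennreal_mult' [symmetric] ennreal_mult''[symmetric])
    also have "\<dots> \<le> ennreal (norm (taylor_coeff f k)) * (ennreal ((1 - x / 2) ^ k) * emeasure lborel E)"
      by (intro mult_left_mono lE) auto
    also have "ennreal ((1 - x / 2) ^ k) * emeasure lborel E = (\<integral>\<^sup>+z\<in>E. ennreal ((1 - x / 2) ^ k) \<partial>lborel)"
      using E by (simp add: nn_integral_cmult_indicator)
    also have "\<dots> \<le> (\<integral>\<^sup>+z\<in>E. ennreal (norm z ^ k) \<partial>lborel)"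
      using x by (intro nn_integral_mono) (auto simp: E_def indicator_def not_less intro!: ennreal_leI
          power_mono)
    also have "ennreal (norm (taylor_coeff f k)) * \<dots> \<le> (\<integral>\<^sup>+z\<in>E. ennreal (norm (f z)) \<partial>lborel)"
      by (intro taylor_coeff_area_bound[OF hol] E) (auto simp: E_def norm_mult)
    also note EI
    finally have *: "ennreal (norm (taylor_coeff f k) * ((1 - x / 2) ^ k * (x / 2))) \<le> I"
      by (simp add: mult_left_mono)
    have "norm (taylor_coeff f k) * t ^ k = (2 / x * \<theta> ^ k) * (norm (taylor_coeff f k)
        * ((1 - x / 2) ^ k * (x / 2)))"
      using x by (simp add: \<theta>_def power_divide)
    then have "ennreal (norm (taylor_coeff f k) * t ^ k)
        = ennreal (2 / x * \<theta> ^ k) * ennreal (norm (taylor_coeff f k) * ((1 - x / 2) ^ k * (x / 2)))"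
      using x \<theta> by (simp only: ennreal_mult'[symmetric]) (simp add: ennreal_mult'[symmetric])
    also have "\<dots> \<le> ennreal (2 / x * \<theta> ^ k) * I" by (intro mult_left_mono *) simp
    finally show ?thesis .
  qed
  have "(\<Sum>k. ennreal (norm (taylor_coeff f k) * t ^ k)) \<le> (\<Sum>k. ennreal (2 / x * \<theta> ^ k) * I)"
    by (intro suminf_le coeff summableI)
  also have "\<dots> = (\<Sum>k. ennreal (2 / x * \<theta> ^ k)) * I" by (rule ennreal_suminf_multc)
  also have "(\<Sum>k. ennreal (2 / x * \<theta> ^ k)) = ennreal (\<Sum>k. 2 / x * \<theta> ^ k)"
    using x \<theta> by (intro suminf_ennreal2) (auto intro!: summable_mult summable_divide summable_geometric)
  also have "(\<Sum>k. 2 / x * \<theta> ^ k) = 2 / x * (1 / (1 - \<theta>))"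
    using \<theta> by (subst suminf_mult) (auto simp: suminf_geometric)
  also have "ennreal (2 / x * (1 / (1 - \<theta>))) \<le> ennreal (4 / x\<^sup>2)"
  proof (intro ennreal_leI)
    have "1 - \<theta> = (x / 2) / (1 - x / 2)" unfolding \<theta>_def using x by (simp add: x_def field_simps)
    then have "1 / (1 - \<theta>) = (1 - x / 2) * (2 / x)" using x by simp
    also have "\<dots> \<le> 1 * (2 / x)" using x by (intro mult_right_mono) auto
    finally have "2 / x * (1 / (1 - \<theta>)) \<le> 2 / x * (2 / x)" using x by (intro mult_left_mono) auto
    then show "2 / x * (1 / (1 - \<theta>)) \<le> 4 / x\<^sup>2" by (simp add: power2_eq_square)
  qed
  finally show ?thesis unfolding I_def x_def by (simp add: mult_right_mono)
qed

lemma measurable_radius: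
  fixes g :: "real \<Rightarrow> 'b::topological_space"
  assumes "on_radius \<nu>" "continuous_on {0..<1} g"
  shows "g \<in> borel_measurable \<nu>"
  using borel_measurable_continuous_on_restrict[OF assms(2)] measurable_cong_sets[OF assms(1) refl] by blast

lemma space_radius: "on_radius \<nu> \<Longrightarrow> space \<nu> = {0..<1}"
  using sets_eq_imp_space_eq[of \<nu> "restrict_space borel {0..<1::real}"] by (simp add: space_restrict_space)

lemma radius_disc_Fubini:
  fixes h :: "real \<Rightarrow> ennreal" and \<Phi> :: "complex \<Rightarrow> ennreal"
  assumes \<nu>: "on_radius \<nu>" "finite_measure \<nu>"
    and [measurable]: "h \<in> borel_measurable \<nu>" "\<Phi> \<in> borel_measurable disc"
  shows "(\<integral>\<^sup>+t. h t * (\<integral>\<^sup>+w\<in>shell (1 - t). \<Phi> w \<partial>disc) \<partial>\<nu>)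
    = (\<integral>\<^sup>+w. \<Phi> w * (\<integral>\<^sup>+t. h t * indicator {t. w \<in> shell (1 - t)} t \<partial>\<nu>) \<partial>disc)"
proof -
  interpret D: finite_measure disc by (rule finite_disc)
  interpret N: finite_measure \<nu> by (rule \<nu>)
  interpret P: pair_sigma_finite disc \<nu> ..
  have [measurable]: "(\<lambda>t. t) \<in> borel_measurable \<nu>" by (intro measurable_radius \<nu> continuous_intros)
  \<comment> \<open>Joint measurability is visible from the inequalities between t and |w|; the
    clause \<open>norm w < 1\<close> of \<open>shell\<close> holds automatically on the
    disc.\<close>
  define g :: "complex \<Rightarrow> real \<Rightarrow> ennreal" where
    "g w t = (if (1 - t) / 4 \<le> 1 - norm w \<and> 1 - norm w \<le> 2 * (1 - t) then 1 else 0)" for w t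
  have [measurable]: "(\<lambda>(w, t). g w t) \<in> borel_measurable (disc \<Otimes>\<^sub>M \<nu>)"
    unfolding g_def by measurable
  have g: "indicator (shell (1 - t)) w = g w t" "indicator {t. w \<in> shell (1 - t)} t
      = g w t" if "w \<in> space disc" for w t
    using that by (auto simp: g_def shell_def)
  have [measurable]: "(\<lambda>w. g w t) \<in> borel_measurable disc" for t
    unfolding g_def by measurable
  have [measurable]: "(\<lambda>t. g w t) \<in> borel_measurable \<nu>" for w
    unfolding g_def by measurable
  have "(\<integral>\<^sup>+t. h t * (\<integral>\<^sup>+w\<in>shell (1 - t). \<Phi> w \<partial>disc) \<partial>\<nu>) = (\<integral>\<^sup>+t. h t * (\<integral>\<^sup>+w. \<Phi> w * g w t \<partial>disc) \<partial>\<nu>)"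
    by (intro nn_integral_cong arg_cong2[where f="(*)"] refl) (auto simp: g)
  also have "\<dots> = (\<integral>\<^sup>+t. \<integral>\<^sup>+w. h t * (\<Phi> w * g w t) \<partial>disc \<partial>\<nu>)"
    by (intro nn_integral_cong nn_integral_cmult[symmetric]) measurable
  also have "\<dots> = (\<integral>\<^sup>+w. \<integral>\<^sup>+t. h t * (\<Phi> w * g w t) \<partial>\<nu> \<partial>disc)"
    by (rule P.Fubini') measurable
  also have "\<dots> = (\<integral>\<^sup>+w. \<integral>\<^sup>+t. \<Phi> w * (h t * g w t) \<partial>\<nu> \<partial>disc)"
    by (simp add: mult_ac)
  also have "\<dots> = (\<integral>\<^sup>+w. \<Phi> w * (\<integral>\<^sup>+t. h t * g w t \<partial>\<nu>) \<partial>disc)"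
    by (intro nn_integral_cong nn_integral_cmult) measurable
  also have "\<dots> = (\<integral>\<^sup>+w. \<Phi> w * (\<integral>\<^sup>+t. h t * indicator {t. w \<in> shell (1 - t)} t \<partial>\<nu>) \<partial>disc)"
    by (intro nn_integral_cong arg_cong2[where f="(*)"] refl) (auto simp: g)
  finally show ?thesis .
qed

text \<open>The hypothesis on \<open>h d\<nu>\<close> is a Carleson condition on dyadic shells, and \<open>r \<ge> p\<close> lets the growth
  bound for \<open>f\<close> absorb \<open>r - p\<close> of its powers.\<close>
lemma carleson_embedding:
  assumes "0 < p" "p \<le> r" "-1 < \<alpha>"
  obtains C where "0 < C" "\<And>\<nu> h K f N.
     on_radius \<nu> \<Longrightarrow> finite_measure \<nu> \<Longrightarrow>
     h \<in> borel_measurable \<nu> \<Longrightarrow> (\<And>t. 0 \<le> (h t :: real)) \<Longrightarrow> 0 \<le> K \<Longrightarrow>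
     (\<And>x. 0 < x \<Longrightarrow> x \<le> 1 \<Longrightarrow> (\<integral>\<^sup>+t. ennreal (h t) * indicator {t. x / 2 \<le> 1 - t \<and> 1 - t \<le> 4 * x} t \<partial>\<nu>)
         \<le> ennreal (K * x powr ((\<alpha> + 2) * r / p))) \<Longrightarrow>
     f holomorphic_on ball 0 1 \<Longrightarrow> 0 \<le> N \<Longrightarrow> bergman_mass p \<alpha> f \<le> ennreal N \<Longrightarrow>
     (\<integral>\<^sup>+t. ennreal (norm (f (of_real t)) powr r * h t) \<partial>\<nu>) \<le> ennreal (C * K * N powr (r / p))"
proof -
  obtain C1 where C1: "0 < C1" "\<And>f N z. f holomorphic_on ball 0 1 \<Longrightarrow> 0 \<le> N \<Longrightarrow>
     bergman_mass p \<alpha> f \<le> ennreal N \<Longrightarrow> norm z < 1 \<Longrightarrow>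
     norm (f z) powr p \<le> C1 * N * (1 - norm z) powr (- (\<alpha> + 2))"
    using bergman_pointwise_bound[OF assms(1)] by blast
  obtain C2 where C2: "0 < C2" "\<And>f z. f holomorphic_on ball 0 1 \<Longrightarrow> norm z < 1 \<Longrightarrow>
    ennreal (norm (f z) powr p) \<le> ennreal (C2 / (1 - norm z)\<^sup>2)
        * (\<integral>\<^sup>+w\<in>shell (1 - norm z). ennreal (norm (f w) powr p) \<partial>disc)"
    using subharmonic_shell[OF assms(1)] by blast
  \<comment> \<open>The number of surplus factors |f|^p that the growth bound has to absorb.\<close>
  define e where "e = r / p - 1"
  have e: "0 \<le> e" unfolding e_def using assms by simp
  \<comment> \<open>The total negative power of 1 - t: (\<alpha>+2)e from the growth bound and 2
    from the mean value. Against the assumed exponent, (\<alpha>+2)r/p - \<kappa> = \<alpha>, the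
    power in the Bergman weight.\<close>
  define \<kappa> where "\<kappa> = (\<alpha> + 2) * e + 2"
  have \<kappa>: "0 \<le> \<kappa>" unfolding \<kappa>_def using e assms by simp
  have main: "(\<integral>\<^sup>+t. ennreal (norm (f (of_real t)) powr r * h t) \<partial>\<nu>)
      \<le> ennreal (C1 powr e * C2 * 4 powr \<kappa> * 2 powr \<bar>\<alpha>\<bar> * K * N powr (r / p))"
    if \<nu>: "on_radius \<nu>" "finite_measure \<nu>"
      and h[measurable]: "h \<in> borel_measurable \<nu>" and h0: "\<And>t. 0 \<le> (h t :: real)" and K: "0 \<le> K"
      and carl: "\<And>x. 0 < x \<Longrightarrow> x \<le> 1 \<Longrightarrow> (\<integral>\<^sup>+t. ennreal (h t) * indicator {t. x / 2 \<le> 1 - t \<and> 1 - t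
          \<le> 4 * x} t \<partial>\<nu>) \<le> ennreal (K * x powr ((\<alpha> + 2) * r / p))"
      and f: "f holomorphic_on ball 0 1" and N: "0 \<le> N" "bergman_mass p \<alpha> f \<le> ennreal N"
    for \<nu> h K f N
  proof -
    have [measurable]: "(\<lambda>t. t) \<in> borel_measurable \<nu>" by (intro measurable_radius \<nu> continuous_intros)
    have [measurable]: "f \<in> borel_measurable disc" by (rule holomorphic_disc_measurable[OF f])
    define c where "c = (C1 * N) powr e * C2"
    have c: "0 \<le> c" unfolding c_def using C2 by simp
    have "(\<integral>\<^sup>+t. ennreal (norm (f (of_real t)) powr r * h t) \<partial>\<nu>)
       \<le> (\<integral>\<^sup>+t. ennreal (c * (1 - t) powr (- \<kappa>) * h t)
           * (\<integral>\<^sup>+w\<in>shell (1 - t). ennreal (norm (f w) powr p) \<partial>disc) \<partial>\<nu>)"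
    proof (intro nn_integral_mono)
      fix t assume "t \<in> space \<nu>"
      then have t: "0 \<le> t" "t < 1" using space_radius[OF \<nu>(1)] by auto
      define a where "a = norm (f (of_real t))"
      define I where "I = (\<integral>\<^sup>+w\<in>shell (1 - t). ennreal (norm (f w) powr p) \<partial>disc)"
      have a1: "a powr p \<le> C1 * N * (1 - t) powr (- (\<alpha> + 2))"
        using C1(2)[OF f N, of "of_real t"] t by (simp add: a_def)
      have a2: "ennreal (a powr p) \<le> ennreal (C2 / (1 - t)\<^sup>2) * I"
        using C2(2)[OF f, of "of_real t"] t by (simp add: a_def I_def)
      have "a powr r = (a powr p) powr e * a powr p"
      proof (cases "a = 0")
        case False
        then have "(a powr p) powr e * a powr p = a powr (p * e + p)" by (simp add: powr_powr powr_add)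
        also have "p * e + p = r" unfolding e_def using assms by (simp add: field_simps)
        finally show ?thesis by simp
      qed (use assms in simp)
      also have "\<dots> \<le> (C1 * N * (1 - t) powr (- (\<alpha> + 2))) powr e * a powr p"
        using a1 e by (intro mult_right_mono powr_mono2) auto
      also have "(C1 * N * (1 - t) powr (- (\<alpha> + 2))) powr e
          = (C1 * N) powr e * (1 - t) powr (- ((\<alpha> + 2) * e))"
        by (simp only: powr_mult powr_powr mult_minus_left)
      finally have "a powr r * h t \<le> ((C1 * N) powr e * (1 - t) powr (- ((\<alpha> + 2) * e)) * a powr p) * h t"
        using h0[of t] by (rule mult_right_mono)
      also have "\<dots> = ((C1 * N) powr e * (1 - t) powr (- ((\<alpha> + 2) * e)) * h t) * a powr p" by simp
      finally have "a powr r * h t \<le> ((C1 * N) powr e * (1 - t) powr (- ((\<alpha> + 2) * e)) * h t) * a powr p" .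
      then have "ennreal (a powr r * h t) \<le> ennreal ((C1 * N) powr e * (1 - t) powr (- ((\<alpha>
          + 2) * e)) * h t) * ennreal (a powr p)"
        using h0[of t] by (simp add: ennreal_mult''[symmetric] ennreal_leI)
      also have "\<dots> \<le> ennreal ((C1 * N) powr e * (1 - t) powr (- ((\<alpha>
          + 2) * e)) * h t) * (ennreal (C2 / (1 - t)\<^sup>2) * I)"
        by (intro mult_left_mono a2) simp
      also have "\<dots> = ennreal ((C1 * N) powr e * (1 - t) powr (- ((\<alpha> + 2) * e)) * h t * (C2 / (1 - t)\<^sup>2)) * I"
        using C2(1) by (subst ennreal_mult'') (auto simp: mult.assoc intro!: divide_nonneg_nonneg)
      also have "(C1 * N) powr e * (1 - t) powr (- ((\<alpha> + 2) * e)) * h t * (C2 / (1 - t)\<^sup>2)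
          = c * (1 - t) powr (- \<kappa>) * h t"
        unfolding c_def \<kappa>_def using t by (simp add: powr_diff powr_minus powr_add powr_numeral field_simps)
      finally show "ennreal (norm (f (of_real t)) powr r * h t)
          \<le> ennreal (c * (1 - t) powr (- \<kappa>) * h t) * (\<integral>\<^sup>+w\<in>shell (1 - t). ennreal (norm (f w) powr p) \<partial>disc)"
        unfolding a_def I_def .
    qed
    also have "\<dots> = (\<integral>\<^sup>+w. ennreal (norm (f w) powr p) * (\<integral>\<^sup>+t. ennreal (c * (1 - t) powr (- \<kappa>) * h t)
        * indicator {t. w \<in> shell (1 - t)} t \<partial>\<nu>) \<partial>disc)"
      by (rule radius_disc_Fubini[OF \<nu>]) measurable
    also have "\<dots> \<le> (\<integral>\<^sup>+w. ennreal (c * 4 powr \<kappa> * 2 powr \<bar>\<alpha>\<bar> * K) * (ennreal ((1 - (norm w)\<^sup>2) powr \<alpha>)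
        * ennreal (norm (f w) powr p)) \<partial>disc)"
    proof (intro nn_integral_mono)
      fix w assume "w \<in> space disc"
      then have w: "norm w < 1" by simp
      define u where "u = 1 - norm w"
      have u: "0 < u" "u \<le> 1" unfolding u_def using w by auto
      have "(\<integral>\<^sup>+t. ennreal (c * (1 - t) powr (- \<kappa>) * h t) * indicator {t. w \<in> shell (1 - t)} t \<partial>\<nu>)
        \<le> (\<integral>\<^sup>+t. ennreal (c * 4 powr \<kappa> * u powr (- \<kappa>)) * (ennreal (h t) * indicator {t. u / 2 \<le> 1 - t
            \<and> 1 - t \<le> 4 * u} t) \<partial>\<nu>)"
      proof (intro nn_integral_mono)
        fix t assume "t \<in> space \<nu>"
        then have t: "0 \<le> t" "t < 1" using space_radius[OF \<nu>(1)] by auto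
        show "ennreal (c * (1 - t) powr (- \<kappa>) * h t) * indicator {t. w \<in> shell (1 - t)} t
           \<le> ennreal (c * 4 powr \<kappa> * u powr (- \<kappa>)) * (ennreal (h t) * indicator {t. u / 2 \<le> 1 - t
               \<and> 1 - t \<le> 4 * u} t)"
        proof (cases "w \<in> shell (1 - t)")
          case True
          \<comment> \<open>Solving the shell condition for 1 - t turns the factors 1/4 and 2 into
            1/2 and 4, which is the window in the hypothesis on \<open>h\<close>.\<close>
          then have b: "u / 2 \<le> 1 - t" "1 - t \<le> 4 * u" by (auto simp: shell_def u_def field_simps)
          have "(1 - t) powr (- \<kappa>) \<le> 4 powr \<bar>- \<kappa>\<bar> * u powr (- \<kappa>)"
            using t u b by (intro powr_comparable) auto
          then have "c * (1 - t) powr (- \<kappa>) * h t \<le> c * (4 powr \<kappa> * u powr (- \<kappa>)) * h t"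
            using c \<kappa> h0[of t] by (intro mult_right_mono mult_left_mono) auto
          then have "ennreal (c * (1 - t) powr (- \<kappa>) * h t)
              \<le> ennreal (c * 4 powr \<kappa> * u powr (- \<kappa>)) * ennreal (h t)"
            using h0[of t] by (simp add: ennreal_mult''[symmetric] ennreal_leI mult.assoc)
          then show ?thesis using True b by simp
        qed simp
      qed
      also have "\<dots> = ennreal (c * 4 powr \<kappa> * u powr (- \<kappa>)) * (\<integral>\<^sup>+t. ennreal (h t) * indicator {t. u / 2
          \<le> 1 - t \<and> 1 - t \<le> 4 * u} t \<partial>\<nu>)"
        by (rule nn_integral_cmult) measurable
      also have "\<dots> \<le> ennreal (c * 4 powr \<kappa> * u powr (- \<kappa>)) * ennreal (K * u powr ((\<alpha> + 2) * r / p))"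
        by (intro mult_left_mono carl u) simp
      also have "\<dots> = ennreal (c * 4 powr \<kappa> * K * (u powr (- \<kappa>) * u powr ((\<alpha> + 2) * r / p)))"
        using K by (subst ennreal_mult''[symmetric]) (auto simp: mult_ac)
      also have "u powr (- \<kappa>) * u powr ((\<alpha> + 2) * r / p) = u powr \<alpha>"
      proof -
        have "- \<kappa> + (\<alpha> + 2) * r / p = \<alpha>" unfolding \<kappa>_def e_def using assms by (simp add: field_simps)
        then show ?thesis by (simp add: powr_add[symmetric])
      qed
      also have "ennreal (c * 4 powr \<kappa> * K * u powr \<alpha>)
          \<le> ennreal (c * 4 powr \<kappa> * K * (2 powr \<bar>\<alpha>\<bar> * (1 - (norm w)\<^sup>2) powr \<alpha>))"
        unfolding u_def using c K w by (intro ennreal_leI mult_left_mono disc_weight_bounds) auto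
      also have "\<dots> = ennreal (c * 4 powr \<kappa> * 2 powr \<bar>\<alpha>\<bar> * K) * ennreal ((1 - (norm w)\<^sup>2) powr \<alpha>)"
        by (subst ennreal_mult''[symmetric]) (auto simp: mult_ac)
      finally have "ennreal (norm (f w) powr p) * (\<integral>\<^sup>+t. ennreal (c * (1 - t) powr (- \<kappa>) * h t)
          * indicator {t. w \<in> shell (1 - t)} t \<partial>\<nu>)
          \<le> ennreal (norm (f w) powr p) * (ennreal (c * 4 powr \<kappa> * 2 powr \<bar>\<alpha>\<bar> * K)
              * ennreal ((1 - (norm w)\<^sup>2) powr \<alpha>))"
        by (intro mult_left_mono) auto
      then show "ennreal (norm (f w) powr p) * (\<integral>\<^sup>+t. ennreal (c * (1 - t) powr (- \<kappa>) * h t)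
          * indicator {t. w \<in> shell (1 - t)} t \<partial>\<nu>)
          \<le> ennreal (c * 4 powr \<kappa> * 2 powr \<bar>\<alpha>\<bar> * K) * (ennreal ((1 - (norm w)\<^sup>2) powr \<alpha>)
              * ennreal (norm (f w) powr p))"
        by (simp add: mult_ac)
    qed
    also have "\<dots> = ennreal (c * 4 powr \<kappa> * 2 powr \<bar>\<alpha>\<bar> * K) * bergman_mass p \<alpha> f"
    proof -
      have "(\<lambda>w. ennreal ((1 - (norm w)\<^sup>2) powr \<alpha>)) \<in> borel_measurable disc"
        by (rule measurable_disc) measurable
      then show ?thesis by (subst nn_integral_cmult) (auto simp: nn_integral_wdisc)
    qed
    also have "\<dots> \<le> ennreal (c * 4 powr \<kappa> * 2 powr \<bar>\<alpha>\<bar> * K) * ennreal N"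
      by (intro mult_left_mono N) simp
    also have "\<dots> = ennreal (c * 4 powr \<kappa> * 2 powr \<bar>\<alpha>\<bar> * K * N)" using N by (intro ennreal_mult''[symmetric])
    also have "c * 4 powr \<kappa> * 2 powr \<bar>\<alpha>\<bar> * K * N = C1 powr e * C2 * 4 powr \<kappa> * 2 powr \<bar>\<alpha>\<bar> * K
        * N powr (r / p)"
    proof -
      have "N powr (r / p) = N powr e * N"
        using N assms by (cases "N = 0") (auto simp: e_def powr_diff)
      then show ?thesis unfolding c_def using C1 N by (simp add: powr_mult)
    qed
    finally show ?thesis .
  qed
  show ?thesis
    by (rule that[of "C1 powr e * C2 * 4 powr \<kappa> * 2 powr \<bar>\<alpha>\<bar>"]) (use C1 C2 main in auto)
qed

section \<open>The integral representation\<close>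

lemma emeasure_radius_growth:
  assumes \<mu>: "on_radius \<mu>" and c: "carleson \<mu> s" and s: "0 \<le> s"
  obtains K where "0 \<le> K" "\<And>d. 0 < d \<Longrightarrow> emeasure \<mu> {t \<in> space \<mu>. 1 - t \<le> d} \<le> ennreal (K * d powr s)"
proof -
  obtain C where C: "\<And>t. t \<in> {0..<1} \<Longrightarrow> emeasure \<mu> {t..<1} \<le> ennreal (C * (1 - t) powr s)"
    using c unfolding carleson_def by blast
  have "emeasure \<mu> {t \<in> space \<mu>. 1 - t \<le> d} \<le> ennreal (max C 0 * d powr s)" if d: "0 < d" for d
  proof -
    have "{t \<in> space \<mu>. 1 - t \<le> d} = {max 0 (1 - d)..<1}"
      unfolding space_radius[OF \<mu>] by auto
    also have "emeasure \<mu> \<dots> \<le> ennreal (C * (1 - max 0 (1 - d)) powr s)"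
      using d by (intro C) auto
    also have "\<dots> \<le> ennreal (max C 0 * d powr s)"
      using d s by (intro ennreal_leI mult_mono powr_mono2) auto
    finally show ?thesis .
  qed
  then show ?thesis using that[of "max C 0"] by simp
qed

lemma carleson_finite_measure:
  assumes \<mu>: "on_radius \<mu>" and c: "carleson \<mu> s"
  shows "finite_measure \<mu>"
proof
  obtain C where "\<And>t. t \<in> {0..<1} \<Longrightarrow> emeasure \<mu> {t..<1} \<le> ennreal (C * (1 - t) powr s)"
    using c unfolding carleson_def by blast
  from this[of 0] show "emeasure \<mu> (space \<mu>) \<noteq> \<infinity>"
    unfolding space_radius[OF \<mu>] by (auto simp: top_unique)
qed

text \<open>After Fubini the inner integral is at most 16 u^(-2) times the measure of {1 - t \<le>
  4u} with u = 1 - |w|, and the Carleson bound makes this O(u^(s-2)). Absolute convergence against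
  mu is thereby reduced to a weighted L^1 condition on the disc.\<close>

lemma radial_coeff_sum_finite:
  assumes \<mu>: "on_radius \<mu>" and c: "carleson \<mu> s" and s: "0 \<le> s"
    and hol: "f holomorphic_on ball 0 1"
    and fin: "(\<integral>\<^sup>+w. ennreal (norm (f w) * (1 - norm w) powr (s - 2)) \<partial>disc) < \<infinity>"
  shows "(\<integral>\<^sup>+t. (\<Sum>k. ennreal (norm (taylor_coeff f k) * t ^ k)) \<partial>\<mu>) < \<infinity>"
proof -
  obtain K where K: "0 \<le> K" "\<And>d. 0 < d \<Longrightarrow> emeasure \<mu> {t \<in> space \<mu>. 1 - t \<le> d} \<le> ennreal (K * d powr s)"
    using emeasure_radius_growth[OF \<mu> c s] by blast
  have fm: "finite_measure \<mu>" by (rule carleson_finite_measure[OF \<mu> c])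
  have [measurable]: "(\<lambda>t. t) \<in> borel_measurable \<mu>" by (intro measurable_radius \<mu> continuous_intros)
  have [measurable]: "f \<in> borel_measurable disc" by (rule holomorphic_disc_measurable[OF hol])
  have nm[measurable]: "(\<lambda>w. (1 - norm w) powr (s - 2)) \<in> borel_measurable disc"
    by (rule measurable_disc) measurable
  have "(\<integral>\<^sup>+t. (\<Sum>k. ennreal (norm (taylor_coeff f k) * t ^ k)) \<partial>\<mu>)
     \<le> (\<integral>\<^sup>+t. ennreal (4 / (1 - t)\<^sup>2) * (\<integral>\<^sup>+w\<in>shell (1 - t). ennreal (norm (f w)) \<partial>disc) \<partial>\<mu>)"
    using space_radius[OF \<mu>] by (intro nn_integral_mono taylor_coeff_sum_shell[OF hol]) auto
  also have "\<dots> = (\<integral>\<^sup>+w. ennreal (norm (f w)) * (\<integral>\<^sup>+t. ennreal (4 / (1 - t)\<^sup>2)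
      * indicator {t. w \<in> shell (1 - t)} t \<partial>\<mu>) \<partial>disc)"
    by (rule radius_disc_Fubini[OF \<mu> fm]) measurable
  also have "\<dots> \<le> (\<integral>\<^sup>+w. ennreal (16 * 4 powr s * K) * ennreal (norm (f w) * (1 - norm w) powr (s - 2)) \<partial>disc)"
  proof (intro nn_integral_mono)
    fix w assume "w \<in> space disc"
    then have w: "norm w < 1" by simp
    define u where "u = 1 - norm w"
    have u: "0 < u" unfolding u_def using w by auto
    have "(\<integral>\<^sup>+t. ennreal (4 / (1 - t)\<^sup>2) * indicator {t. w \<in> shell (1 - t)} t \<partial>\<mu>)
      \<le> (\<integral>\<^sup>+t. ennreal (16 / u\<^sup>2) * indicator {t \<in> space \<mu>. 1 - t \<le> 4 * u} t \<partial>\<mu>)"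
    proof (intro nn_integral_mono)
      fix t assume t: "t \<in> space \<mu>"
      then have t01: "0 \<le> t" "t < 1" using space_radius[OF \<mu>] by auto
      show "ennreal (4 / (1 - t)\<^sup>2) * indicator {t. w \<in> shell (1 - t)} t
          \<le> ennreal (16 / u\<^sup>2) * indicator {t \<in> space \<mu>. 1 - t \<le> 4 * u} t"
      proof (cases "w \<in> shell (1 - t)")
        case True
        then have b: "u / 2 \<le> 1 - t" "1 - t \<le> 4 * u" by (auto simp: shell_def u_def field_simps)
        have "(u / 2)\<^sup>2 \<le> (1 - t)\<^sup>2" using b u by (intro power_mono) auto
        then have "4 / (1 - t)\<^sup>2 \<le> 4 / (u / 2)\<^sup>2" using u
            by (intro divide_left_mono mult_pos_pos) (auto intro: less_le_trans[of _ "(u/2)\<^sup>2"])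
        also have "\<dots> = 16 / u\<^sup>2" by (simp add: power2_eq_square)
        finally show ?thesis using True b t by (simp add: ennreal_leI)
      qed simp
    qed
    also have "\<dots> = ennreal (16 / u\<^sup>2) * emeasure \<mu> {t \<in> space \<mu>. 1 - t \<le> 4 * u}"
      by (rule nn_integral_cmult_indicator) measurable
    also have "\<dots> \<le> ennreal (16 / u\<^sup>2) * ennreal (K * (4 * u) powr s)"
      using u by (intro mult_left_mono K) auto
    also have "\<dots> = ennreal (16 / u\<^sup>2 * (K * (4 * u) powr s))"
      using u K by (intro ennreal_mult'[symmetric]) auto
    also have "16 / u\<^sup>2 * (K * (4 * u) powr s) = 16 * 4 powr s * K * u powr (s - 2)"
      using u by (simp add: powr_mult powr_diff powr_numeral field_simps)
    finally have "ennreal (norm (f w)) * (\<integral>\<^sup>+t. ennreal (4 / (1 - t)\<^sup>2)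
        * indicator {t. w \<in> shell (1 - t)} t \<partial>\<mu>)
        \<le> ennreal (norm (f w)) * ennreal (16 * 4 powr s * K * u powr (s - 2))"
      by (intro mult_left_mono) auto
    also have "\<dots> = ennreal (16 * 4 powr s * K) * ennreal (norm (f w) * u powr (s - 2))"
      using K by (simp add: ennreal_mult''[symmetric] mult_ac)
    finally show "ennreal (norm (f w)) * (\<integral>\<^sup>+t. ennreal (4 / (1 - t)\<^sup>2)
        * indicator {t. w \<in> shell (1 - t)} t \<partial>\<mu>)
        \<le> ennreal (16 * 4 powr s * K) * ennreal (norm (f w) * (1 - norm w) powr (s - 2))"
      unfolding u_def .
  qed
  also have "\<dots> = ennreal (16 * 4 powr s * K) * (\<integral>\<^sup>+w. ennreal (norm (f w) * (1 - norm w) powr (s - 2)) \<partial>disc)"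
    by (rule nn_integral_cmult) measurable
  also have "\<dots> < \<infinity>" using fin by (simp add: ennreal_mult_less_top)
  finally show ?thesis .
qed

text \<open>The Gamma quotient in \<open>mu_coeff\<close> is the rising factorial of \<beta> over
  n!, hence the n-th coefficient of (1 - w)^(-\<beta>); this is how the kernel arises.\<close>

lemma binomial_series_kernel:
  fixes w :: complex
  assumes "norm w < 1" "0 < \<beta>"
  shows "(\<lambda>n. of_real (Gamma (real n + \<beta>) / (fact n * Gamma \<beta>)) * w ^ n) sums (1 - w) powr (- of_real \<beta>)"
proof -
  have "(- of_real \<beta> gchoose n) * (- w) ^ n = of_real (Gamma (real n + \<beta>) / (fact n * Gamma \<beta>)) * w ^ n" for n
  proof -
    have "(- of_real \<beta> gchoose n :: complex) = (- 1) ^ n * pochhammer (of_real \<beta>) n / fact n"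
      by (simp add: gbinomial_pochhammer)
    also have "pochhammer (of_real \<beta>) n = (of_real (pochhammer \<beta> n) :: complex)"
        by (simp add: pochhammer_of_real)
    also have "pochhammer \<beta> n = Gamma (real n + \<beta>) / Gamma \<beta>"
      using assms by (subst pochhammer_Gamma) (auto simp: add.commute dest: nonpos_Ints_nonpos)
    finally show ?thesis by (simp add: power_minus[of w n] minus_one_power_iff)
  qed
  then show ?thesis using gen_binomial_complex[of "- w" "- of_real \<beta>"] assms by simp
qed

lemma taylor_coeff_sums:
  assumes "f holomorphic_on ball 0 1" "norm z < 1"
  shows "(\<lambda>k. taylor_coeff f k * z ^ k) sums f z"
  using holomorphic_power_series[OF assms(1), of z] assms(2) by (simp add: taylor_coeff_def)

text \<open>Sum and integral are exchanged twice. The sum over k is dominated through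
  \<open>fin\<close>, as t^n \<le> 1; the sum over n by c_n |z|^n |f(t)|, where f is integrable
  along the radius, again by \<open>fin\<close>. The hypothesis concerns absolute coefficient sums
  because \<open>hilbert_defined\<close> asks for convergence of the series over k.\<close>

theorem hilbert_representation:
  assumes \<mu>: "on_radius \<mu>" "finite_measure \<mu>" and \<beta>: "0 < \<beta>"
    and hol: "f holomorphic_on ball 0 1"
    and fin: "(\<integral>\<^sup>+t. (\<Sum>k. ennreal (norm (taylor_coeff f k) * t ^ k)) \<partial>\<mu>) < \<infinity>"
  shows "hilbert_defined \<mu> \<beta> f"
    and "integrable \<mu> (\<lambda>t. f (of_real t))"
    and "norm z < 1 \<Longrightarrow> integrable \<mu> (\<lambda>t. f (of_real t) * (1 - of_real t * z) powr (- of_real \<beta>))"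
    and "norm z < 1 \<Longrightarrow> hilbert_op \<mu> \<beta> f z = (\<integral>t. f (of_real t) * (1 - of_real t * z) powr (- of_real \<beta>) \<partial>\<mu>)"
proof -
  interpret M: finite_measure \<mu> by (rule \<mu>)
  have [measurable]: "(\<lambda>t. t) \<in> borel_measurable \<mu>" by (intro measurable_radius \<mu> continuous_intros)
  have sp: "space \<mu> = {0..<1}" by (rule space_radius[OF \<mu>(1)])
  have cf: "continuous_on {0..<1} (\<lambda>t::real. f (of_real t))"
    by (intro continuous_on_compose2[OF holomorphic_on_imp_continuous_on[OF hol]] continuous_intros) auto
  have [measurable]: "(\<lambda>t. f (of_real t)) \<in> borel_measurable \<mu>" by (rule measurable_radius[OF \<mu>(1) cf])
  define a where "a = taylor_coeff f"
  define c where "c n = Gamma (real n + \<beta>) / (fact n * Gamma \<beta>)" for n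
  have c0: "0 \<le> c n" for n unfolding c_def using \<beta>
      by (intro divide_nonneg_nonneg mult_nonneg_nonneg) (auto simp: Gamma_real_nonneg)
  have csum: "(\<lambda>n. of_real (c n) * w ^ n) sums (1 - w) powr (- of_real \<beta>)" if "norm w < 1" for w :: complex
    unfolding c_def by (rule binomial_series_kernel[OF that \<beta>])
  \<comment> \<open>At a real point r \<ge> 0 the binomial series has nonnegative terms, so its sum
    yields absolute convergence for |z| = r.\<close>
  have cabs: "summable (\<lambda>n. c n * r ^ n)" if "0 \<le> r" "r < 1" for r
  proof -
    have "summable (\<lambda>n. complex_of_real (c n * r ^ n))"
      using sums_summable[OF csum[of "of_real r"]] that by simp
    then show ?thesis by (simp only: summable_of_real_iff)
  qed
  have asum: "(\<lambda>k. a k * of_real t ^ k) sums f (of_real t)" if "t \<in> space \<mu>" for t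
    unfolding a_def using that sp by (intro taylor_coeff_sums[OF hol]) auto
  \<comment> \<open>Convergence at the larger radius (1 + t)/2 forces absolute convergence at
    t.\<close>
  have aabs: "summable (\<lambda>k. norm (a k) * t ^ k)" if t: "t \<in> space \<mu>" for t
  proof -
    have "(1 + t) / 2 \<in> space \<mu>" using t sp by auto
    moreover have "norm (complex_of_real t) < norm (complex_of_real ((1 + t) / 2))"
      using t sp by (simp only: norm_of_real) auto
    ultimately have "summable (\<lambda>k. norm (a k * of_real t ^ k))"
      using powser_insidea[OF sums_summable[OF asum]] by blast
    then show ?thesis using t sp by (simp add: norm_mult norm_power)
  qed
  have momint: "integrable \<mu> (\<lambda>t. t ^ m)" for m
    using sp by (intro M.integrable_const_bound[of _ 1]) (auto simp: power_le_one)
  have f_abs: "ennreal (norm (f (of_real t))) \<le> (\<Sum>k. ennreal (norm (a k) * t ^ k))" if t: "t \<in> space \<mu>" for t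
  proof -
    have "norm (f (of_real t)) \<le> (\<Sum>k. norm (a k * of_real t ^ k))"
      unfolding sums_unique[OF asum[OF t]] using aabs[OF t] t sp
          by (intro summable_norm) (simp add: norm_mult norm_power)
    also have "\<dots> = (\<Sum>k. norm (a k) * t ^ k)" using t sp by (simp add: norm_mult norm_power)
    finally show ?thesis using aabs[OF t] t sp by (subst suminf_ennreal2) (auto intro!: ennreal_leI)
  qed
  show fint: "integrable \<mu> (\<lambda>t. f (of_real t))"
  proof (rule integrableI_bounded)
    have "(\<integral>\<^sup>+t. ennreal (norm (f (of_real t))) \<partial>\<mu>) \<le> (\<integral>\<^sup>+t. (\<Sum>k. ennreal (norm (a k) * t ^ k)) \<partial>\<mu>)"
      by (intro nn_integral_mono f_abs)
    then show "(\<integral>\<^sup>+t. ennreal (norm (f (of_real t))) \<partial>\<mu>) < \<infinity>" using fin unfolding a_def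
        by (rule le_less_trans)
  qed measurable
  \<comment> \<open>Tonelli turns \<open>fin\<close> into summability of |a_k| times the k-th moment
    of the measure.\<close>
  have acoef: "summable (\<lambda>k. \<integral>t. norm (a k) * t ^ k \<partial>\<mu>)"
  proof (rule summable_suminf_not_top)
    have "(\<Sum>k. ennreal (\<integral>t. norm (a k) * t ^ k \<partial>\<mu>)) = (\<Sum>k. \<integral>\<^sup>+t. ennreal (norm (a k) * t ^ k) \<partial>\<mu>)"
      using momint sp by (intro suminf_cong nn_integral_eq_integral[symmetric]) auto
    also have "\<dots> = (\<integral>\<^sup>+t. (\<Sum>k. ennreal (norm (a k) * t ^ k)) \<partial>\<mu>)"
      by (rule nn_integral_suminf[symmetric]) measurable
    finally show "(\<Sum>k. ennreal (\<integral>t. norm (a k) * t ^ k \<partial>\<mu>)) \<noteq> top" using fin unfolding a_def by simp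
    show "0 \<le> (\<integral>t. norm (a k) * t ^ k \<partial>\<mu>)" for k using sp by (intro integral_nonneg_AE) auto
  qed
  have coeff: "(\<lambda>k. complex_of_real (mu_coeff \<mu> \<beta> n k) * taylor_coeff f k) sums (of_real (c n)
      * (\<integral>t. of_real t ^ n * f (of_real t) \<partial>\<mu>))" for n
  proof -
    have "(\<lambda>k. \<integral>t. of_real (t ^ (n + k)) * a k \<partial>\<mu>) sums (\<integral>t. (\<Sum>k. of_real (t ^ (n + k)) * a k) \<partial>\<mu>)"
    proof (rule sums_integral)
      show "integrable \<mu> (\<lambda>t. of_real (t ^ (n + k)) * a k)" for k
        by (intro integrable_mult_left integrable_of_real momint)
      have le: "norm (of_real (t ^ (n + k)) * a k) \<le> norm (a k) * t ^ k" if "t \<in> space \<mu>" for t k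
      proof -
        have "t ^ n * (norm (a k) * t ^ k) \<le> 1 * (norm (a k) * t ^ k)"
          using that sp by (intro mult_right_mono) (auto simp: power_le_one)
        then show ?thesis using that sp by (simp add: norm_mult norm_power power_add mult_ac)
      qed
      show "AE t in \<mu>. summable (\<lambda>k. norm (complex_of_real (t ^ (n + k)) * a k))"
      proof (rule AE_I2)
        fix t assume t: "t \<in> space \<mu>"
        show "summable (\<lambda>k. norm (complex_of_real (t ^ (n + k)) * a k))"
        proof (rule summable_comparison_test'[OF aabs[OF t]])
          show "norm (norm (complex_of_real (t ^ (n + k)) * a k)) \<le> norm (a k) * t ^ k" for k
            using le[OF t] by simp
        qed
      qed
      show "summable (\<lambda>k. \<integral>t. norm (complex_of_real (t ^ (n + k)) * a k) \<partial>\<mu>)"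
      proof (rule summable_comparison_test'[OF acoef])
        fix k :: nat
        have "(\<integral>t. norm (complex_of_real (t ^ (n + k)) * a k) \<partial>\<mu>) \<le> (\<integral>t. norm (a k) * t ^ k \<partial>\<mu>)"
          by (intro integral_mono le integrable_norm integrable_mult_left integrable_mult_right
              integrable_of_real momint)
        then show "norm (\<integral>t. norm (complex_of_real (t ^ (n + k)) * a k) \<partial>\<mu>) \<le> (\<integral>t. norm (a k) * t ^ k \<partial>\<mu>)"
          by (simp add: integral_nonneg_AE)
      qed
    qed
    also have "(\<integral>t. (\<Sum>k. of_real (t ^ (n + k)) * a k) \<partial>\<mu>) = (\<integral>t. of_real t ^ n * f (of_real t) \<partial>\<mu>)"
    proof (rule Bochner_Integration.integral_cong[OF refl])
      fix t assume "t \<in> space \<mu>"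
      from sums_mult[OF asum[OF this], of "of_real t ^ n"]
      show "(\<Sum>k. complex_of_real (t ^ (n + k)) * a k) = of_real t ^ n * f (of_real t)"
        by (intro sums_unique[symmetric]) (simp add: power_add mult_ac)
    qed
    finally have "(\<lambda>k. of_real (c n) * (\<integral>t. complex_of_real (t ^ (n
        + k)) * a k \<partial>\<mu>)) sums (of_real (c n) * (\<integral>t. of_real t ^ n * f (of_real t) \<partial>\<mu>))"
      by (rule sums_mult)
    moreover have "complex_of_real (mu_coeff \<mu> \<beta> n k) * taylor_coeff f k
        = of_real (c n) * (\<integral>t. complex_of_real (t ^ (n + k)) * a k \<partial>\<mu>)" for k
      unfolding mu_coeff_def a_def c_def by (simp only: integral_mult_left_zero integral_complex_of_real
          of_real_mult mult.assoc)
    ultimately show ?thesis by (simp only:)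
  qed
  have hc: "hilbert_coeff \<mu> \<beta> f n = of_real (c n) * (\<integral>t. of_real t ^ n * f (of_real t) \<partial>\<mu>)" for n
    unfolding hilbert_coeff_def by (rule sums_unique[symmetric, OF coeff])
  have main: "integrable \<mu> (\<lambda>t. f (of_real t) * (1 - of_real t * z) powr (- of_real \<beta>)) \<and>
     (\<lambda>n. hilbert_coeff \<mu> \<beta> f n * z ^ n) sums (\<integral>t. f (of_real t) * (1 - of_real t * z) powr (- of_real \<beta>) \<partial>\<mu>)"
    if z: "norm z < 1" for z
  proof -
    \<comment> \<open>The terms of the kernel expansion multiplied by f(t): summed over n they give
      the integrand, integrated they give the terms of the output series.\<close>
    define G where "G n t = (of_real (c n) * z ^ n) * (of_real t ^ n * f (of_real t))" for n t
    have tz: "norm (of_real t * z) < 1" if "t \<in> space \<mu>" for t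
    proof -
      have "t * norm z \<le> 1 * norm z" using that sp by (intro mult_right_mono) auto
      then show ?thesis using z that sp by (simp add: norm_mult)
    qed
    have tnint: "integrable \<mu> (\<lambda>t. of_real t ^ n * f (of_real t))" for n
    proof (rule Bochner_Integration.integrable_bound[OF fint])
      show "AE t in \<mu>. norm (of_real t ^ n * f (of_real t)) \<le> norm (f (of_real t))"
        using sp by (intro AE_I2) (auto simp: norm_mult norm_power power_le_one mult_left_le_one_le)
    qed measurable
    have Gint: "integrable \<mu> (G n)" for n unfolding G_def by (intro integrable_mult_right tnint)
    have Gle: "norm (G n t) \<le> c n * norm z ^ n * norm (f (of_real t))" if "t \<in> space \<mu>" for n t
    proof -
      have "norm (G n t) = c n * norm z ^ n * (t ^ n * norm (f (of_real t)))"
        using c0 that sp by (simp add: G_def norm_mult norm_power)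
      also have "\<dots> \<le> c n * norm z ^ n * (1 * norm (f (of_real t)))"
        using c0 that sp by (intro mult_left_mono mult_right_mono) (auto simp: power_le_one)
      finally show ?thesis by simp
    qed
    have AE: "AE t in \<mu>. summable (\<lambda>n. norm (G n t))"
    proof (rule AE_I2)
      fix t assume t: "t \<in> space \<mu>"
      have "summable (\<lambda>n. c n * norm z ^ n * norm (f (of_real t)))" using cabs[of "norm z"] z
          by (intro summable_mult2) auto
      then show "summable (\<lambda>n. norm (G n t))"
      proof (rule summable_comparison_test')
        show "norm (norm (G n t)) \<le> c n * norm z ^ n * norm (f (of_real t))" for n
          using Gle[OF t] by simp
      qed
    qed
    have sn: "summable (\<lambda>n. \<integral>t. norm (G n t) \<partial>\<mu>)"
    proof (rule summable_comparison_test')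
      show "summable (\<lambda>n. c n * norm z ^ n * (\<integral>t. norm (f (of_real t)) \<partial>\<mu>))"
        using cabs[of "norm z"] z by (intro summable_mult2) auto
      fix n :: nat
      have "(\<integral>t. norm (G n t) \<partial>\<mu>) \<le> (\<integral>t. c n * norm z ^ n * norm (f (of_real t)) \<partial>\<mu>)"
        using Gint fint by (intro integral_mono Gle) auto
      also have "\<dots> = c n * norm z ^ n * (\<integral>t. norm (f (of_real t)) \<partial>\<mu>)" by simp
      finally show "norm (\<integral>t. norm (G n t) \<partial>\<mu>) \<le> c n * norm z ^ n * (\<integral>t. norm (f (of_real t)) \<partial>\<mu>)"
        by (simp add: integral_nonneg_AE)
    qed
    have Gsum: "(\<Sum>n. G n t) = f (of_real t) * (1 - of_real t * z) powr (- of_real \<beta>)" if "t \<in> space \<mu>" for t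
      using sums_mult[OF csum[OF tz[OF that]], of "f (of_real t)"]
      by (intro sums_unique[symmetric]) (simp add: G_def power_mult_distrib mult_ac)
    have "(\<lambda>n. \<integral>t. G n t \<partial>\<mu>) sums (\<integral>t. (\<Sum>n. G n t) \<partial>\<mu>)" by (rule sums_integral[OF Gint AE sn])
    moreover have "(\<integral>t. G n t \<partial>\<mu>) = hilbert_coeff \<mu> \<beta> f n * z ^ n" for n
      unfolding G_def hc by simp
    moreover have "integrable \<mu> (\<lambda>t. \<Sum>n. G n t)" by (rule integrable_suminf[OF Gint AE sn])
    moreover have "integrable \<mu> (\<lambda>t. \<Sum>n. G n t) \<longleftrightarrow> integrable \<mu> (\<lambda>t. f (of_real t) * (1 - of_real t
        * z) powr (- of_real \<beta>))"
      by (intro Bochner_Integration.integrable_cong refl Gsum)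
    moreover have "(\<integral>t. (\<Sum>n. G n t) \<partial>\<mu>) = (\<integral>t. f (of_real t) * (1 - of_real t * z) powr (- of_real \<beta>) \<partial>\<mu>)"
      by (intro Bochner_Integration.integral_cong refl Gsum)
    ultimately show ?thesis by simp
  qed
  show "hilbert_defined \<mu> \<beta> f"
    unfolding hilbert_defined_def
  proof (intro conjI allI ballI)
    show "summable (\<lambda>k. complex_of_real (mu_coeff \<mu> \<beta> n k) * taylor_coeff f k)" for n
      by (rule sums_summable[OF coeff])
    show "summable (\<lambda>n. hilbert_coeff \<mu> \<beta> f n * z ^ n)" if "z \<in> ball 0 1" for z
      using main[of z] that by (intro sums_summable[OF conjunct2]) auto
  qed
  show "norm z < 1 \<Longrightarrow> integrable \<mu> (\<lambda>t. f (of_real t) * (1 - of_real t * z) powr (- of_real \<beta>))"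
    using main by blast
  show "norm z < 1 \<Longrightarrow> hilbert_op \<mu> \<beta> f z = (\<integral>t. f (of_real t) * (1 - of_real t * z) powr (- of_real \<beta>) \<partial>\<mu>)"
    unfolding hilbert_op_def by (rule sums_unique[symmetric]) (use main in blast)
qed

lemma hilbert_op_holomorphic:
  assumes "hilbert_defined \<mu> \<beta> f"
  shows "hilbert_op \<mu> \<beta> f holomorphic_on ball 0 1"
proof (rule power_series_holomorphic)
  fix w :: complex assume "w \<in> ball 0 1"
  then have "summable (\<lambda>n. hilbert_coeff \<mu> \<beta> f n * w ^ n)"
    using assms unfolding hilbert_defined_def by blast
  then show "(\<lambda>n. hilbert_coeff \<mu> \<beta> f n * (w - 0) ^ n) sums hilbert_op \<mu> \<beta> f w"
    unfolding hilbert_op_def by (simp add: summable_sums)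
qed

section \<open>Bergman spaces\<close>

lemma bergman_int_eq:
  assumes "f holomorphic_on ball 0 1"
  shows "bergman_int p \<alpha> f = ennreal ((\<alpha> + 1) / pi) * bergman_mass p \<alpha> f"
proof -
  have [measurable]: "f \<in> borel_measurable disc" by (rule holomorphic_disc_measurable[OF assms])
  have "bergman_mass p \<alpha> f = (\<integral>\<^sup>+z. ennreal ((1 - (norm z)\<^sup>2) powr \<alpha>) * ennreal (norm (f z) powr p) \<partial>disc)"
    by (rule nn_integral_wdisc) measurable
  also have "\<dots> = (\<integral>\<^sup>+z. ennreal (norm (f z) powr p * (1 - (norm z)\<^sup>2) powr \<alpha>) \<partial>disc)"
    by (simp add: ennreal_mult'[symmetric] mult.commute)
  finally show ?thesis unfolding bergman_int_def nn_integral_disc by simp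
qed

lemma bergman_space_iff:
  assumes "-1 < \<alpha>"
  shows "f \<in> bergman_space p \<alpha> \<longleftrightarrow> f holomorphic_on ball 0 1 \<and> bergman_mass p \<alpha> f < \<infinity>"
  unfolding bergman_space_def using assms
  by (auto simp: bergman_int_eq ennreal_mult_less_top ennreal_mult_eq_top_iff less_top[symmetric])

lemma bergman_norm_bound:
  assumes "-1 < \<alpha>" "0 < p" "f \<in> bergman_space p \<alpha>" "bergman_norm p \<alpha> f \<le> M"
  shows "bergman_mass p \<alpha> f \<le> ennreal (pi / (\<alpha> + 1) * M powr p)"
proof -
  have f: "f holomorphic_on ball 0 1" "bergman_mass p \<alpha> f < \<infinity>"
    using assms by (auto simp: bergman_space_iff)
  obtain v where v: "0 \<le> v" "bergman_mass p \<alpha> f = ennreal v"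
    using f(2) by (cases "\<integral>\<^sup>+z. ennreal (norm (f z) powr p) \<partial>wdisc \<alpha>") auto
  have "bergman_norm p \<alpha> f = ((\<alpha> + 1) / pi * v) powr (1 / p)"
    unfolding bergman_norm_def bergman_int_eq[OF f(1)] v(2) using assms v
        by (simp add: ennreal_mult'[symmetric])
  then have "((\<alpha> + 1) / pi * v) powr (1 / p) \<le> M" using assms by simp
  then have "(((\<alpha> + 1) / pi * v) powr (1 / p)) powr p \<le> M powr p" using assms by (intro powr_mono2) auto
  then have "(\<alpha> + 1) / pi * v \<le> M powr p" using assms v by (simp add: powr_powr)
  then show ?thesis unfolding v(2) using assms by (intro ennreal_leI) (simp add: field_simps)
qed

text \<open>On the space the norm is a fixed power of a multiple of a finite mass. Membership
  matters: \<open>enn2real\<close> sends an infinite mass to 0, and the norm would vanish with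
  it.\<close>

lemma bergman_norm_tendsto_zero_iff:
  assumes "-1 < \<gamma>" "0 < q" "\<And>j. u j \<in> bergman_space q \<gamma>"
  shows "(\<lambda>j. bergman_norm q \<gamma> (u j)) \<longlonglongrightarrow> 0 \<longleftrightarrow> (\<lambda>j. \<integral>\<^sup>+z. ennreal (norm (u j z) powr q) \<partial>wdisc \<gamma>) \<longlonglongrightarrow> 0"
proof -
  define v where "v j = enn2real (bergman_mass q \<gamma> (u j))" for j
  have v: "0 \<le> v j" "bergman_mass q \<gamma> (u j) = ennreal (v j)" for j
    using assms(3)[of j] unfolding bergman_space_iff[OF assms(1)] v_def by auto
  define k where "k = (\<gamma> + 1) / pi"
  have k: "0 < k" unfolding k_def using assms by simp
  have bn: "bergman_norm q \<gamma> (u j) = (k * v j) powr (1 / q)" for j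
    using assms(3)[of j] v k unfolding bergman_norm_def bergman_space_iff[OF assms(1)]
    by (simp add: bergman_int_eq k_def[symmetric] ennreal_mult'[symmetric])
  have "(\<lambda>j. (k * v j) powr (1 / q)) \<longlonglongrightarrow> 0 \<longleftrightarrow> v \<longlonglongrightarrow> 0"
  proof
    assume l: "(\<lambda>j. (k * v j) powr (1 / q)) \<longlonglongrightarrow> 0"
    have "(\<lambda>j. ((k * v j) powr (1 / q)) powr q) \<longlonglongrightarrow> 0"
      by (rule tendsto_zero_powrI[OF l, of "\<lambda>_. q" q]) (use assms in auto)
    then have "(\<lambda>j. k * v j) \<longlonglongrightarrow> 0" using assms k v by (simp add: powr_powr)
    then have "(\<lambda>j. 1 / k * (k * v j)) \<longlonglongrightarrow> 1 / k * 0" by (rule tendsto_mult_left)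
    then show "v \<longlonglongrightarrow> 0" using k by simp
  next
    assume "v \<longlonglongrightarrow> 0"
    then have "(\<lambda>j. k * v j) \<longlonglongrightarrow> k * 0" by (rule tendsto_mult_left)
    then have l: "(\<lambda>j. k * v j) \<longlonglongrightarrow> 0" by simp
    show "(\<lambda>j. (k * v j) powr (1 / q)) \<longlonglongrightarrow> 0"
      by (rule tendsto_zero_powrI[OF l, of "\<lambda>_. 1 / q" "1 / q"]) (use assms k v in auto)
  qed
  moreover have "(\<lambda>j. ennreal (v j)) \<longlonglongrightarrow> 0 \<longleftrightarrow> v \<longlonglongrightarrow> 0"
    using v by (subst ennreal_0[symmetric], subst tendsto_ennreal_iff) auto
  ultimately show ?thesis unfolding bn v(2) by simp
qed

text \<open>For p \<le> 1 the growth bound absorbs 1/p - 1 factors |f|^p, and at s = (\<alpha>+2)/p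
  the weight left over is exactly (1 - |w|)^\<alpha>. For p > 1 Young's inequality splits off a pure
  power of 1 - |w|, whose integrability forces the strict inequality on s.\<close>

lemma bergman_weighted_l1_finite:
  assumes \<alpha>: "-1 < \<alpha>" and p: "0 < p" and f: "f \<in> bergman_space p \<alpha>"
    and s: "(p \<le> 1 \<and> (\<alpha> + 2) / p \<le> s) \<or> (1 < p \<and> 1 + (\<alpha> + 1) / p < s)"
  shows "(\<integral>\<^sup>+w. ennreal (norm (f w) * (1 - norm w) powr (s - 2)) \<partial>disc) < \<infinity>"
proof -
  have hol: "f holomorphic_on ball 0 1" and fin: "bergman_mass p \<alpha> f < \<infinity>"
    using f by (auto simp: bergman_space_iff[OF \<alpha>])
  have [measurable]: "f \<in> borel_measurable disc" by (rule holomorphic_disc_measurable[OF hol])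
  have [measurable]: "(\<lambda>w. (1 - (norm w)\<^sup>2) powr \<alpha>) \<in> borel_measurable disc" "(\<lambda>w. (1 - norm w) powr a)
      \<in> borel_measurable disc" for a
    by (rule measurable_disc, measurable)+
  define J where "J = (\<integral>\<^sup>+z. ennreal ((1 - (norm z)\<^sup>2) powr \<alpha>) * ennreal (norm (f z) powr p) \<partial>disc)"
  have J: "J < \<infinity>" using fin unfolding J_def by (subst (asm) nn_integral_wdisc) auto
  consider (small) "p \<le> 1" "(\<alpha> + 2) / p \<le> s" | (large) "1 < p" "1 + (\<alpha> + 1) / p < s" using s by blast
  then show ?thesis
  proof cases
    case small
    obtain N where N: "0 \<le> N" "bergman_mass p \<alpha> f = ennreal N"
      using fin by (cases "\<integral>\<^sup>+z. ennreal (norm (f z) powr p) \<partial>wdisc \<alpha>") auto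
    obtain C where C: "0 < C" "\<And>z. norm z < 1 \<Longrightarrow> norm (f z) powr p \<le> C * N * (1 - norm z) powr (- (\<alpha> + 2))"
      using bergman_pointwise_bound[OF p, of \<alpha>] hol N by (metis order_refl)
    define e where "e = 1 / p - 1"
    have e: "0 \<le> e" unfolding e_def using small p by simp
    have "(\<integral>\<^sup>+w. ennreal (norm (f w) * (1 - norm w) powr (s - 2)) \<partial>disc)
      \<le> (\<integral>\<^sup>+w. ennreal ((C * N) powr e * 2 powr \<bar>\<alpha>\<bar>) * (ennreal ((1 - (norm w)\<^sup>2) powr \<alpha>)
          * ennreal (norm (f w) powr p)) \<partial>disc)"
    proof (intro nn_integral_mono)
      fix w assume "w \<in> space disc"
      then have w: "norm w < 1" by simp
      define u where "u = 1 - norm w"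
      have u: "0 < u" "u \<le> 1" unfolding u_def using w by auto
      define a where "a = norm (f w)"
      have "a = (a powr p) powr e * a powr p"
      proof (cases "a = 0")
        case False
        then have "(a powr p) powr e * a powr p = a powr (p * e + p)" by (simp add: powr_powr powr_add)
        also have "p * e + p = 1" unfolding e_def using p by (simp add: field_simps)
        finally show ?thesis using False by (simp add: a_def)
      qed (use p in simp)
      also have "\<dots> \<le> (C * N * u powr (- (\<alpha> + 2))) powr e * a powr p"
        using C(2)[OF w] e by (intro mult_right_mono powr_mono2) (auto simp: a_def u_def)
      also have "(C * N * u powr (- (\<alpha> + 2))) powr e = (C * N) powr e * u powr (- ((\<alpha> + 2) * e))"
        by (simp only: powr_mult powr_powr mult_minus_left)
      finally have "a * u powr (s - 2) \<le> ((C * N) powr e * u powr (- ((\<alpha>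
          + 2) * e)) * a powr p) * u powr ((\<alpha> + 2) / p - 2)"
        using small u by (intro mult_mono powr_mono') auto
      also have "\<dots> = (C * N) powr e * a powr p * (u powr (- ((\<alpha> + 2) * e)) * u powr ((\<alpha>
          + 2) / p - 2))" by simp
      also have "u powr (- ((\<alpha> + 2) * e)) * u powr ((\<alpha> + 2) / p - 2) = u powr \<alpha>"
      proof -
        have "- ((\<alpha> + 2) * e) + ((\<alpha> + 2) / p - 2) = \<alpha>" unfolding e_def using p by (simp add: field_simps)
        then show ?thesis by (simp add: powr_add[symmetric])
      qed
      also have "(C * N) powr e * a powr p * u powr \<alpha>
          \<le> (C * N) powr e * a powr p * (2 powr \<bar>\<alpha>\<bar> * (1 - (norm w)\<^sup>2) powr \<alpha>)"
        unfolding u_def using w by (intro mult_left_mono disc_weight_bounds) auto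
      finally show "ennreal (norm (f w) * (1 - norm w) powr (s - 2))
        \<le> ennreal ((C * N) powr e * 2 powr \<bar>\<alpha>\<bar>) * (ennreal ((1 - (norm w)\<^sup>2) powr \<alpha>)
            * ennreal (norm (f w) powr p))"
        unfolding a_def u_def by (simp add: ennreal_mult'[symmetric] ennreal_leI mult_ac)
    qed
    also have "\<dots> = ennreal ((C * N) powr e * 2 powr \<bar>\<alpha>\<bar>) * J"
      unfolding J_def by (rule nn_integral_cmult) measurable
    also have "\<dots> < \<infinity>" using J by (simp add: ennreal_mult_less_top)
    finally show ?thesis .
  next
    case large
    define p' where "p' = p / (p - 1)"
    have p': "1 < p'" "1 / p + 1 / p' = 1" unfolding p'_def using large by (auto simp: field_simps)
    \<comment> \<open>The exponent of the pure power after pairing (1 - |w|)^(\<alpha>/p) with |f|;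
      \<gamma> > -1 is the same as s > 1 + (\<alpha>+1)/p.\<close>
    define \<gamma> where "\<gamma> = (s - 2 - \<alpha> / p) * p'"
    have "-1 < \<gamma>"
    proof -
      have "1 / p - 1 < s - 2 - \<alpha> / p" using large(2) by (simp add: add_divide_distrib)
      then have "(1 / p - 1) * p' < \<gamma>" unfolding \<gamma>_def using p' by (intro mult_strict_right_mono) auto
      moreover have "(1 / p - 1) * p' = -1" unfolding p'_def using large by (simp add: field_simps)
      ultimately show ?thesis by simp
    qed
    have "(\<integral>\<^sup>+w. ennreal (norm (f w) * (1 - norm w) powr (s - 2)) \<partial>disc)
      \<le> (\<integral>\<^sup>+w. ennreal (2 powr \<bar>\<alpha>\<bar>) * (ennreal ((1 - (norm w)\<^sup>2) powr \<alpha>) * ennreal (norm (f w) powr p))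
          + ennreal ((1 - norm w) powr \<gamma>) \<partial>disc)"
    proof (intro nn_integral_mono)
      fix w assume "w \<in> space disc"
      then have w: "norm w < 1" by simp
      define u where "u = 1 - norm w"
      have u: "0 < u" "u \<le> 1" unfolding u_def using w by auto
      have "norm (f w) * u powr (s - 2) = (norm (f w) * u powr (\<alpha> / p)) * u powr (s - 2 - \<alpha> / p)"
        using u by (simp add: powr_diff)
      also have "\<dots> \<le> (norm (f w) * u powr (\<alpha> / p)) powr p / p + (u powr (s - 2 - \<alpha> / p)) powr p' / p'"
        using large p' by (intro Youngs_inequality) auto
      also have "\<dots> = norm (f w) powr p * u powr \<alpha> / p + u powr \<gamma> / p'"
        using large by (simp add: powr_mult powr_powr \<gamma>_def)
      also have "\<dots> \<le> norm (f w) powr p * u powr \<alpha> + u powr \<gamma>"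
        using large p' divide_left_mono[of 1 p "norm (f w) powr p
            * u powr \<alpha>"] divide_left_mono[of 1 p' "u powr \<gamma>"]
        by (intro add_mono) auto
      also have "\<dots> \<le> norm (f w) powr p * (2 powr \<bar>\<alpha>\<bar> * (1 - (norm w)\<^sup>2) powr \<alpha>) + u powr \<gamma>"
        unfolding u_def using w by (intro add_right_mono mult_left_mono disc_weight_bounds) auto
      finally show "ennreal (norm (f w) * (1 - norm w) powr (s - 2))
        \<le> ennreal (2 powr \<bar>\<alpha>\<bar>) * (ennreal ((1 - (norm w)\<^sup>2) powr \<alpha>) * ennreal (norm (f w) powr p))
            + ennreal ((1 - norm w) powr \<gamma>)"
        unfolding u_def by (simp add: ennreal_mult'[symmetric] ennreal_plus[symmetric] ennreal_leI
            mult_ac del: ennreal_plus)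
    qed
    also have "\<dots> = ennreal (2 powr \<bar>\<alpha>\<bar>) * J + (\<integral>\<^sup>+w. ennreal ((1 - norm w) powr \<gamma>) \<partial>disc)"
      unfolding J_def by (subst nn_integral_add) (auto simp: nn_integral_cmult)
    also have "\<dots> < \<infinity>"
      using J nn_integral_disc_radial_powr_finite[OF \<open>-1 < \<gamma>\<close>] by (simp add: ennreal_mult_less_top)
    finally show ?thesis .
  qed
qed

section \<open>Kernel operators from the radius to the disc\<close>

lemma nn_integral_radius_wdisc_Fubini:
  assumes \<nu>: "finite_measure \<nu>" and "-1 < \<gamma>" "(\<lambda>(z, t). F z t) \<in> borel_measurable (wdisc \<gamma> \<Otimes>\<^sub>M \<nu>)"
  shows "(\<integral>\<^sup>+z. \<integral>\<^sup>+t. F z t \<partial>\<nu> \<partial>wdisc \<gamma>) = (\<integral>\<^sup>+t. \<integral>\<^sup>+z. F z t \<partial>wdisc \<gamma> \<partial>\<nu>)"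
proof -
  interpret D: finite_measure "wdisc \<gamma>" by (rule finite_wdisc) fact
  interpret N: finite_measure \<nu> by (rule \<nu>)
  interpret P: pair_sigma_finite "wdisc \<gamma>" \<nu> ..
  show ?thesis by (rule P.Fubini'[symmetric]) fact
qed

lemma measurable_wdisc_ident [measurable]: "(\<lambda>z. z) \<in> borel_measurable (wdisc \<gamma>)"
  by (simp add: measurable_cong_sets[OF sets_wdisc refl])

text \<open>Only this direction of the comparison is used for upper bounds: it replaces the complex
  kernel by one depending on 1 - t and |1 - z|.\<close>

lemma kernel_norm_bound:
  assumes "norm z < 1" "0 \<le> t" "t < 1" "0 \<le> \<beta>"
  shows "norm (1 - of_real t * z :: complex) powr (- \<beta>) \<le> 3 powr \<beta> * ((1 - t) + norm (1 - z)) powr (- \<beta>)"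
proof -
  have k: "((1 - t) + norm (1 - z)) / 3 \<le> norm (1 - of_real t * z)" "0 < (1 - t) + norm (1 - z)"
    using kernel_comparison[OF assms(1-3)] assms by (auto simp: add_pos_nonneg)
  then have "norm (1 - of_real t * z) powr (- \<beta>) \<le> (((1 - t) + norm (1 - z)) / 3) powr (- \<beta>)"
    using assms by (intro powr_mono2') auto
  also have "\<dots> = 3 powr \<beta> * ((1 - t) + norm (1 - z)) powr (- \<beta>)"
    using k by (simp add: powr_divide powr_minus field_simps)
  finally show ?thesis .
qed

text \<open>The kernel \<open>(x + \<rho>)\<^bsup>-\<beta>\<^esup>\<close> with \<open>x = 1 - t\<close>, \<open>\<rho> = \<bar>1 - z\<bar>\<close> is handled by Schur's test with the weight
  \<open>x\<^sup>a (x + \<rho>)\<^bsup>-b\<^esup>\<close>; any \<open>0 < a < \<beta>/q'\<close> and \<open>0 < b - a < \<beta>/q\<close> would do.\<close>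
lemma kernel_operator_bound:
  assumes \<beta>: "1 < \<beta>" and q: "1 < q" and p: "0 < p" "p \<le> q"
  defines "r \<equiv> 1 + p * (1 - 1 / q)" and "\<sigma> \<equiv> \<beta> * (1 / p + (1 - 1 / q))"
  obtains C where "0 < C" "\<And>\<nu> K E c i.
     on_radius \<nu> \<Longrightarrow> finite_measure \<nu> \<Longrightarrow> 0 < K \<Longrightarrow> 0 < E \<Longrightarrow>
     (\<And>d. 0 < d \<Longrightarrow> emeasure \<nu> {t \<in> space \<nu>. 1 - t \<le> d} \<le> ennreal (K * d powr \<sigma>)) \<Longrightarrow>
     c \<in> borel_measurable \<nu> \<Longrightarrow> (\<And>t. 0 \<le> (c t :: real)) \<Longrightarrow> (\<integral>\<^sup>+t. ennreal (c t powr r) \<partial>\<nu>) \<le> ennreal E \<Longrightarrow>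
     (\<And>z. norm z < 1 \<Longrightarrow> 0 \<le> i z \<and> ennreal (i z) \<le> (\<integral>\<^sup>+t. ennreal (c t * norm (1 - of_real t
         * z) powr (- \<beta>)) \<partial>\<nu>)) \<Longrightarrow>
     (\<integral>\<^sup>+z. ennreal (i z powr q) \<partial>wdisc (\<beta> - 2)) \<le> ennreal (C * K powr ((r - 1) * q / r) * E powr (q / r))"
proof -
  obtain V where V: "0 < V" "\<And>\<rho>. 0 < \<rho> \<Longrightarrow> emeasure (wdisc (\<beta> - 2)) {z \<in> space (wdisc (\<beta> - 2)). norm (1 -
      z) \<le> \<rho>} \<le> ennreal (V * \<rho> powr (\<beta> - 2 + 2))"
    using emeasure_wdisc_near_one[of "\<beta> - 2"] \<beta> by auto
  have V': "emeasure (wdisc (\<beta> - 2)) {z \<in> space (wdisc (\<beta> - 2)). norm (1 - z) \<le> \<rho>}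
      \<le> ennreal (V * \<rho> powr \<beta>)" if "0 < \<rho>" for \<rho>
    using V(2)[OF that] by simp
  \<comment> \<open>1/q', the reciprocal of the conjugate exponent.\<close>
  define k where "k = 1 - 1 / q"
  have k: "0 < k" "k < 1" unfolding k_def using q by auto
  have r: "r = 1 + p * k" unfolding r_def k_def by simp
  have r1: "1 < r" using k p by (simp add: r)
  have rq: "r \<le> q"
  proof -
    have "p * k \<le> q * k" using p k by (intro mult_right_mono) auto
    also have "q * k = q - 1" unfolding k_def using q by (simp add: field_simps)
    finally show ?thesis by (simp add: r)
  qed
  \<comment> \<open>Conjugate to r. The choice r = 1 + pk makes k r' = 1/p + k, so that \<sigma> =
    \<beta> k r'.\<close>
  define r' where "r' = r / (r - 1)"
  have r': "0 < r'" "r' * (r - 1) = r" unfolding r'_def using r1 by auto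
  have \<sigma>: "\<sigma> = \<beta> * k * r'"
  proof -
    have "k * r' = (1 + p * k) / p" unfolding r'_def r using k p by (simp add: field_simps)
    also have "\<dots> = 1 / p + k" using p by (simp add: field_simps)
    finally show ?thesis unfolding \<sigma>_def k_def[symmetric] by (simp add: mult.assoc)
  qed
  \<comment> \<open>The midpoint of the admissible range; likewise b - a is the midpoint of (0,
    \<beta>/q).\<close>
  define a where "a = \<beta> * k / 2"
  define b where "b = a + \<beta> / (2 * q)"
  have a: "0 < a" unfolding a_def using \<beta> k by simp
  have b: "a < b" unfolding b_def using \<beta> q by simp
  have bk: "\<beta> / q = \<beta> - \<beta> * k" unfolding k_def using q by (simp add: field_simps)
  have b': "b = \<beta> / 2" unfolding b_def a_def using bk by simp
  \<comment> \<open>\<open>A1\<close> and \<open>B1\<close> are the exponents of the r'-th power of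
    the kernel divided by the Schur weight. The conditions on a and b say that this power has a
    convergent integral on the radius.\<close>
  define A1 where "A1 = - (a * r')"
  define B1 where "B1 = (\<beta> - b) * r'"
  have AB1: "0 < A1 + \<sigma>" "A1 + \<sigma> < B1" "0 \<le> B1"
  proof -
    have "A1 + \<sigma> = a * r'" unfolding A1_def \<sigma> a_def by (simp add: field_simps)
    then show "0 < A1 + \<sigma>" using a r' by simp
    have "a < \<beta> - b" unfolding b' a_def using \<beta> k by simp
    then show "A1 + \<sigma> < B1" unfolding \<open>A1 + \<sigma> = a * r'\<close> B1_def using r' by (intro mult_strict_right_mono) auto
    show "0 \<le> B1" unfolding B1_def b' using \<beta> r' by simp
  qed
  define w1 where "w1 = weight_const A1 B1 \<sigma>"
  have w1: "0 < w1" unfolding w1_def using AB1 by (intro weight_const_pos) auto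
  \<comment> \<open>A second use of Jensen's inequality raises the power from r to q; s \<ge> 1 is
    where p \<le> q is used.\<close>
  define s where "s = q / r"
  have s: "1 \<le> s" unfolding s_def using rq r1 by simp
  \<comment> \<open>The power of |1 - z| that the first Jensen step leaves behind; \<open>B2\<close>
    comes from the s-th power of \<psi>. They are the exponents of the dual Schur integral over the
    disc.\<close>
  define A2 where "A2 = (A1 + \<sigma> - B1) * ((r - 1) * s)"
  define B2 where "B2 = b * q"
  have A2: "A2 = q * (b - a) - \<beta>"
  proof -
    have "A1 + \<sigma> - B1 = r' * (\<beta> * k - a - \<beta> + b)" unfolding A1_def B1_def \<sigma> by (simp add: algebra_simps)
    then have "A2 = (r' * (r - 1)) * s * (\<beta> * k - a - \<beta> + b)" unfolding A2_def by simp
    also have "(r' * (r - 1)) * s = q" unfolding r' s_def using r1 by simp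
    also have "q * (\<beta> * k - a - \<beta> + b) = q * (b - a) - q * (\<beta> / q)" unfolding bk by (simp add: algebra_simps)
    finally show ?thesis using q by simp
  qed
  have AB2: "0 < A2 + \<beta>" "A2 + \<beta> < B2" "0 \<le> B2"
    unfolding A2 B2_def using a b q by (auto simp: algebra_simps)
  define w2 where "w2 = weight_const A2 B2 \<beta>"
  have w2: "0 < w2" unfolding w2_def using AB2 by (intro weight_const_pos) auto
  define C where "C = 3 powr (\<beta> * q) * w1 powr ((r - 1) * s) * w2 * V"
  have C: "0 < C" unfolding C_def using w1 w2 V by simp
  have main: "(\<integral>\<^sup>+z. ennreal (i z powr q) \<partial>wdisc (\<beta> - 2))
      \<le> ennreal (C * K powr ((r - 1) * q / r) * E powr (q / r))"
    if \<nu>: "on_radius \<nu>" "finite_measure \<nu>" and K: "0 < K" and E: "0 < E"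
      and growth: "\<And>d. 0 < d \<Longrightarrow> emeasure \<nu> {t \<in> space \<nu>. 1 - t \<le> d} \<le> ennreal (K * d powr \<sigma>)"
      and c[measurable]: "c \<in> borel_measurable \<nu>" and c0: "\<And>t. 0 \<le> (c t :: real)"
          and cE: "(\<integral>\<^sup>+t. ennreal (c t powr r) \<partial>\<nu>) \<le> ennreal E"
      and i: "\<And>z. norm z < 1 \<Longrightarrow> 0 \<le> i z \<and> ennreal (i z)
          \<le> (\<integral>\<^sup>+t. ennreal (c t * norm (1 - of_real t * z) powr (- \<beta>)) \<partial>\<nu>)"
    for \<nu> K E c i
  proof -
    have [measurable]: "(\<lambda>t. t) \<in> borel_measurable \<nu>" by (intro measurable_radius \<nu> continuous_intros)
    have sp: "space \<nu> = {0..<1}" by (rule space_radius[OF \<nu>(1)])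
    define M where "M = 3 powr (\<beta> * q) * (w1 * K) powr ((r - 1) * s) * E powr (s - 1)"
    have M: "0 < M" unfolding M_def using w1 K E by simp
    have pt: "ennreal (i z powr q) \<le> (\<integral>\<^sup>+t. ennreal (M * c t powr r * (1 - t) powr (a * q))
        * ennreal (norm (1 - z) powr A2 * (norm (1 - z) + (1 - t)) powr (- B2)) \<partial>\<nu>)"
      if z: "norm z < 1" for z
    proof -
      define \<rho> where "\<rho> = norm (1 - z)"
      have \<rho>: "0 < \<rho>" unfolding \<rho>_def using z by auto
      define i0 where "i0 = i z / 3 powr \<beta>"
      have i0: "0 \<le> i0" using i[OF z] by (simp add: i0_def)
      have xr: "0 < 1 - t" "0 < 1 - t + \<rho>" if "t \<in> space \<nu>" for t using that sp \<rho> by auto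
      define w where "w t = (1 - t) powr A1 * ((1 - t) + \<rho>) powr (- B1)" for t
      \<comment> \<open>Chosen so that \<phi> w is c times the kernel while \<phi>^r w = \<psi> c^r:
        Hoelder's inequality with exponents r and r', put in the form of Jensen's inequality with
        weight w.\<close>
      define \<phi> where "\<phi> t = c t * (1 - t) powr (- A1) * ((1 - t) + \<rho>) powr (B1 - \<beta>)" for t
      define \<psi> where "\<psi> t = (1 - t) powr (a * r) * ((1 - t) + \<rho>) powr (- (b * r))" for t
      define W where "W = w1 * K * \<rho> powr (A1 + \<sigma> - B1)"
      have W: "0 < W" unfolding W_def using w1 K \<rho> by simp
      have [measurable]: "w \<in> borel_measurable \<nu>" "\<phi> \<in> borel_measurable \<nu>" "\<psi> \<in> borel_measurable \<nu>"
        unfolding w_def \<phi>_def \<psi>_def by measurable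
      have iw: "(\<integral>\<^sup>+t. ennreal (w t) \<partial>\<nu>) \<le> ennreal W"
        unfolding w_def W_def w1_def using AB1 K \<rho> growth sp
        by (intro powr_weight_kernel) auto
      have \<phi>w: "\<phi> t * w t = c t * ((1 - t) + \<rho>) powr (- \<beta>)" if "t \<in> space \<nu>" for t
      proof -
        have "\<phi> t * w t = c t * ((1 - t) powr (- A1) * (1 - t) powr A1) * (((1 - t)
            + \<rho>) powr (B1 - \<beta>) * ((1 - t) + \<rho>) powr (- B1))"
          unfolding \<phi>_def w_def by simp
        then show ?thesis using xr[OF that] by (simp only: powr_add[symmetric]) simp
      qed
      have \<phi>rw: "\<phi> t powr r * w t = \<psi> t * c t powr r" if "t \<in> space \<nu>" for t
      proof -
        have "\<phi> t powr r * w t = c t powr r * ((1 - t) powr (- A1 * r) * (1 - t) powr A1) * (((1 - t)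
            + \<rho>) powr ((B1 - \<beta>) * r) * ((1 - t) + \<rho>) powr (- B1))"
          unfolding \<phi>_def w_def by (simp add: powr_mult powr_powr)
        also have "\<dots> = c t powr r * (1 - t) powr (- A1 * r + A1) * ((1 - t) + \<rho>) powr ((B1 - \<beta>) * r + - B1)"
          by (simp only: powr_add)
        also have "- A1 * r + A1 = a * (r' * (r - 1))" unfolding A1_def by (simp add: algebra_simps)
        also have "(B1 - \<beta>) * r + - B1 = (\<beta> - b) * (r' * (r - 1)) - \<beta> * r" unfolding B1_def
            by (simp add: algebra_simps)
        also have "\<dots> = - (b * r)" unfolding r' by (simp add: algebra_simps)
        finally show ?thesis unfolding \<psi>_def r' by (simp add: mult_ac)
      qed
      have "ennreal i0 \<le> (\<integral>\<^sup>+t. ennreal (\<phi> t * w t) \<partial>\<nu>)"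
      proof -
        have "ennreal i0 = ennreal (1 / 3 powr \<beta>) * ennreal (i z)"
            by (simp add: i0_def ennreal_mult'[symmetric])
        also have "\<dots> \<le> ennreal (1 / 3 powr \<beta>) * (\<integral>\<^sup>+t. ennreal (c t * norm (1 - of_real t
            * z) powr (- \<beta>)) \<partial>\<nu>)"
          using i[OF z] by (intro mult_left_mono) auto
        also have "\<dots> = (\<integral>\<^sup>+t. ennreal (1 / 3 powr \<beta>) * ennreal (c t * norm (1 - of_real t
            * z) powr (- \<beta>)) \<partial>\<nu>)"
          by (rule nn_integral_cmult[symmetric]) measurable
        also have "\<dots> \<le> (\<integral>\<^sup>+t. ennreal (\<phi> t * w t) \<partial>\<nu>)"
        proof (intro nn_integral_mono)
          fix t assume t: "t \<in> space \<nu>"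
          have "norm (1 - of_real t * z) powr (- \<beta>) \<le> 3 powr \<beta> * ((1 - t) + \<rho>) powr (- \<beta>)"
            unfolding \<rho>_def using z t sp \<beta> by (intro kernel_norm_bound) auto
          then have "1 / 3 powr \<beta> * (c t * norm (1 - of_real t * z) powr (- \<beta>))
              \<le> 1 / 3 powr \<beta> * (c t * (3 powr \<beta> * ((1 - t) + \<rho>) powr (- \<beta>)))"
            using c0 by (intro mult_left_mono) auto
          also have "\<dots> = \<phi> t * w t" unfolding \<phi>w[OF t] by simp
          finally show "ennreal (1 / 3 powr \<beta>) * ennreal (c t * norm (1 - of_real t * z) powr (- \<beta>))
              \<le> ennreal (\<phi> t * w t)"
            by (subst ennreal_mult'[symmetric]) (auto intro!: ennreal_leI)
        qed
        finally show ?thesis .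
      qed
      then have "ennreal (i0 powr r) \<le> ennreal (W powr (r - 1)) * (\<integral>\<^sup>+t. ennreal (\<phi> t powr r * w t) \<partial>\<nu>)"
        using r1 i0 W iw c0 by (intro jensen_powr_nn_integral) (auto simp: \<phi>_def w_def)
      also have "(\<integral>\<^sup>+t. ennreal (\<phi> t powr r * w t) \<partial>\<nu>) = (\<integral>\<^sup>+t. ennreal (\<psi> t * c t powr r) \<partial>\<nu>)"
        by (intro nn_integral_cong) (simp add: \<phi>rw)
      finally have J1: "ennreal (i0 powr r) \<le> ennreal (W powr (r - 1)) * (\<integral>\<^sup>+t. ennreal (\<psi> t
          * c t powr r) \<partial>\<nu>)" .
      define i1 where "i1 = W powr (1 - r) * i0 powr r"
      have "ennreal i1 = ennreal (W powr (1 - r)) * ennreal (i0 powr r)" by (simp add: i1_def ennreal_mult)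
      also have "\<dots> \<le> ennreal (W powr (1 - r)) * (ennreal (W powr (r - 1)) * (\<integral>\<^sup>+t. ennreal (\<psi> t
          * c t powr r) \<partial>\<nu>))"
        by (intro mult_left_mono J1) simp
      also have "\<dots> = ennreal (W powr (1 - r) * W powr (r - 1)) * (\<integral>\<^sup>+t. ennreal (\<psi> t * c t powr r) \<partial>\<nu>)"
        by (simp add: ennreal_mult mult.assoc)
      also have "W powr (1 - r) * W powr (r - 1) = 1" using W by (simp add: powr_add[symmetric])
      finally have "ennreal i1 \<le> (\<integral>\<^sup>+t. ennreal (\<psi> t * c t powr r) \<partial>\<nu>)" by simp
      \<comment> \<open>Jensen again, now with c^r as weight, whose total mass is at most E.\<close>
      then have "ennreal (i1 powr s) \<le> ennreal (E powr (s - 1)) * (\<integral>\<^sup>+t. ennreal (\<psi> t powr s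
          * c t powr r) \<partial>\<nu>)"
        using s E cE by (intro jensen_powr_nn_integral) (auto simp: \<psi>_def i1_def)
      then have J2: "ennreal (i1 powr s) \<le> ennreal (E powr (s - 1)) * (\<integral>\<^sup>+t. ennreal (\<psi> t powr s
          * c t powr r) \<partial>\<nu>)" .
      have iq: "i z powr q = 3 powr (\<beta> * q) * W powr ((r - 1) * s) * i1 powr s"
      proof -
        have "i1 powr s = W powr ((1 - r) * s) * i0 powr q"
          unfolding i1_def using r1 by (simp add: powr_mult powr_powr s_def)
        moreover have "W powr ((r - 1) * s) * W powr ((1 - r) * s) = 1" using W
            by (simp add: powr_add[symmetric] algebra_simps)
        moreover have "3 powr (\<beta> * q) * i0 powr q = i z powr q"
          unfolding i0_def using i[OF z] by (simp add: powr_divide powr_powr)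
        ultimately show ?thesis by (metis mult.assoc mult.commute mult.left_commute mult_1)
      qed
      have "ennreal (i z powr q) = ennreal (3 powr (\<beta> * q) * W powr ((r - 1) * s)) * ennreal (i1 powr s)"
        unfolding iq by (intro ennreal_mult) auto
      also have "\<dots> \<le> ennreal (3 powr (\<beta> * q) * W powr ((r - 1) * s)) * (ennreal (E powr (s - 1))
          * (\<integral>\<^sup>+t. ennreal (\<psi> t powr s * c t powr r) \<partial>\<nu>))"
        by (intro mult_left_mono J2) simp
      also have "\<dots> = ennreal (3 powr (\<beta> * q) * W powr ((r - 1) * s) * E powr (s - 1))
          * (\<integral>\<^sup>+t. ennreal (\<psi> t powr s * c t powr r) \<partial>\<nu>)"
        by (subst mult.assoc[symmetric], subst ennreal_mult[symmetric]) auto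
      also have "\<dots> = (\<integral>\<^sup>+t. ennreal (3 powr (\<beta> * q) * W powr ((r - 1) * s) * E powr (s - 1))
          * ennreal (\<psi> t powr s * c t powr r) \<partial>\<nu>)"
        by (rule nn_integral_cmult[symmetric]) measurable
      also have "\<dots> = (\<integral>\<^sup>+t. ennreal (M * c t powr r * (1 - t) powr (a * q)) * ennreal (\<rho> powr A2 * (\<rho>
          + (1 - t)) powr (- B2)) \<partial>\<nu>)"
      proof (intro nn_integral_cong)
        fix t assume t: "t \<in> space \<nu>"
        have "W powr ((r - 1) * s) = (w1 * K) powr ((r - 1) * s) * \<rho> powr A2"
          unfolding W_def A2_def by (simp add: powr_mult powr_powr)
        moreover have "\<psi> t powr s = (1 - t) powr (a * q) * (\<rho> + (1 - t)) powr (- B2)"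
          unfolding \<psi>_def B2_def s_def using r1 by (simp add: powr_mult powr_powr add.commute)
        ultimately have "3 powr (\<beta> * q) * W powr ((r - 1) * s) * E powr (s - 1) * (\<psi> t powr s * c t powr r)
           = (M * c t powr r * (1 - t) powr (a * q)) * (\<rho> powr A2 * (\<rho> + (1 - t)) powr (- B2))"
          unfolding M_def by simp
        then show "ennreal (3 powr (\<beta> * q) * W powr ((r - 1) * s) * E powr (s - 1))
            * ennreal (\<psi> t powr s * c t powr r)
          = ennreal (M * c t powr r * (1 - t) powr (a * q)) * ennreal (\<rho> powr A2 * (\<rho> + (1 - t)) powr (- B2))"
          using M by (subst (1 2) ennreal_mult[symmetric]) auto
      qed
      finally show ?thesis unfolding \<rho>_def .
    qed
    have "(\<integral>\<^sup>+z. ennreal (i z powr q) \<partial>wdisc (\<beta> - 2))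
      \<le> (\<integral>\<^sup>+z. \<integral>\<^sup>+t. ennreal (M * c t powr r * (1 - t) powr (a * q)) * ennreal (norm (1 - z) powr A2
          * (norm (1 - z) + (1 - t)) powr (- B2)) \<partial>\<nu> \<partial>wdisc (\<beta> - 2))"
      by (intro nn_integral_mono pt) simp
    also have "\<dots> = (\<integral>\<^sup>+t. \<integral>\<^sup>+z. ennreal (M * c t powr r * (1 - t) powr (a * q))
        * ennreal (norm (1 - z) powr A2 * (norm (1 - z) + (1 - t)) powr (- B2)) \<partial>wdisc (\<beta> - 2) \<partial>\<nu>)"
      using \<beta> by (intro nn_integral_radius_wdisc_Fubini \<nu>) (simp, measurable)
    also have "\<dots> \<le> (\<integral>\<^sup>+t. ennreal (M * w2 * V) * ennreal (c t powr r) \<partial>\<nu>)"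
    proof (intro nn_integral_mono)
      fix t assume t: "t \<in> space \<nu>"
      then have t1: "0 < 1 - t" using sp by simp
      have "(\<integral>\<^sup>+z. ennreal (M * c t powr r * (1 - t) powr (a * q)) * ennreal (norm (1 - z) powr A2
          * (norm (1 - z) + (1 - t)) powr (- B2)) \<partial>wdisc (\<beta> - 2))
        = ennreal (M * c t powr r * (1 - t) powr (a * q)) * (\<integral>\<^sup>+z. ennreal (norm (1 - z) powr A2
            * (norm (1 - z) + (1 - t)) powr (- B2)) \<partial>wdisc (\<beta> - 2))"
        by (rule nn_integral_cmult) measurable
      also have "\<dots> \<le> ennreal (M * c t powr r * (1 - t) powr (a * q)) * ennreal (w2 * V
          * (1 - t) powr (A2 + \<beta> - B2))"
      proof (intro mult_left_mono)
        show "(\<integral>\<^sup>+z. ennreal (norm (1 - z) powr A2 * (norm (1 - z)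
            + (1 - t)) powr (- B2)) \<partial>wdisc (\<beta> - 2)) \<le> ennreal (w2 * V * (1 - t) powr (A2 + \<beta> - B2))"
          unfolding w2_def
        proof (rule powr_weight_kernel)
          show "0 < norm (1 - w)" if "w \<in> space (wdisc (\<beta> - 2))" for w using that by auto
        qed (use AB2 V V' t1 in auto)
      qed simp
      also have "\<dots> = ennreal (M * w2 * V * c t powr r * ((1 - t) powr (a * q) * (1 - t) powr (A2 + \<beta> - B2)))"
        using M w2 V by (subst ennreal_mult[symmetric]) (auto simp: mult_ac)
      \<comment> \<open>All powers of 1 - t cancel by homogeneity, leaving just the integral of
        c^r.\<close>
      also have "(1 - t) powr (a * q) * (1 - t) powr (A2 + \<beta> - B2) = 1"
      proof -
        have "a * q + (A2 + \<beta> - B2) = 0" unfolding A2 B2_def by (simp add: algebra_simps)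
        then show ?thesis using t1 by (simp add: powr_add[symmetric])
      qed
      finally show "(\<integral>\<^sup>+z. ennreal (M * c t powr r * (1 - t) powr (a * q))
          * ennreal (norm (1 - z) powr A2 * (norm (1 - z) + (1 - t)) powr (- B2)) \<partial>wdisc (\<beta> - 2))
         \<le> ennreal (M * w2 * V) * ennreal (c t powr r)"
        using M w2 V by (subst ennreal_mult[symmetric]) auto
    qed
    also have "\<dots> = ennreal (M * w2 * V) * (\<integral>\<^sup>+t. ennreal (c t powr r) \<partial>\<nu>)"
      by (rule nn_integral_cmult) measurable
    also have "\<dots> \<le> ennreal (M * w2 * V) * ennreal E" by (intro mult_left_mono cE) simp
    also have "\<dots> = ennreal (M * w2 * V * E)" using M w2 V E by (intro ennreal_mult[symmetric]) auto
    also have "M * w2 * V * E = C * K powr ((r - 1) * q / r) * E powr (q / r)"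
    proof -
      have "E powr (s - 1) * E = E powr s" using E by (simp add: powr_diff)
      then show ?thesis unfolding M_def C_def s_def using w1 K by (simp add: powr_mult mult_ac)
    qed
    finally show ?thesis .
  qed
  show ?thesis using that[OF C] main by blast
qed

text \<open>For q = 1 Tonelli suffices, integrating over z first. The exponent \<beta> of the kernel
  equals the growth exponent of \<open>wdisc (\<beta> - 2)\<close> at 1, so the inner integral is in
  the critical case and logarithmic.\<close>

lemma kernel_operator_bound_log:
  assumes \<beta>: "1 < \<beta>"
  obtains C where "0 < C" "\<And>\<nu> c i.
     on_radius \<nu> \<Longrightarrow> finite_measure \<nu> \<Longrightarrow>
     c \<in> borel_measurable \<nu> \<Longrightarrow> (\<And>t. 0 \<le> (c t :: real)) \<Longrightarrow>
     (\<And>z. norm z < 1 \<Longrightarrow> 0 \<le> i z \<and> ennreal (i z) \<le> (\<integral>\<^sup>+t. ennreal (c t * norm (1 - of_real t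
         * z) powr (- \<beta>)) \<partial>\<nu>)) \<Longrightarrow>
     (\<integral>\<^sup>+z. ennreal (i z) \<partial>wdisc (\<beta> - 2)) \<le> ennreal C * (\<integral>\<^sup>+t. ennreal (c t * (1 + ln (1 / (1 - t)))) \<partial>\<nu>)"
proof -
  obtain V where V: "0 < V" "\<And>\<rho>. 0 < \<rho> \<Longrightarrow> emeasure (wdisc (\<beta> - 2)) {z \<in> space (wdisc (\<beta> - 2)). norm (1 -
      z) \<le> \<rho>} \<le> ennreal (V * \<rho> powr (\<beta> - 2 + 2))"
    using emeasure_wdisc_near_one[of "\<beta> - 2"] \<beta> by auto
  have V': "emeasure (wdisc (\<beta> - 2)) {z \<in> space (wdisc (\<beta> - 2)). norm (1 - z) \<le> \<rho>}
      \<le> ennreal (V * \<rho> powr \<beta>)" if "0 < \<rho>" for \<rho>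
    using V(2)[OF that] by simp
  define C where "C = 3 powr \<beta> * (4 * 2 powr \<beta> * V)"
  have C: "0 < C" unfolding C_def using V by simp
  have main: "(\<integral>\<^sup>+z. ennreal (i z) \<partial>wdisc (\<beta> - 2))
      \<le> ennreal C * (\<integral>\<^sup>+t. ennreal (c t * (1 + ln (1 / (1 - t)))) \<partial>\<nu>)"
    if \<nu>: "on_radius \<nu>" "finite_measure \<nu>"
      and c[measurable]: "c \<in> borel_measurable \<nu>" and c0: "\<And>t. 0 \<le> (c t :: real)"
      and i: "\<And>z. norm z < 1 \<Longrightarrow> 0 \<le> i z \<and> ennreal (i z)
          \<le> (\<integral>\<^sup>+t. ennreal (c t * norm (1 - of_real t * z) powr (- \<beta>)) \<partial>\<nu>)"
    for \<nu> c i
  proof -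
    have [measurable]: "(\<lambda>t. t) \<in> borel_measurable \<nu>" by (intro measurable_radius \<nu> continuous_intros)
    have sp: "space \<nu> = {0..<1}" by (rule space_radius[OF \<nu>(1)])
    have "(\<integral>\<^sup>+z. ennreal (i z) \<partial>wdisc (\<beta> - 2)) \<le> (\<integral>\<^sup>+z. \<integral>\<^sup>+t. ennreal (3 powr \<beta> * c t)
        * ennreal ((norm (1 - z) + (1 - t)) powr (- \<beta>)) \<partial>\<nu> \<partial>wdisc (\<beta> - 2))"
    proof (intro nn_integral_mono)
      fix z assume "z \<in> space (wdisc (\<beta> - 2))"
      then have z: "norm z < 1" by simp
      have "ennreal (i z) \<le> (\<integral>\<^sup>+t. ennreal (c t * norm (1 - of_real t * z) powr (- \<beta>)) \<partial>\<nu>)"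
          using i[OF z] by blast
      also have "\<dots> \<le> (\<integral>\<^sup>+t. ennreal (3 powr \<beta> * c t) * ennreal ((norm (1 - z) + (1 - t)) powr (- \<beta>)) \<partial>\<nu>)"
      proof (intro nn_integral_mono)
        fix t assume t: "t \<in> space \<nu>"
        have "c t * norm (1 - of_real t * z) powr (- \<beta>)
            \<le> c t * (3 powr \<beta> * ((1 - t) + norm (1 - z)) powr (- \<beta>))"
          using z t sp \<beta> c0 by (intro mult_left_mono kernel_norm_bound) auto
        then show "ennreal (c t * norm (1 - of_real t * z) powr (- \<beta>))
            \<le> ennreal (3 powr \<beta> * c t) * ennreal ((norm (1 - z) + (1 - t)) powr (- \<beta>))"
          using c0[of t] by (subst ennreal_mult[symmetric]) (auto intro!: ennreal_leI simp: mult_ac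
              add.commute)
      qed
      finally show "ennreal (i z) \<le> (\<integral>\<^sup>+t. ennreal (3 powr \<beta> * c t) * ennreal ((norm (1 - z)
          + (1 - t)) powr (- \<beta>)) \<partial>\<nu>)" .
    qed
    also have "\<dots> = (\<integral>\<^sup>+t. \<integral>\<^sup>+z. ennreal (3 powr \<beta> * c t) * ennreal ((norm (1 - z)
        + (1 - t)) powr (- \<beta>)) \<partial>wdisc (\<beta> - 2) \<partial>\<nu>)"
      using \<beta> by (intro nn_integral_radius_wdisc_Fubini \<nu>) (simp, measurable)
    also have "\<dots> \<le> (\<integral>\<^sup>+t. ennreal C * ennreal (c t * (1 + ln (1 / (1 - t)))) \<partial>\<nu>)"
    proof (intro nn_integral_mono)
      fix t assume t: "t \<in> space \<nu>"
      then have t1: "0 < 1 - t" "1 - t \<le> 1" using sp by auto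
      have "(\<integral>\<^sup>+z. ennreal (3 powr \<beta> * c t) * ennreal ((norm (1 - z) + (1 - t)) powr (- \<beta>)) \<partial>wdisc (\<beta> - 2))
        = ennreal (3 powr \<beta> * c t) * (\<integral>\<^sup>+z. ennreal ((norm (1 - z) + (1 - t)) powr (- \<beta>)) \<partial>wdisc (\<beta> - 2))"
        by (rule nn_integral_cmult) measurable
      also have "\<dots> \<le> ennreal (3 powr \<beta> * c t) * ennreal (4 * 2 powr \<beta> * V * (1 + ln (1 / (1 - t))))"
      proof (intro mult_left_mono powr_weight_log)
        show "0 \<le> norm (1 - w) \<and> norm (1 - w) \<le> 2" if "w \<in> space (wdisc (\<beta> - 2))" for w
          using that norm_triangle_ineq4[of 1 w] by auto
      qed (use \<beta> V V' t1 in auto)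
      also have "\<dots> = ennreal (C * (c t * (1 + ln (1 / (1 - t)))))"
        unfolding C_def using c0[of t] by (subst ennreal_mult'[symmetric]) (auto simp: mult_ac)
      finally show "(\<integral>\<^sup>+z. ennreal (3 powr \<beta> * c t) * ennreal ((norm (1 - z)
          + (1 - t)) powr (- \<beta>)) \<partial>wdisc (\<beta> - 2)) \<le> ennreal C * ennreal (c t * (1 + ln (1 / (1 - t))))"
        using C by (subst ennreal_mult'[symmetric]) auto
    qed
    also have "\<dots> = ennreal C * (\<integral>\<^sup>+t. ennreal (c t * (1 + ln (1 / (1 - t)))) \<partial>\<nu>)"
      by (rule nn_integral_cmult) measurable
    finally show ?thesis .
  qed
  show ?thesis using that[OF C] main by blast
qed

section \<open>Sufficient conditions for compactness\<close>

text \<open>Valid for every q \<ge> 0, so it can take the place of the triangle inequality when the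
  exponent is below 1.\<close>

lemma powr_add_le:
  fixes x y :: real
  assumes "0 \<le> x" "0 \<le> y" "0 \<le> q"
  shows "(x + y) powr q \<le> 2 powr q * (x powr q + y powr q)"
proof -
  have "(x + y) powr q \<le> (2 * max x y) powr q" using assms by (intro powr_mono2) auto
  also have "\<dots> = 2 powr q * max x y powr q" using assms by (simp add: powr_mult)
  also have "max x y powr q \<le> x powr q + y powr q" by (auto simp: max_def)
  finally show ?thesis by (simp add: mult_left_mono)
qed

lemma bergman_integral_diff_le:
  assumes "0 \<le> p" "f holomorphic_on ball 0 1" "g holomorphic_on ball 0 1"
  shows "(\<integral>\<^sup>+z. ennreal (norm (f z - g z) powr p) \<partial>wdisc \<alpha>) \<le>
    ennreal (2 powr p) * (bergman_mass p \<alpha> f + bergman_mass p \<alpha> g)"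
proof -
  have m: "f \<in> borel_measurable (wdisc \<alpha>)" "g \<in> borel_measurable (wdisc \<alpha>)"
    using holomorphic_disc_measurable assms by (auto simp: measurable_cong_sets[OF sets_wdisc refl])
  have "(\<integral>\<^sup>+z. ennreal (norm (f z - g z) powr p) \<partial>wdisc \<alpha>)
     \<le> (\<integral>\<^sup>+z. ennreal (2 powr p) * (ennreal (norm (f z) powr p) + ennreal (norm (g z) powr p)) \<partial>wdisc \<alpha>)"
  proof (intro nn_integral_mono)
    fix z
    have "norm (f z - g z) powr p \<le> (norm (f z) + norm (g z)) powr p"
      using assms by (intro powr_mono2 norm_triangle_ineq4) auto
    also have "\<dots> \<le> 2 powr p * (norm (f z) powr p + norm (g z) powr p)"
      using assms by (intro powr_add_le) auto
    finally show "ennreal (norm (f z - g z) powr p)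
        \<le> ennreal (2 powr p) * (ennreal (norm (f z) powr p) + ennreal (norm (g z) powr p))"
      by (simp add: ennreal_plus[symmetric] ennreal_mult'[symmetric] ennreal_leI del: ennreal_plus)
  qed
  also have "\<dots> = ennreal (2 powr p) * (bergman_mass p \<alpha> f + bergman_mass p \<alpha> g)"
    using m by (simp add: nn_integral_cmult nn_integral_add)
  finally show ?thesis .
qed

lemma bergman_space_diff:
  assumes "-1 < \<alpha>" "0 \<le> p" "f \<in> bergman_space p \<alpha>" "g \<in> bergman_space p \<alpha>"
  shows "(\<lambda>z. f z - g z) \<in> bergman_space p \<alpha>"
proof -
  have f: "f holomorphic_on ball 0 1" "bergman_mass p \<alpha> f < \<infinity>"
    and g: "g holomorphic_on ball 0 1" "bergman_mass p \<alpha> g < \<infinity>"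
    using assms by (auto simp: bergman_space_iff)
  have "(\<integral>\<^sup>+z. ennreal (norm (f z - g z) powr p) \<partial>wdisc \<alpha>) < \<infinity>"
    using bergman_integral_diff_le[OF assms(2) f(1) g(1), of \<alpha>] f(2) g(2)
    by (elim le_less_trans) (simp add: ennreal_mult_less_top)
  then show ?thesis using f g assms(1) by (auto simp: bergman_space_iff intro!: holomorphic_intros)
qed

text \<open>Fatou's lemma; it keeps the limit of a bounded sequence in the same Bergman
  ball.\<close>

lemma bergman_integral_limit_le:
  assumes p: "0 < p" and F: "\<And>j. F j holomorphic_on ball 0 1" "\<And>j. bergman_mass p \<alpha> (F j) \<le> N"
    and lim: "\<And>z. z \<in> ball 0 1 \<Longrightarrow> (\<lambda>j. F j z) \<longlonglongrightarrow> g z"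
  shows "bergman_mass p \<alpha> g \<le> N"
proof -
  have m: "F j \<in> borel_measurable (wdisc \<alpha>)" for j
    using holomorphic_disc_measurable[OF F(1)] by (auto simp: measurable_cong_sets[OF sets_wdisc refl])
  have "bergman_mass p \<alpha> g = (\<integral>\<^sup>+z. liminf (\<lambda>j. ennreal (norm (F j z) powr p)) \<partial>wdisc \<alpha>)"
  proof (intro nn_integral_cong)
    fix z assume "z \<in> space (wdisc \<alpha>)"
    then have "(\<lambda>j. F j z) \<longlonglongrightarrow> g z" by (intro lim) simp
    then have l: "(\<lambda>j. norm (F j z)) \<longlonglongrightarrow> norm (g z)" by (rule tendsto_norm)
    have "(\<lambda>j. norm (F j z) powr p) \<longlonglongrightarrow> norm (g z) powr p"
      by (rule tendsto_powr'[OF l tendsto_const]) (use p in auto)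
    then have "(\<lambda>j. ennreal (norm (F j z) powr p)) \<longlonglongrightarrow> ennreal (norm (g z) powr p)" by (rule tendsto_ennrealI)
    then show "ennreal (norm (g z) powr p) = liminf (\<lambda>j. ennreal (norm (F j z) powr p))"
      by (intro lim_imp_Liminf[symmetric]) auto
  qed
  also have "\<dots> \<le> liminf (\<lambda>j. \<integral>\<^sup>+z. ennreal (norm (F j z) powr p) \<partial>wdisc \<alpha>)"
    using m by (intro nn_integral_liminf) simp
  also have "\<dots> \<le> N" using F(2) by (intro Liminf_le) auto
  finally show ?thesis .
qed

text \<open>On \<open>[0, r0)\<close> the kernel is bounded, so only smallness of the operator over the tail \<open>[r0, 1)\<close>,
  uniformly on bounded sets, is at stake.\<close>
lemma hilbert_compact_criterion:
  assumes \<mu>: "on_radius \<mu>" "finite_measure \<mu>"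
    and \<alpha>: "-1 < \<alpha>" and \<beta>: "1 < \<beta>" and p: "0 < p" and q: "0 < q"
    and D: "\<And>f. f \<in> bergman_space p \<alpha> \<Longrightarrow> (\<integral>\<^sup>+t. (\<Sum>k. ennreal (norm (taylor_coeff f k) * t ^ k)) \<partial>\<mu>) < \<infinity>"
    and T: "\<And>N e. 0 < N \<Longrightarrow> 0 < e \<Longrightarrow> \<exists>r0\<in>{0..<1}. \<forall>f i. f holomorphic_on ball 0 1 \<longrightarrow>
       bergman_mass p \<alpha> f \<le> ennreal N \<longrightarrow>
       (\<forall>z. norm z < 1 \<longrightarrow> 0 \<le> i z \<and> ennreal (i z) \<le> (\<integral>\<^sup>+t\<in>{r0..<1}. ennreal (norm (f (of_real t))
           * norm (1 - of_real t * z) powr (- \<beta>)) \<partial>\<mu>)) \<longrightarrow>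
       (\<integral>\<^sup>+z. ennreal (i z powr q) \<partial>wdisc (\<beta> - 2)) \<le> ennreal e"
  shows "hilbert_compact \<mu> \<beta> p \<alpha> q (\<beta> - 2)"
proof -
  interpret M: finite_measure \<mu> by (rule \<mu>)
  interpret W: finite_measure "wdisc (\<beta> - 2)" using \<beta> by (intro finite_wdisc) simp
  have \<beta>2: "-1 < \<beta> - 2" and \<beta>0: "0 < \<beta>" using \<beta> by auto
  have sp: "space \<mu> = {0..<1}" by (rule space_radius[OF \<mu>(1)])
  define m where "m = measure \<mu> (space \<mu>)"
  define v where "v = measure (wdisc (\<beta> - 2)) (ball 0 1)"
  have m: "0 \<le> m" and v: "0 \<le> v" unfolding m_def v_def by auto
  have v_eq: "emeasure (wdisc (\<beta> - 2)) (ball 0 1) = ennreal v" unfolding v_def by (rule W.emeasure_eq_measure)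
  have rep: "hilbert_defined \<mu> \<beta> f" "norm z < 1 \<Longrightarrow> integrable \<mu> (\<lambda>t. f (of_real t) * (1 - of_real t
      * z) powr (- of_real \<beta>))"
      "norm z < 1 \<Longrightarrow> hilbert_op \<mu> \<beta> f z = (\<integral>t. f (of_real t) * (1 - of_real t * z) powr (- of_real \<beta>) \<partial>\<mu>)"
      "hilbert_op \<mu> \<beta> f holomorphic_on ball 0 1"
    if "f \<in> bergman_space p \<alpha>" for f z
  proof -
    have hol: "f holomorphic_on ball 0 1" using that bergman_space_iff[OF \<alpha>] by blast
    note r = hilbert_representation[OF \<mu> \<beta>0 hol D[OF that]]
    show "hilbert_defined \<mu> \<beta> f" "norm z < 1 \<Longrightarrow> integrable \<mu> (\<lambda>t. f (of_real t) * (1 - of_real t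
        * z) powr (- of_real \<beta>))"
      "norm z < 1 \<Longrightarrow> hilbert_op \<mu> \<beta> f z = (\<integral>t. f (of_real t) * (1 - of_real t * z) powr (- of_real \<beta>) \<partial>\<mu>)"
      by (fact r)+
    show "hilbert_op \<mu> \<beta> f holomorphic_on ball 0 1" by (intro hilbert_op_holomorphic r)
  qed
  \<comment> \<open>The radius r0 depends on the mass bound and on e, not on f: the tail costs e,
    the remaining part is controlled by the supremum S of |f| on [0, r0].\<close>
  have key: "\<exists>r0\<in>{0..<1}. \<forall>f S. f \<in> bergman_space p \<alpha> \<longrightarrow> bergman_mass p \<alpha> f \<le> ennreal N \<longrightarrow>
      (\<forall>t\<in>{0..r0}. norm (f (of_real t)) \<le> S) \<longrightarrow>
      bergman_mass q (\<beta> - 2) (hilbert_op \<mu> \<beta> f) \<le> ennreal (2 powr q * ((S * (1 - r0) powr (- \<beta>)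
          * m) powr q * v + e))"
    if N: "0 < N" and e: "0 < e" for N e
  proof -
    obtain r0 where r0: "0 \<le> r0" "r0 < 1" and T': "\<And>f i. f holomorphic_on ball 0 1 \<Longrightarrow>
       bergman_mass p \<alpha> f \<le> ennreal N \<Longrightarrow>
       (\<And>z. norm z < 1 \<Longrightarrow> 0 \<le> i z \<and> ennreal (i z) \<le> (\<integral>\<^sup>+t\<in>{r0..<1}. ennreal (norm (f (of_real t))
           * norm (1 - of_real t * z) powr (- \<beta>)) \<partial>\<mu>)) \<Longrightarrow>
       (\<integral>\<^sup>+z. ennreal (i z powr q) \<partial>wdisc (\<beta> - 2)) \<le> ennreal e"
      using T[OF N e] by auto
    have "bergman_mass q (\<beta> - 2) (hilbert_op \<mu> \<beta> f)
        \<le> ennreal (2 powr q * ((S * (1 - r0) powr (- \<beta>) * m) powr q * v + e))"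
      if f: "f \<in> bergman_space p \<alpha>" "bergman_mass p \<alpha> f \<le> ennreal N"
        and S: "\<And>t. t \<in> {0..r0} \<Longrightarrow> norm (f (of_real t)) \<le> S" for f S
    proof -
      have hol: "f holomorphic_on ball 0 1" using f(1) bergman_space_iff[OF \<alpha>] by blast
      have "norm (f (of_real 0)) \<le> S" using r0 by (intro S) simp
      then have S0: "0 \<le> S" by (rule order_trans[OF norm_ge_zero])
      define c where "c = S * (1 - r0) powr (- \<beta>) * m"
      have c: "0 \<le> c" unfolding c_def using S0 m by simp
      \<comment> \<open>The excess over the contribution of [0, r0). It is real-valued and bounded
        by the tail integral, which itself is only known as an extended real; this is why the tail
        hypothesis speaks of an auxiliary function.\<close>
      define i where "i z = max 0 (norm (hilbert_op \<mu> \<beta> f z) - c)" for z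
      have [measurable]: "hilbert_op \<mu> \<beta> f \<in> borel_measurable (wdisc (\<beta> - 2))"
        using holomorphic_disc_measurable[OF rep(4)[OF f(1)]]
            by (simp add: measurable_cong_sets[OF sets_wdisc refl])
      have "0 \<le> i z \<and> ennreal (i z) \<le> (\<integral>\<^sup>+t\<in>{r0..<1}. ennreal (norm (f (of_real t))
          * norm (1 - of_real t * z) powr (- \<beta>)) \<partial>\<mu>)"
        if z: "norm z < 1" for z
      proof -
        define g where "g t = f (of_real t) * (1 - of_real t * z) powr (- of_real \<beta>)" for t :: real
        have ng: "norm (g t) = norm (f (of_real t)) * norm (1 - of_real t * z) powr (- \<beta>)" for t
          unfolding g_def norm_mult by (subst norm_powr_real_powr') auto
        have gi: "integrable \<mu> g" unfolding g_def using rep(2)[OF f(1) z] .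
        have s1: "{0..<r0} \<in> sets \<mu>" and s2: "{r0..<1} \<in> sets \<mu>"
          unfolding \<mu>(1) using r0 by (auto simp: sets_restrict_space_iff)
        have gi1: "integrable \<mu> (\<lambda>t. indicator {0..<r0} t *\<^sub>R g t)"
            and gi2: "integrable \<mu> (\<lambda>t. indicator {r0..<1} t *\<^sub>R g t)"
          using s1 s2 gi by (auto intro: integrable_mult_indicator)
        have "hilbert_op \<mu> \<beta> f z = (\<integral>t. g t \<partial>\<mu>)" unfolding g_def using rep(3)[OF f(1) z] .
        also have "\<dots> = (\<integral>t. indicator {0..<r0} t *\<^sub>R g t + indicator {r0..<1} t *\<^sub>R g t \<partial>\<mu>)"
          using r0 sp by (intro Bochner_Integration.integral_cong) (auto simp: indicator_def)
        also have "\<dots> = (\<integral>t. indicator {0..<r0} t *\<^sub>R g t \<partial>\<mu>) + (\<integral>t. indicator {r0..<1} t *\<^sub>R g t \<partial>\<mu>)"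
          by (rule Bochner_Integration.integral_add[OF gi1 gi2])
        finally have "norm (hilbert_op \<mu> \<beta> f z) \<le> norm (\<integral>t. indicator {0..<r0} t *\<^sub>R g t \<partial>\<mu>)
            + norm (\<integral>t. indicator {r0..<1} t *\<^sub>R g t \<partial>\<mu>)"
          by (simp add: norm_triangle_ineq)
        moreover have "norm (\<integral>t. indicator {0..<r0} t *\<^sub>R g t \<partial>\<mu>) \<le> c"
        proof -
          have "norm (\<integral>t. indicator {0..<r0} t *\<^sub>R g t \<partial>\<mu>) \<le> (\<integral>t. S * (1 - r0) powr (- \<beta>) \<partial>\<mu>)"
          proof (rule Bochner_Integration.integral_norm_bound_integral[OF gi1])
            fix t assume t: "t \<in> space \<mu>"
            show "norm (indicator {0..<r0} t *\<^sub>R g t) \<le> S * (1 - r0) powr (- \<beta>)"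
            proof (cases "t < r0")
              case True
              have "1 - r0 \<le> norm (1 - of_real t * z)"
                  using kernel_comparison(4)[OF z, of t] t sp True by auto
              then have "norm (1 - of_real t * z) powr (- \<beta>) \<le> (1 - r0) powr (- \<beta>)"
                using r0 \<beta>0 by (intro powr_mono2') auto
              then have "norm (g t) \<le> S * (1 - r0) powr (- \<beta>)"
                unfolding ng using S[of t] t sp True S0 by (intro mult_mono) auto
              then show ?thesis using True t sp by (simp add: indicator_def)
            next
              case False then show ?thesis using S0 by simp
            qed
          qed simp
          also have "\<dots> = c" unfolding c_def m_def by simp
          finally show ?thesis .
        qed
        ultimately have "i z \<le> norm (\<integral>t. indicator {r0..<1} t *\<^sub>R g t \<partial>\<mu>)" unfolding i_def by simp
        then have "ennreal (i z) \<le> ennreal (norm (\<integral>t. indicator {r0..<1} t *\<^sub>R g t \<partial>\<mu>))" by (rule ennreal_leI)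
        also have "\<dots> \<le> (\<integral>\<^sup>+t. ennreal (norm (indicator {r0..<1} t *\<^sub>R g t)) \<partial>\<mu>)"
            by (rule integral_norm_bound_ennreal[OF gi2])
        also have "\<dots> = (\<integral>\<^sup>+t\<in>{r0..<1}. ennreal (norm (f (of_real t)) * norm (1 - of_real t
            * z) powr (- \<beta>)) \<partial>\<mu>)"
          by (intro nn_integral_cong) (auto simp: ng indicator_def)
        finally show ?thesis by (simp add: i_def)
      qed
      then have iq: "(\<integral>\<^sup>+z. ennreal (i z powr q) \<partial>wdisc (\<beta> - 2)) \<le> ennreal e" by (intro T'[OF hol f(2)])
      have "bergman_mass q (\<beta> - 2) (hilbert_op \<mu> \<beta> f)
        \<le> (\<integral>\<^sup>+z. ennreal (2 powr q) * (ennreal (c powr q) + ennreal (i z powr q)) \<partial>wdisc (\<beta> - 2))"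
      proof (intro nn_integral_mono)
        fix z
        have "norm (hilbert_op \<mu> \<beta> f z) powr q \<le> (c + i z) powr q"
          using q by (intro powr_mono2) (auto simp: i_def)
        also have "\<dots> \<le> 2 powr q * (c powr q + i z powr q)"
          using q c by (intro powr_add_le) (auto simp: i_def)
        finally show "ennreal (norm (hilbert_op \<mu> \<beta> f z) powr q)
            \<le> ennreal (2 powr q) * (ennreal (c powr q) + ennreal (i z powr q))"
          by (simp add: ennreal_plus[symmetric] ennreal_mult'[symmetric] ennreal_leI del: ennreal_plus)
      qed
      also have "\<dots> = ennreal (2 powr q) * (ennreal (c powr q)
          * emeasure (wdisc (\<beta> - 2)) (space (wdisc (\<beta> - 2))) + (\<integral>\<^sup>+z. ennreal (i z powr q) \<partial>wdisc (\<beta> - 2)))"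
        unfolding i_def by (simp add: nn_integral_cmult nn_integral_add)
      also have "\<dots> \<le> ennreal (2 powr q) * (ennreal (c powr q) * ennreal v + ennreal e)"
        using v_eq by (intro mult_left_mono add_mono iq) auto
      also have "\<dots> = ennreal (2 powr q * (c powr q * v + e))"
        using v e by (simp add: ennreal_mult'[symmetric] ennreal_plus[symmetric] del: ennreal_plus)
      finally show ?thesis unfolding c_def .
    qed
    then show ?thesis using r0 by (intro bexI[of _ r0]) auto
  qed
  have maps: "hilbert_op \<mu> \<beta> f \<in> bergman_space q (\<beta> - 2)" if f: "f \<in> bergman_space p \<alpha>" for f
  proof -
    have hol: "f holomorphic_on ball 0 1" and fin: "bergman_mass p \<alpha> f < \<infinity>"
      using f bergman_space_iff[OF \<alpha>] by auto
    obtain N where N: "bergman_mass p \<alpha> f \<le> ennreal N" "0 < N"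
    proof -
      obtain n where "0 \<le> n" "bergman_mass p \<alpha> f = ennreal n"
        using fin by (cases "\<integral>\<^sup>+z. ennreal (norm (f z) powr p) \<partial>wdisc \<alpha>") auto
      then show ?thesis using that[of "n + 1"] by (simp add: ennreal_leI)
    qed
    obtain r0 where r0: "r0 \<in> {0..<1}" and k: "\<And>S. (\<forall>t\<in>{0..r0}. norm (f (of_real t)) \<le> S) \<Longrightarrow>
      bergman_mass q (\<beta> - 2) (hilbert_op \<mu> \<beta> f) \<le> ennreal (2 powr q * ((S * (1 - r0) powr (- \<beta>)
          * m) powr q * v + 1))"
      using key[OF N(2) zero_less_one] f N(1) by blast
    have "continuous_on {0..r0} (\<lambda>t::real. norm (f (of_real t)))"
      using r0 by (intro continuous_intros continuous_on_compose2[OF holomorphic_on_imp_continuous_on[OF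
          hol]]) auto
    then obtain S where "\<forall>t\<in>{0..r0}. norm (f (of_real t)) \<le> S"
      using compact_continuous_image[of "{0..r0}"] compact_imp_bounded[of "(\<lambda>t::real. norm (f (of_real
          t))) ` {0..r0}"]
      by (auto simp: bounded_iff)
    from k[OF this] have "bergman_mass q (\<beta> - 2) (hilbert_op \<mu> \<beta> f) < \<infinity>"
      by (elim le_less_trans) simp
    then show ?thesis using rep(4)[OF f] bergman_space_iff[OF \<beta>2] by blast
  qed
  have seq: "\<exists>r g. strict_mono r \<and> g \<in> bergman_space q (\<beta> - 2) \<and>
           (\<lambda>j. bergman_norm q (\<beta> - 2) (\<lambda>z. hilbert_op \<mu> \<beta> (F (r j)) z - g z)) \<longlonglongrightarrow> 0"
    if F: "\<And>j. F j \<in> bergman_space p \<alpha>" "\<And>j. bergman_norm p \<alpha> (F j)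
        \<le> B" for F :: "nat \<Rightarrow> complex \<Rightarrow> complex" and B
  proof -
    define N where "N = pi / (\<alpha> + 1) * B powr p"
    have N: "0 \<le> N" unfolding N_def using \<alpha> by simp
    have hol: "F j holomorphic_on ball 0 1" for j using F(1) bergman_space_iff[OF \<alpha>] by blast
    have FN: "bergman_mass p \<alpha> (F j) \<le> ennreal N" for j
      unfolding N_def by (rule bergman_norm_bound[OF \<alpha> p F])
    obtain C where C: "0 < C" "\<And>f N z. f holomorphic_on ball 0 1 \<Longrightarrow> 0 \<le> N \<Longrightarrow>
     bergman_mass p \<alpha> f \<le> ennreal N \<Longrightarrow> norm z < 1 \<Longrightarrow>
     norm (f z) powr p \<le> C * N * (1 - norm z) powr (- (\<alpha> + 2))"
      using bergman_pointwise_bound[OF p] by blast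
    obtain g r where g: "g holomorphic_on ball 0 1" and r: "strict_mono (r :: nat \<Rightarrow> nat)"
      and lim: "\<And>x. x \<in> ball 0 1 \<Longrightarrow> ((\<lambda>n. F (r n) x) \<longlongrightarrow> g x) sequentially"
      and ulim: "\<And>K. compact K \<Longrightarrow> K \<subseteq> ball 0 1 \<Longrightarrow> uniform_limit K (F \<circ> r) g sequentially"
    proof (rule Montel[of "ball 0 1" "range F" F])
      fix K :: "complex set" assume K: "compact K" "K \<subseteq> ball 0 1"
      show "\<exists>B. \<forall>h\<in>range F. \<forall>z\<in>K. norm (h z) \<le> B"
      proof (cases "K = {}")
        case False
        then obtain z0 where z0: "z0 \<in> K" "\<And>z. z \<in> K \<Longrightarrow> norm z \<le> norm z0"
          using continuous_attains_sup[OF K(1), of norm] by (auto intro: continuous_intros)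
        then have n0: "norm z0 < 1" using K by auto
        \<comment> \<open>The growth bound at the point of K farthest from 0 serves all of K and all
          j.\<close>
        have "norm (F j z) \<le> (C * N * (1 - norm z0) powr (- (\<alpha> + 2))) powr (1 / p)" if "z \<in> K" for j z
        proof -
          have "norm z < 1" using that K by auto
          have "norm (F j z) powr p \<le> C * N * (1 - norm z) powr (- (\<alpha> + 2))"
            by (rule C(2)[OF hol N FN]) fact
          also have "\<dots> \<le> C * N * (1 - norm z0) powr (- (\<alpha> + 2))"
            using C N \<alpha> n0 z0(2)[OF that] by (intro mult_left_mono powr_mono2') auto
          finally have "(norm (F j z) powr p) powr (1 / p)
              \<le> (C * N * (1 - norm z0) powr (- (\<alpha> + 2))) powr (1 / p)"
            using p by (intro powr_mono2) auto
          then show ?thesis using p by (simp add: powr_powr)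
        qed
        then show ?thesis by blast
      qed simp
    qed (use hol in auto)
    have gN: "bergman_mass p \<alpha> g \<le> ennreal N"
      by (rule bergman_integral_limit_le[OF p, of "\<lambda>j. F (r j)"]) (use hol FN lim in auto)
    have gb: "g \<in> bergman_space p \<alpha>" unfolding bergman_space_iff[OF \<alpha>] using g gN
        by (auto elim: le_less_trans)
    \<comment> \<open>After subtracting the limit the functions tend to 0 uniformly on [0, r0] while
      their masses stay bounded.\<close>
    define h where "h j z = F (r j) z - g z" for j z
    have hb: "h j \<in> bergman_space p \<alpha>" for j
      unfolding h_def using \<alpha> p F gb by (intro bergman_space_diff) auto
    \<comment> \<open>The quasi-triangle constant for two masses at most N; the summand 1 secures
      positivity.\<close>
    define N' where "N' = 2 powr p * (N + N) + 1"
    have N': "0 < N'" unfolding N'_def using N by (simp add: add_nonneg_pos)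
    have hN: "bergman_mass p \<alpha> (h j) \<le> ennreal N'" for j
    proof -
      have "bergman_mass p \<alpha> (h j) \<le> ennreal (2 powr p) * (ennreal N + ennreal N)"
        unfolding h_def using p by (intro order_trans[OF bergman_integral_diff_le[OF _ hol g]]
            mult_left_mono add_mono FN gN) auto
      also have "\<dots> = ennreal (2 powr p * (N + N))"
        using N by (simp add: ennreal_plus[symmetric] ennreal_mult'[symmetric] del: ennreal_plus)
      also have "\<dots> \<le> ennreal N'" unfolding N'_def by (intro ennreal_leI) simp
      finally show ?thesis .
    qed
    define X where "X j = bergman_mass q (\<beta> - 2) (hilbert_op \<mu> \<beta> (h j))" for j
    have X0: "X \<longlonglongrightarrow> 0"
    proof (rule order_tendstoI)
      fix a :: ennreal assume "0 < a"
      then obtain b where b: "0 < b" "b < a" using dense by blast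
      then obtain \<epsilon> where \<epsilon>: "0 < \<epsilon>" "b = ennreal \<epsilon>"
        by (cases b) auto
      define e where "e = \<epsilon> / (2 * 2 powr q)"
      have e: "0 < e" unfolding e_def using \<epsilon> by simp
      obtain r0 where r0: "0 \<le> r0" "r0 < 1" and k: "\<And>f S. f \<in> bergman_space p \<alpha> \<Longrightarrow>
          bergman_mass p \<alpha> f \<le> ennreal N' \<Longrightarrow>
          (\<forall>t\<in>{0..r0}. norm (f (of_real t)) \<le> S) \<Longrightarrow>
          bergman_mass q (\<beta> - 2) (hilbert_op \<mu> \<beta> f)
              \<le> ennreal (2 powr q * ((S * (1 - r0) powr (- \<beta>) * m) powr q * v + e))"
        using key[OF N' e] by auto
      define c1 where "c1 = (1 - r0) powr (- \<beta>) * m"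
      have c1: "0 \<le> c1" unfolding c1_def using m by simp
      \<comment> \<open>Makes the inner contribution (\<delta> c1)^q v at most e; the added ones
        guard against v = 0 and c1 = 0.\<close>
      define \<delta> where "\<delta> = (e / (v + 1)) powr (1 / q) / (c1 + 1)"
      have \<delta>: "0 < \<delta>" unfolding \<delta>_def using e v c1 by (intro divide_pos_pos) auto
      have small: "(\<delta> * (1 - r0) powr (- \<beta>) * m) powr q * v \<le> e"
      proof -
        have "\<delta> * (1 - r0) powr (- \<beta>) * m = (e / (v + 1)) powr (1 / q) * (c1 / (c1 + 1))"
          unfolding \<delta>_def c1_def by simp
        also have "\<dots> \<le> (e / (v + 1)) powr (1 / q) * 1"
          using c1 by (intro mult_left_mono) (auto simp: divide_le_eq)
        finally have "(\<delta> * (1 - r0) powr (- \<beta>) * m) powr q \<le> ((e / (v + 1)) powr (1 / q)) powr q"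
          using \<delta> m q by (intro powr_mono2) auto
        also have "\<dots> = e / (v + 1)" using e v q by (simp add: powr_powr)
        finally have "(\<delta> * (1 - r0) powr (- \<beta>) * m) powr q * v \<le> e / (v + 1) * v" using v
            by (rule mult_right_mono)
        also have "\<dots> \<le> e" using e v by (simp add: field_simps)
        finally show ?thesis .
      qed
      have "compact (complex_of_real ` {0..r0})" by (intro compact_continuous_image continuous_intros) auto
      moreover have "complex_of_real ` {0..r0} \<subseteq> ball 0 1" using r0 by auto
      ultimately have "uniform_limit (complex_of_real ` {0..r0}) (F \<circ> r) g sequentially" by (rule ulim)
      from uniform_limitD[OF this \<delta>]
      have "\<forall>\<^sub>F j in sequentially. X j \<le> ennreal \<epsilon>"
      proof eventually_elim
        case (elim j)
        have "\<forall>t\<in>{0..r0}. norm (h j (of_real t)) \<le> \<delta>" using elim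
            by (auto simp: h_def dist_norm intro: less_imp_le)
        from k[OF hb hN this] have "X j \<le> ennreal (2 powr q * ((\<delta> * (1 - r0) powr (- \<beta>) * m) powr q * v + e))"
          unfolding X_def .
        also have "\<dots> \<le> ennreal (2 powr q * (e + e))" using small by (intro ennreal_leI mult_left_mono) auto
        also have "2 powr q * (e + e) = \<epsilon>" unfolding e_def by simp
        finally show ?case .
      qed
      then show "\<forall>\<^sub>F j in sequentially. X j < a"
        using b \<epsilon> by (auto elim!: eventually_mono)
    qed auto
    define u where "u j z = hilbert_op \<mu> \<beta> (F (r j)) z - hilbert_op \<mu> \<beta> g z" for j z
    have ub: "u j \<in> bergman_space q (\<beta> - 2)" for j
      unfolding u_def using \<beta>2 q by (intro bergman_space_diff maps F gb) auto
    \<comment> \<open>Linearity of the operator, obtained from the integral formula.\<close>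
    have uh: "u j z = hilbert_op \<mu> \<beta> (h j) z" if "norm z < 1" for j z
      unfolding u_def rep(3)[OF F(1) that] rep(3)[OF gb that] rep(3)[OF hb that] h_def left_diff_distrib
      by (rule Bochner_Integration.integral_diff[symmetric, OF rep(2)[OF F(1) that] rep(2)[OF gb that]])
    have "(\<lambda>j. \<integral>\<^sup>+z. ennreal (norm (u j z) powr q) \<partial>wdisc (\<beta> - 2)) = X"
      unfolding X_def by (intro ext nn_integral_cong) (simp add: uh)
    then have "(\<lambda>j. bergman_norm q (\<beta> - 2) (u j)) \<longlonglongrightarrow> 0"
      using X0 bergman_norm_tendsto_zero_iff[OF \<beta>2 q ub] by simp
    then show ?thesis using r maps[OF gb] unfolding u_def by blast
  qed
  show ?thesis
    unfolding hilbert_compact_def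
  proof (intro conjI allI impI ballI)
    fix F :: "nat \<Rightarrow> complex \<Rightarrow> complex" and B
    assume "\<forall>j. F j \<in> bergman_space p \<alpha> \<and> bergman_norm p \<alpha> (F j) \<le> B"
    then show "\<exists>r g. strict_mono r \<and> g \<in> bergman_space q (\<beta> - 2) \<and>
           (\<lambda>j. bergman_norm q (\<beta> - 2) (\<lambda>z. hilbert_op \<mu> \<beta> (F (r j)) z - g z)) \<longlonglongrightarrow> 0"
      by (intro seq[of F B]) blast+
  qed (use rep(1) maps in auto)
qed

section \<open>Restriction of the measure to a tail of the radius\<close>

lemma emeasure_restricted_tail:
  assumes \<mu>: "on_radius \<mu>" and A: "A \<in> sets \<mu>" and r0: "0 \<le> r0"
  shows "emeasure (density \<mu> (indicator {r0..<1})) A = emeasure \<mu> ({r0..<1} \<inter> A)"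
proof -
  have s: "{r0..<1} \<in> sets \<mu>" unfolding \<mu> using r0 by (auto simp: sets_restrict_space_iff)
  then have "emeasure (density \<mu> (indicator {r0..<1})) A = (\<integral>\<^sup>+t. indicator {r0..<1} t * indicator A t \<partial>\<mu>)"
    using A by (intro emeasure_density) auto
  also have "\<dots> = (\<integral>\<^sup>+t. indicator ({r0..<1} \<inter> A) t \<partial>\<mu>)" by (simp add: indicator_inter_arith)
  also have "\<dots> = emeasure \<mu> ({r0..<1} \<inter> A)" using s A by (intro nn_integral_indicator) auto
  finally show ?thesis .
qed

lemma finite_restricted_tail:
  assumes \<mu>: "on_radius \<mu>" "finite_measure \<mu>" and r0: "0 \<le> r0"
  shows "finite_measure (density \<mu> (indicator {r0..<1}))"
proof
  have "emeasure (density \<mu> (indicator {r0..<1})) (space \<mu>) = emeasure \<mu> ({r0..<1} \<inter> space \<mu>)"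
    by (intro emeasure_restricted_tail \<mu> r0) auto
  then show "emeasure (density \<mu> (indicator {r0..<1})) (space (density \<mu> (indicator {r0..<1}))) \<noteq> \<infinity>"
    using finite_measure.emeasure_finite[OF \<mu>(2)] by simp
qed

lemma nn_integral_restricted_tail:
  assumes \<mu>: "on_radius \<mu>" and r0: "0 \<le> r0" and F: "F \<in> borel_measurable \<mu>"
  shows "(\<integral>\<^sup>+t. F t \<partial>density \<mu> (indicator {r0..<1})) = (\<integral>\<^sup>+t\<in>{r0..<1}. F t \<partial>\<mu>)"
proof -
  have s: "{r0..<1} \<in> sets \<mu>" unfolding \<mu> using r0 by (auto simp: sets_restrict_space_iff)
  then show ?thesis using F by (subst nn_integral_density) (auto simp: mult.commute)
qed

lemma tail_growth:
  assumes \<mu>: "on_radius \<mu>" and r0: "0 \<le> r0" "r0 < 1" and d: "0 < d"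
  shows "emeasure (density \<mu> (indicator {r0..<1})) {t \<in> space (density \<mu> (indicator {r0..<1})). 1 - t \<le> d}
    = emeasure \<mu> {1 - min d (1 - r0)..<1}"
proof -
  have [measurable]: "(\<lambda>t. t) \<in> borel_measurable \<mu>" by (intro measurable_radius \<mu> continuous_intros)
  have "{t \<in> space \<mu>. 1 - t \<le> d} \<in> sets \<mu>" by measurable
  moreover have "{r0..<1} \<inter> {t \<in> space \<mu>. 1 - t \<le> d} = {1 - min d (1 - r0)..<1}"
    unfolding space_radius[OF \<mu>] using r0 d by auto
  ultimately show ?thesis using emeasure_restricted_tail[OF \<mu> _ r0(1)] by simp
qed

text \<open>Below scale 1 - r0 the vanishing condition gives the constant \<epsilon>; at larger
  scales the restricted measure gains no more mass while the bound keeps growing. Since only scales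
  at most 1 occur in the condition, a single r0 serves all exponents up to \<open>s\<close>.\<close>

lemma vanishing_tail_growth:
  assumes \<mu>: "on_radius \<mu>" and van: "vanishing_carleson \<mu> s" and \<epsilon>: "0 < \<epsilon>"
  obtains r0 where "0 \<le> r0" "r0 < 1"
    "\<And>\<sigma> d. 0 \<le> \<sigma> \<Longrightarrow> \<sigma> \<le> s \<Longrightarrow> 0 < d \<Longrightarrow> emeasure (density \<mu> (indicator {r0..<1})) {t \<in> space (density \<mu>
        (indicator {r0..<1})). 1 - t \<le> d} \<le> ennreal (\<epsilon> * d powr \<sigma>)"
proof -
  obtain \<delta> where \<delta>: "0 < \<delta>" "\<And>t. 1 - \<delta> < t \<Longrightarrow> t < 1 \<Longrightarrow> emeasure \<mu> {t..<1} \<le> ennreal (\<epsilon> * (1 - t) powr s)"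
    using van \<epsilon> unfolding vanishing_carleson_def by blast
  \<comment> \<open>\<delta>/2 rather than \<delta>, as the condition holds strictly beyond 1 -
    \<delta>.\<close>
  define r0 where "r0 = max 0 (1 - \<delta> / 2)"
  have r0: "0 \<le> r0" "r0 < 1" "1 - \<delta> < r0" unfolding r0_def using \<delta> by auto
  have "emeasure (density \<mu> (indicator {r0..<1})) {t \<in> space (density \<mu> (indicator {r0..<1})). 1 - t
      \<le> d} \<le> ennreal (\<epsilon> * d powr \<sigma>)"
    if \<sigma>: "0 \<le> \<sigma>" "\<sigma> \<le> s" and d: "0 < d" for \<sigma> d
  proof -
    define y where "y = min d (1 - r0)"
    have y: "0 < y" "y \<le> d" "y \<le> 1" "y < \<delta>" unfolding y_def using d r0 by auto
    have "emeasure \<mu> {1 - y..<1} \<le> ennreal (\<epsilon> * y powr s)" using \<delta>(2)[of "1 - y"] y by simp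
    also have "\<dots> \<le> ennreal (\<epsilon> * d powr \<sigma>)"
    proof (intro ennreal_leI mult_left_mono)
      have "y powr s \<le> y powr \<sigma>" using y \<sigma> by (intro powr_mono') auto
      also have "\<dots> \<le> d powr \<sigma>" using y \<sigma> by (intro powr_mono2) auto
      finally show "y powr s \<le> d powr \<sigma>" .
    qed (use \<epsilon> in simp)
    finally show ?thesis unfolding tail_growth[OF \<mu> r0(1,2) d] y_def .
  qed
  then show ?thesis using that r0 by blast
qed

lemma vanishing_imp_carleson:
  assumes \<mu>: "on_radius \<mu>" "finite_measure \<mu>" and van: "vanishing_carleson \<mu> s" and s: "0 \<le> s"
  shows "carleson \<mu> s"
proof -
  interpret M: finite_measure \<mu> by (rule \<mu>)
  obtain \<delta> where \<delta>: "0 < \<delta>" "\<And>t. 1 - \<delta> < t \<Longrightarrow> t < 1 \<Longrightarrow> emeasure \<mu> {t..<1} \<le> ennreal (1 * (1 - t) powr s)"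
    using van unfolding vanishing_carleson_def by (meson zero_less_one)
  define m where "m = measure \<mu> (space \<mu>)"
  \<comment> \<open>Away from 1, where 1 - t \<ge> \<delta>, the total mass m is bounded by this
    multiple of (1 - t)^s.\<close>
  define C where "C = max 1 (m / \<delta> powr s)"
  have "emeasure \<mu> {t..<1} \<le> ennreal (C * (1 - t) powr s)" if t: "t \<in> {0..<1}" for t
  proof (cases "1 - \<delta> < t")
    case True
    then have "emeasure \<mu> {t..<1} \<le> ennreal (1 * (1 - t) powr s)" using \<delta> t by auto
    also have "\<dots> \<le> ennreal (C * (1 - t) powr s)" unfolding C_def by (intro ennreal_leI mult_right_mono) auto
    finally show ?thesis .
  next
    case False
    have "emeasure \<mu> {t..<1} \<le> ennreal m"
      unfolding m_def by (metis M.emeasure_eq_measure emeasure_space)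
    also have "\<dots> \<le> ennreal (C * (1 - t) powr s)"
    proof (rule ennreal_leI)
      have "m = m / \<delta> powr s * \<delta> powr s" using \<delta> by simp
      also have "\<dots> \<le> C * (1 - t) powr s"
        unfolding C_def using False \<delta> s by (intro mult_mono powr_mono2) auto
      finally show "m \<le> C * (1 - t) powr s" .
    qed
    finally show ?thesis .
  qed
  then show ?thesis unfolding carleson_def by blast
qed

lemma radius_norm_measurable:
  assumes "on_radius \<nu>" "f holomorphic_on ball 0 1"
  shows "(\<lambda>t. norm (f (of_real t))) \<in> borel_measurable \<nu>"
  by (intro measurable_radius[OF assms(1)] continuous_intros
      continuous_on_compose2[OF holomorphic_on_imp_continuous_on[OF assms(2)]]) auto

theorem vanishing_carleson_imp_compact:
  assumes p: "0 < p" and \<alpha>: "-1 < \<alpha>" and \<beta>: "1 < \<beta>"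
    and \<mu>: "on_radius \<mu>" "finite_measure \<mu>"
    and q: "p \<le> q" "1 < q"
    and van: "vanishing_carleson \<mu> (max (\<alpha> + 2) \<beta> * (1 / p + (1 - 1 / q)))"
  shows "hilbert_compact \<mu> \<beta> p \<alpha> q (\<beta> - 2)"
proof (rule hilbert_compact_criterion[OF \<mu> \<alpha> \<beta> p])
  define k where "k = 1 - 1 / q"
  have k: "0 < k" "1 - 1 / p \<le> k" unfolding k_def using q p by (auto simp: frac_le)
  define m where "m = max (\<alpha> + 2) \<beta>"
  have m: "\<alpha> + 2 \<le> m" "\<beta> \<le> m" "1 < m" unfolding m_def using \<beta> by auto
  define s where "s = m * (1 / p + k)"
  have van': "vanishing_carleson \<mu> s" using van unfolding s_def m_def k_def .
  have pk: "0 < 1 / p + k" using p k by (simp add: add_pos_pos)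
  have s0: "0 \<le> s" unfolding s_def using m pk by simp
  have car: "carleson \<mu> s" by (rule vanishing_imp_carleson[OF \<mu> van' s0])
  \<comment> \<open>For p > 1 the terms m/p \<ge> (\<alpha>+2)/p and mk > k \<ge> 1 - 1/p add up to
    more than 1 + (\<alpha>+1)/p; the strictness comes from m > 1.\<close>
  have scond: "(p \<le> 1 \<and> (\<alpha> + 2) / p \<le> s) \<or> (1 < p \<and> 1 + (\<alpha> + 1) / p < s)"
  proof (cases "p \<le> 1")
    case True
    have "(\<alpha> + 2) / p = (\<alpha> + 2) * (1 / p)" by simp
    also have "\<dots> \<le> m * (1 / p + k)" using m p k \<alpha> by (intro mult_mono) auto
    finally show ?thesis using True by (simp add: s_def)
  next
    case False
    have "(\<alpha> + 1) / p + 1 / p = (\<alpha> + 2) * (1 / p)" by (simp add: add_divide_distrib[symmetric])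
    also have "\<dots> \<le> m * (1 / p)" using m p by (intro mult_right_mono) auto
    finally have "(\<alpha> + 1) / p + 1 / p \<le> m * (1 / p)" .
    moreover have "1 * k < m * k" using m k by (intro mult_strict_right_mono) auto
    ultimately have "1 + (\<alpha> + 1) / p < s" unfolding s_def distrib_left using k by linarith
    then show ?thesis using False by simp
  qed
  show "0 < q" using q by simp
  show "(\<integral>\<^sup>+t. (\<Sum>k. ennreal (norm (taylor_coeff f k) * t ^ k)) \<partial>\<mu>) < \<infinity>" if f: "f \<in> bergman_space p \<alpha>" for f
    using f bergman_space_iff[OF \<alpha>]
    by (intro radial_coeff_sum_finite[OF \<mu>(1) car s0] bergman_weighted_l1_finite[OF \<alpha> p f scond]) auto
  define r where "r = 1 + p * (1 - 1 / q)"
  have r_p: "r / p = 1 / p + k" unfolding r_def k_def using p by (simp add: field_simps)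
  have r1: "1 < r" unfolding r_def k_def[symmetric] using p k by simp
  \<comment> \<open>Equivalent to 1/p + 1/q' \<ge> 1, hence to p \<le> q.\<close>
  have pr: "p \<le> r"
  proof -
    have "1 \<le> r / p" unfolding r_p using k by simp
    then show ?thesis using p by simp
  qed
  define \<sigma>1 where "\<sigma>1 = (\<alpha> + 2) * r / p"
  define \<sigma>2 where "\<sigma>2 = \<beta> * (1 / p + (1 - 1 / q))"
  have \<sigma>1: "0 \<le> \<sigma>1" "\<sigma>1 \<le> s"
  proof -
    have e: "\<sigma>1 = (\<alpha> + 2) * (1 / p + k)" unfolding \<sigma>1_def r_p[symmetric] by simp
    show "0 \<le> \<sigma>1" unfolding e using \<alpha> pk by simp
    show "\<sigma>1 \<le> s" unfolding e s_def using m pk by (intro mult_right_mono) auto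
  qed
  have \<sigma>2: "0 \<le> \<sigma>2" "\<sigma>2 \<le> s"
    unfolding \<sigma>2_def s_def k_def[symmetric] using \<beta> m pk by (auto intro: mult_right_mono)
  fix N e :: real assume N: "0 < N" and e: "0 < e"
  obtain C1 where C1: "0 < C1" "\<And>\<nu> h K f N.
     on_radius \<nu> \<Longrightarrow> finite_measure \<nu> \<Longrightarrow>
     h \<in> borel_measurable \<nu> \<Longrightarrow> (\<And>t. 0 \<le> (h t :: real)) \<Longrightarrow> 0 \<le> K \<Longrightarrow>
     (\<And>x. 0 < x \<Longrightarrow> x \<le> 1 \<Longrightarrow> (\<integral>\<^sup>+t. ennreal (h t) * indicator {t. x / 2 \<le> 1 - t \<and> 1 - t \<le> 4 * x} t \<partial>\<nu>)
         \<le> ennreal (K * x powr ((\<alpha> + 2) * r / p))) \<Longrightarrow>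
     f holomorphic_on ball 0 1 \<Longrightarrow> 0 \<le> N \<Longrightarrow> bergman_mass p \<alpha> f \<le> ennreal N \<Longrightarrow>
     (\<integral>\<^sup>+t. ennreal (norm (f (of_real t)) powr r * h t) \<partial>\<nu>) \<le> ennreal (C1 * K * N powr (r / p))"
    using carleson_embedding[OF p pr \<alpha>] by blast
  obtain C2 where C2: "0 < C2" "\<And>\<nu> K E c i.
     on_radius \<nu> \<Longrightarrow> finite_measure \<nu> \<Longrightarrow> 0 < K \<Longrightarrow> 0 < E \<Longrightarrow>
     (\<And>d. 0 < d \<Longrightarrow> emeasure \<nu> {t \<in> space \<nu>. 1 - t \<le> d} \<le> ennreal (K * d powr \<sigma>2)) \<Longrightarrow>
     c \<in> borel_measurable \<nu> \<Longrightarrow> (\<And>t. 0 \<le> (c t :: real)) \<Longrightarrow> (\<integral>\<^sup>+t. ennreal (c t powr r) \<partial>\<nu>) \<le> ennreal E \<Longrightarrow>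
     (\<And>z. norm z < 1 \<Longrightarrow> 0 \<le> i z \<and> ennreal (i z) \<le> (\<integral>\<^sup>+t. ennreal (c t * norm (1 - of_real t
         * z) powr (- \<beta>)) \<partial>\<nu>)) \<Longrightarrow>
     (\<integral>\<^sup>+z. ennreal (i z powr q) \<partial>wdisc (\<beta> - 2)) \<le> ennreal (C2 * K powr ((r - 1) * q / r) * E powr (q / r))"
    using kernel_operator_bound[OF \<beta> q(2) p q(1)] unfolding r_def \<sigma>2_def by blast
  define D where "D = C1 * 4 powr \<sigma>1 * N powr (r / p)"
  have D: "0 < D" unfolding D_def using C1 N by simp
  define C3 where "C3 = C2 * D powr (q / r)"
  have C3: "0 < C3" unfolding C3_def using C2 D by simp
  \<comment> \<open>\<epsilon> enters as growth constant with the power (r-1)q/r and through the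
    embedding with the power q/r, so with total power q.\<close>
  define \<epsilon> where "\<epsilon> = (e / C3) powr (1 / q)"
  have \<epsilon>: "0 < \<epsilon>" unfolding \<epsilon>_def using e C3 by simp
  obtain r0 where r0: "0 \<le> r0" "r0 < 1" and gr:
    "\<And>\<sigma> d. 0 \<le> \<sigma> \<Longrightarrow> \<sigma> \<le> s \<Longrightarrow> 0 < d \<Longrightarrow> emeasure (density \<mu> (indicator {r0..<1})) {t \<in> space (density \<mu>
        (indicator {r0..<1})). 1 - t \<le> d} \<le> ennreal (\<epsilon> * d powr \<sigma>)"
    using vanishing_tail_growth[OF \<mu>(1) van' \<epsilon>] by blast
  define \<nu> where "\<nu> = density \<mu> (indicator {r0..<1} :: real \<Rightarrow> ennreal)"
  have \<nu>: "on_radius \<nu>" "finite_measure \<nu>"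
    unfolding \<nu>_def using \<mu> finite_restricted_tail[OF \<mu> r0(1)] by auto
  have meas [measurable]: "(\<lambda>t. t) \<in> borel_measurable \<nu>" "(\<lambda>t. t) \<in> borel_measurable \<mu>"
    by (intro measurable_radius \<nu> \<mu> continuous_intros)+
  have "(\<integral>\<^sup>+z. ennreal (i z powr q) \<partial>wdisc (\<beta> - 2)) \<le> ennreal e"
    if hol: "f holomorphic_on ball 0 1" and fN: "bergman_mass p \<alpha> f \<le> ennreal N"
      and i: "\<And>z. norm z < 1 \<Longrightarrow> 0 \<le> i z \<and> ennreal (i z)
          \<le> (\<integral>\<^sup>+t\<in>{r0..<1}. ennreal (norm (f (of_real t)) * norm (1 - of_real t * z) powr (- \<beta>)) \<partial>\<mu>)"
    for f i
  proof -
    have [measurable]: "(\<lambda>t. norm (f (of_real t))) \<in> borel_measurable \<nu>" "(\<lambda>t. norm (f (of_real t))) \<in>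
        borel_measurable \<mu>"
      by (intro radius_norm_measurable \<nu> \<mu> hol)+
    have E: "(\<integral>\<^sup>+t. ennreal (norm (f (of_real t)) powr r * 1) \<partial>\<nu>)
        \<le> ennreal (C1 * (\<epsilon> * 4 powr \<sigma>1) * N powr (r / p))"
    proof (rule C1(2)[OF \<nu>])
      fix x :: real assume x: "0 < x" "x \<le> 1"
      have "(\<integral>\<^sup>+t. ennreal 1 * indicator {t. x / 2 \<le> 1 - t \<and> 1 - t \<le> 4 * x} t \<partial>\<nu>)
          \<le> (\<integral>\<^sup>+t. indicator {t \<in> space \<nu>. 1 - t \<le> 4 * x} t \<partial>\<nu>)"
        by (intro nn_integral_mono) (auto simp: indicator_def)
      also have "\<dots> = emeasure \<nu> {t \<in> space \<nu>. 1 - t \<le> 4 * x}" by (rule nn_integral_indicator) measurable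
      also have "\<dots> \<le> ennreal (\<epsilon> * (4 * x) powr \<sigma>1)" unfolding \<nu>_def using x by (intro gr \<sigma>1) auto
      also have "\<epsilon> * (4 * x) powr \<sigma>1 = \<epsilon> * 4 powr \<sigma>1 * x powr \<sigma>1" using x by (simp add: powr_mult)
      finally show "(\<integral>\<^sup>+t. ennreal 1 * indicator {t. x / 2 \<le> 1 - t \<and> 1 - t \<le> 4 * x} t \<partial>\<nu>)
          \<le> ennreal (\<epsilon> * 4 powr \<sigma>1 * x powr ((\<alpha> + 2) * r / p))"
        unfolding \<sigma>1_def .
    qed (use hol fN N \<epsilon> in auto)
    have ED: "C1 * (\<epsilon> * 4 powr \<sigma>1) * N powr (r / p) = \<epsilon> * D" unfolding D_def by simp
    have "(\<integral>\<^sup>+z. ennreal (i z powr q) \<partial>wdisc (\<beta> - 2))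
        \<le> ennreal (C2 * \<epsilon> powr ((r - 1) * q / r) * (\<epsilon> * D) powr (q / r))"
    proof (rule C2(2)[OF \<nu> \<epsilon>, where c = "\<lambda>t. norm (f (of_real t))"])
      show "0 < \<epsilon> * D" using \<epsilon> D by simp
      show "emeasure \<nu> {t \<in> space \<nu>. 1 - t \<le> d} \<le> ennreal (\<epsilon> * d powr \<sigma>2)" if "0 < d" for d
        unfolding \<nu>_def using that by (intro gr \<sigma>2)
      show "(\<integral>\<^sup>+t. ennreal (norm (f (of_real t)) powr r) \<partial>\<nu>) \<le> ennreal (\<epsilon> * D)" using E unfolding ED by simp
      show "0 \<le> i z \<and> ennreal (i z) \<le> (\<integral>\<^sup>+t. ennreal (norm (f (of_real t)) * norm (1 - of_real t
          * z) powr (- \<beta>)) \<partial>\<nu>)" if z: "norm z < 1" for z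
        unfolding \<nu>_def using i[OF z] by (subst nn_integral_restricted_tail[OF \<mu>(1) r0(1)]) auto
    qed auto
    also have "C2 * \<epsilon> powr ((r - 1) * q / r) * (\<epsilon> * D) powr (q / r)
        = C3 * (\<epsilon> powr ((r - 1) * q / r) * \<epsilon> powr (q / r))"
      unfolding C3_def using \<epsilon> D by (simp add: powr_mult)
    also have "\<epsilon> powr ((r - 1) * q / r) * \<epsilon> powr (q / r) = \<epsilon> powr q"
    proof -
      have "(r - 1) * q / r + q / r = q" using r1 by (simp add: field_simps)
      then show ?thesis by (simp add: powr_add[symmetric])
    qed
    also have "\<epsilon> powr q = e / C3" unfolding \<epsilon>_def using e C3 q by (simp add: powr_powr)
    finally show ?thesis using C3 by simp
  qed
  then show "\<exists>r0\<in>{0..<1}. \<forall>f i. f holomorphic_on ball 0 1 \<longrightarrow>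
       bergman_mass p \<alpha> f \<le> ennreal N \<longrightarrow>
       (\<forall>z. norm z < 1 \<longrightarrow> 0 \<le> i z \<and> ennreal (i z) \<le> (\<integral>\<^sup>+t\<in>{r0..<1}. ennreal (norm (f (of_real t))
           * norm (1 - of_real t * z) powr (- \<beta>)) \<partial>\<mu>)) \<longrightarrow>
       (\<integral>\<^sup>+z. ennreal (i z powr q) \<partial>wdisc (\<beta> - 2)) \<le> ennreal e"
    using r0 by (intro bexI[of _ r0]) auto
qed

text \<open>The embedding is used with r = 1, which p \<le> 1 permits, and with the density 1 +
  log(1/(1-t)) produced by the logarithmic kernel bound; the logarithmic condition verifies its
  shell hypothesis with a small constant.\<close>

theorem vanishing_log_carleson_imp_compact:
  assumes p: "0 < p" "p \<le> 1" and \<alpha>: "-1 < \<alpha>" and \<beta>: "1 < \<beta>"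
    and \<mu>: "on_radius \<mu>"
    and car: "carleson \<mu> ((\<alpha> + 2) / p)"
    and van: "vanishing_log_carleson \<mu> 1 ((\<alpha> + 2) / p)"
  shows "hilbert_compact \<mu> \<beta> p \<alpha> 1 (\<beta> - 2)"
proof -
  have fm: "finite_measure \<mu>" by (rule carleson_finite_measure[OF \<mu> car])
  define s where "s = (\<alpha> + 2) / p"
  have s: "0 < s" unfolding s_def using \<alpha> p by simp
  show ?thesis
  proof (rule hilbert_compact_criterion[OF \<mu> fm \<alpha> \<beta> p(1)])
    show "(\<integral>\<^sup>+t. (\<Sum>k. ennreal (norm (taylor_coeff f k) * t ^ k)) \<partial>\<mu>) < \<infinity>" if f: "f \<in> bergman_space p \<alpha>" for f
      using f bergman_space_iff[OF \<alpha>] s p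
      by (intro radial_coeff_sum_finite[OF \<mu> car] bergman_weighted_l1_finite[OF \<alpha> p(1) f]) (auto simp: s_def)
    fix N e :: real assume N: "0 < N" and e: "0 < e"
    obtain C1 where C1: "0 < C1" "\<And>\<nu> h K f N.
       on_radius \<nu> \<Longrightarrow> finite_measure \<nu> \<Longrightarrow>
       h \<in> borel_measurable \<nu> \<Longrightarrow> (\<And>t. 0 \<le> (h t :: real)) \<Longrightarrow> 0 \<le> K \<Longrightarrow>
       (\<And>x. 0 < x \<Longrightarrow> x \<le> 1 \<Longrightarrow> (\<integral>\<^sup>+t. ennreal (h t) * indicator {t. x / 2 \<le> 1 - t \<and> 1 - t \<le> 4 * x} t \<partial>\<nu>)
           \<le> ennreal (K * x powr ((\<alpha> + 2) * 1 / p))) \<Longrightarrow>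
       f holomorphic_on ball 0 1 \<Longrightarrow> 0 \<le> N \<Longrightarrow> bergman_mass p \<alpha> f \<le> ennreal N \<Longrightarrow>
       (\<integral>\<^sup>+t. ennreal (norm (f (of_real t)) powr 1 * h t) \<partial>\<nu>) \<le> ennreal (C1 * K * N powr (1 / p))"
      using carleson_embedding[OF p \<alpha>] by blast
    obtain C2 where C2: "0 < C2" "\<And>\<nu> c i.
       on_radius \<nu> \<Longrightarrow> finite_measure \<nu> \<Longrightarrow>
       c \<in> borel_measurable \<nu> \<Longrightarrow> (\<And>t. 0 \<le> (c t :: real)) \<Longrightarrow>
       (\<And>z. norm z < 1 \<Longrightarrow> 0 \<le> i z \<and> ennreal (i z) \<le> (\<integral>\<^sup>+t. ennreal (c t * norm (1 - of_real t
           * z) powr (- \<beta>)) \<partial>\<nu>)) \<Longrightarrow>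
       (\<integral>\<^sup>+z. ennreal (i z) \<partial>wdisc (\<beta> - 2)) \<le> ennreal C2 * (\<integral>\<^sup>+t. ennreal (c t * (1 + ln (1 / (1 - t)))) \<partial>\<nu>)"
      using kernel_operator_bound_log[OF \<beta>] by blast
    define D where "D = C2 * (C1 * (5 * 4 powr s) * N powr (1 / p))"
    have D: "0 < D" unfolding D_def using C1 C2 N by simp
    define \<epsilon> where "\<epsilon> = e / D"
    have \<epsilon>: "0 < \<epsilon>" unfolding \<epsilon>_def using e D by simp
    obtain \<delta> where \<delta>: "0 < \<delta>" "\<And>t. 1 - \<delta> < t \<Longrightarrow> t < 1 \<Longrightarrow>
        emeasure \<mu> {t..<1} * ennreal (ln (1 / (1 - t)) powr 1) \<le> ennreal (\<epsilon> * (1 - t) powr s)"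
      using van \<epsilon> unfolding vanishing_log_carleson_def s_def by blast
    \<comment> \<open>Beyond 1 - 1/e the logarithm is at least 1, so it also pays for additive
      constants.\<close>
    define r0 where "r0 = max (1 - \<delta> / 2) (1 - exp (- 1))"
    have r0: "0 \<le> r0" "r0 < 1" "1 - \<delta> < r0" "1 - r0 \<le> exp (- 1)" unfolding r0_def using \<delta>
      by (auto simp: le_max_iff_disj)
    define \<nu> where "\<nu> = density \<mu> (indicator {r0..<1} :: real \<Rightarrow> ennreal)"
    have \<nu>: "on_radius \<nu>" "finite_measure \<nu>"
      unfolding \<nu>_def using \<mu> finite_restricted_tail[OF \<mu> fm r0(1)] by auto
    have sp: "space \<nu> = {0..<1}" by (rule space_radius[OF \<nu>(1)])
    have meas [measurable]: "(\<lambda>t. t) \<in> borel_measurable \<nu>" "(\<lambda>t. t) \<in> borel_measurable \<mu>"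
      by (intro measurable_radius \<nu> \<mu> continuous_intros)+
    define h where "h t = max 0 (1 + ln (1 / (1 - t)))" for t :: real
    have [measurable]: "h \<in> borel_measurable \<nu>" unfolding h_def by measurable
    have carl: "(\<integral>\<^sup>+t. ennreal (h t) * indicator {t. x / 2 \<le> 1 - t \<and> 1 - t \<le> 4 * x} t \<partial>\<nu>)
        \<le> ennreal ((5 * \<epsilon> * 4 powr s) * x powr ((\<alpha> + 2) * 1 / p))"
      if x: "0 < x" "x \<le> 1" for x
    proof -
      define y where "y = min (4 * x) (1 - r0)"
      have y: "0 < y" "y \<le> 4 * x" "y \<le> exp (- 1)" "y < \<delta>" unfolding y_def using x r0 by auto
      define L where "L = ln (1 / y)"
      have "ln y \<le> ln (exp (- 1))" using y by (subst ln_le_cancel_iff) auto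
      then have L: "1 \<le> L" unfolding L_def using y by (simp add: ln_div)
      \<comment> \<open>On the window 1/(1-t) \<le> 2/x, whereas y \<le> 4x. The ratio 8 costs ln 8
        \<le> 3, and L \<ge> 1 gives 1 + 3 + L \<le> 5L.\<close>
      have lx: "1 + ln (2 / x) \<le> 5 * L"
      proof -
        have "ln (2 / x) = ln (8 * (1 / (4 * x)))" by simp
        also have "\<dots> = ln 8 + ln (1 / (4 * x))" using x by (subst ln_mult) auto
        also have "ln (1 / (4 * x)) \<le> L" unfolding L_def using x y
            by (subst ln_le_cancel_iff) (auto simp: frac_le)
        also have "ln (8::real) \<le> 3"
        proof -
          have "ln (8::real) = 3 * ln 2" using ln_realpow[of 2 3] by simp
          then show ?thesis using ln_2_less_1 by simp
        qed
        finally show ?thesis using L by simp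
      qed
      have "(\<integral>\<^sup>+t. ennreal (h t) * indicator {t. x / 2 \<le> 1 - t \<and> 1 - t \<le> 4 * x} t \<partial>\<nu>)
        \<le> (\<integral>\<^sup>+t. ennreal (5 * L) * indicator {t \<in> space \<nu>. 1 - t \<le> 4 * x} t \<partial>\<nu>)"
      proof (intro nn_integral_mono)
        fix t assume t: "t \<in> space \<nu>"
        show "ennreal (h t) * indicator {t. x / 2 \<le> 1 - t \<and> 1 - t \<le> 4 * x} t
            \<le> ennreal (5 * L) * indicator {t \<in> space \<nu>. 1 - t \<le> 4 * x} t"
        proof (cases "x / 2 \<le> 1 - t \<and> 1 - t \<le> 4 * x")
          case True
          have "ln (1 / (1 - t)) \<le> ln (2 / x)" using True x t sp
              by (subst ln_le_cancel_iff) (auto simp: field_simps)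
          then have "h t \<le> 5 * L" unfolding h_def using lx L by simp
          then show ?thesis using True t by (simp add: ennreal_leI)
        qed simp
      qed
      also have "\<dots> = ennreal (5 * L) * emeasure \<nu> {t \<in> space \<nu>. 1 - t \<le> 4 * x}"
        by (rule nn_integral_cmult_indicator) measurable
      also have "emeasure \<nu> {t \<in> space \<nu>. 1 - t \<le> 4 * x} = emeasure \<mu> {1 - y..<1}"
        unfolding \<nu>_def y_def using x by (intro tail_growth[OF \<mu> r0(1,2)]) simp
      also have "ennreal (5 * L) * emeasure \<mu> {1 - y..<1}
          = ennreal 5 * (emeasure \<mu> {1 - y..<1} * ennreal (ln (1 / (1 - (1 - y))) powr 1))"
        using L by (simp add: ennreal_mult mult_ac L_def)
      also have "\<dots> \<le> ennreal 5 * ennreal (\<epsilon> * (1 - (1 - y)) powr s)"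
        using y by (intro mult_left_mono \<delta>) auto
      also have "\<dots> = ennreal (5 * \<epsilon> * y powr s)" using \<epsilon>
          by (subst ennreal_mult[symmetric]) (auto simp: mult.assoc)
      also have "\<dots> \<le> ennreal (5 * \<epsilon> * (4 * x) powr s)"
        using y s \<epsilon> by (intro ennreal_leI mult_left_mono powr_mono2) auto
      also have "5 * \<epsilon> * (4 * x) powr s = (5 * \<epsilon> * 4 powr s) * x powr ((\<alpha> + 2) * 1 / p)"
        using x by (simp add: powr_mult s_def)
      finally show ?thesis .
    qed
    have "(\<integral>\<^sup>+z. ennreal (i z powr 1) \<partial>wdisc (\<beta> - 2)) \<le> ennreal e"
      if hol: "f holomorphic_on ball 0 1" and fN: "bergman_mass p \<alpha> f \<le> ennreal N"
        and i: "\<And>z. norm z < 1 \<Longrightarrow> 0 \<le> i z \<and> ennreal (i z)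
            \<le> (\<integral>\<^sup>+t\<in>{r0..<1}. ennreal (norm (f (of_real t)) * norm (1 - of_real t * z) powr (- \<beta>)) \<partial>\<mu>)"
      for f i
    proof -
      have [measurable]: "(\<lambda>t. norm (f (of_real t))) \<in> borel_measurable \<nu>" "(\<lambda>t. norm (f (of_real t))) \<in>
          borel_measurable \<mu>"
        by (intro radius_norm_measurable \<nu> \<mu> hol)+
      have E: "(\<integral>\<^sup>+t. ennreal (norm (f (of_real t)) powr 1 * h t) \<partial>\<nu>)
          \<le> ennreal (C1 * (5 * \<epsilon> * 4 powr s) * N powr (1 / p))"
        by (rule C1(2)[OF \<nu> _ _ _ carl hol _ fN]) (use N \<epsilon> in \<open>auto simp: h_def[of t for t]\<close>)
      have "(\<integral>\<^sup>+z. ennreal (i z powr 1) \<partial>wdisc (\<beta> - 2)) = (\<integral>\<^sup>+z. ennreal (i z) \<partial>wdisc (\<beta> - 2))"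
        using i by (intro nn_integral_cong) auto
      also have "\<dots> \<le> ennreal C2 * (\<integral>\<^sup>+t. ennreal (norm (f (of_real t)) * (1 + ln (1 / (1 - t)))) \<partial>\<nu>)"
      proof (rule C2(2)[OF \<nu>])
        show "0 \<le> i z \<and> ennreal (i z) \<le> (\<integral>\<^sup>+t. ennreal (norm (f (of_real t)) * norm (1 - of_real t
            * z) powr (- \<beta>)) \<partial>\<nu>)" if z: "norm z < 1" for z
          unfolding \<nu>_def using i[OF z] by (subst nn_integral_restricted_tail[OF \<mu>(1) r0(1)]) auto
      qed auto
      also have "\<dots> \<le> ennreal C2 * (\<integral>\<^sup>+t. ennreal (norm (f (of_real t)) powr 1 * h t) \<partial>\<nu>)"
        by (intro mult_left_mono nn_integral_mono ennreal_leI) (auto simp: h_def intro!: mult_left_mono)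
      also have "\<dots> \<le> ennreal C2 * ennreal (C1 * (5 * \<epsilon> * 4 powr s) * N powr (1 / p))"
        by (intro mult_left_mono E) simp
      also have "\<dots> = ennreal (C2 * (C1 * (5 * \<epsilon> * 4 powr s) * N powr (1 / p)))"
        using C2 by (intro ennreal_mult'[symmetric]) simp
      also have "C2 * (C1 * (5 * \<epsilon> * 4 powr s) * N powr (1 / p)) = \<epsilon> * D" unfolding D_def by simp
      also have "\<epsilon> * D = e" unfolding \<epsilon>_def using D by simp
      finally show ?thesis .
    qed
    then show "\<exists>r0\<in>{0..<1}. \<forall>f i. f holomorphic_on ball 0 1 \<longrightarrow>
         bergman_mass p \<alpha> f \<le> ennreal N \<longrightarrow>
         (\<forall>z. norm z < 1 \<longrightarrow> 0 \<le> i z \<and> ennreal (i z)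
             \<le> (\<integral>\<^sup>+t\<in>{r0..<1}. ennreal (norm (f (of_real t)) * norm (1 - of_real t * z) powr (- \<beta>)) \<partial>\<mu>)) \<longrightarrow>
         (\<integral>\<^sup>+z. ennreal (i z powr 1) \<partial>wdisc (\<beta> - 2)) \<le> ennreal e"
      using r0 by (intro bexI[of _ r0]) auto
  qed simp
qed

section \<open>Necessary conditions\<close>

text \<open>A power of the Cauchy kernel with pole at 1/a, scaled so that for s = (\<alpha>+2)/p and
  np > \<alpha>+2 its norm stays bounded as a tends to 1. The integer power keeps it rational, and
  it is positive along the radius.\<close>

definition bergman_test :: "real \<Rightarrow> nat \<Rightarrow> real \<Rightarrow> complex \<Rightarrow> complex" where
  "bergman_test s n a z = of_real ((1 - a) powr (real n - s)) / (1 - of_real a * z) ^ n"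

lemma bergman_test_holomorphic:
  assumes "0 \<le> a" "a < 1"
  shows "bergman_test s n a holomorphic_on ball 0 (1 / a)" "bergman_test s n a holomorphic_on ball 0 1"
proof -
  have nz: "1 - of_real a * z \<noteq> 0" if "a * norm z < 1" for z :: complex
  proof
    assume "1 - of_real a * z = 0"
    then have "of_real a * z = 1" by simp
    then have "norm (of_real a * z) = 1" by simp
    then show False using that assms by (simp add: norm_mult)
  qed
  show "bergman_test s n a holomorphic_on ball 0 (1 / a)"
    unfolding bergman_test_def
  proof (intro holomorphic_intros)
    fix z :: complex assume z: "z \<in> ball 0 (1 / a)"
    have "a * norm z < 1"
    proof (cases "a = 0")
      case False
      then show ?thesis using z assms by (simp add: field_simps)
    qed simp
    then show "(1 - of_real a * z) ^ n \<noteq> 0" using nz by simp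
  qed
  show "bergman_test s n a holomorphic_on ball 0 1"
    unfolding bergman_test_def
  proof (intro holomorphic_intros)
    fix z :: complex assume z: "z \<in> ball 0 1"
    have "a * norm z \<le> a * 1" using z assms by (intro mult_left_mono) auto
    then have "a * norm z < 1" using assms by simp
    then show "(1 - of_real a * z) ^ n \<noteq> 0" using nz by simp
  qed
qed

text \<open>With np > \<alpha>+2 the kernel power decays faster than the growth exponent of the
  weighted area, so its integral is at most a multiple of (1-a)^(\<alpha>+2-np), which the scaling
  factor cancels.\<close>

lemma bergman_test_integral_bound:
  assumes p: "0 < p" and \<alpha>: "-1 < \<alpha>" and n: "\<alpha> + 2 < real n * p"
  obtains B where "0 \<le> B" "\<And>a. 0 \<le> a \<Longrightarrow> a < 1 \<Longrightarrow>
    (\<integral>\<^sup>+z. ennreal (norm (bergman_test ((\<alpha> + 2) / p) n a z) powr p) \<partial>wdisc \<alpha>) \<le> ennreal B"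
proof -
  obtain V where V: "0 < V" "\<And>\<rho>. 0 < \<rho> \<Longrightarrow> emeasure (wdisc \<alpha>) {z \<in> space (wdisc \<alpha>). norm (1 - z) \<le> \<rho>}
      \<le> ennreal (V * \<rho> powr (\<alpha> + 2))"
    using emeasure_wdisc_near_one[OF \<alpha>] by blast
  define w where "w = weight_const 0 (real n * p) (\<alpha> + 2)"
  have w: "0 < w" unfolding w_def using \<alpha> n by (intro weight_const_pos) auto
  have "(\<integral>\<^sup>+z. ennreal (norm (bergman_test ((\<alpha> + 2) / p) n a z) powr p) \<partial>wdisc \<alpha>)
      \<le> ennreal (3 powr (real n * p) * w * V)"
    if a: "0 \<le> a" "a < 1" for a
  proof -
    define c where "c = (1 - a) powr (real n * p - (\<alpha> + 2)) * 3 powr (real n * p)"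
    have c: "0 \<le> c" unfolding c_def by simp
    have "(\<integral>\<^sup>+z. ennreal (norm (bergman_test ((\<alpha> + 2) / p) n a z) powr p) \<partial>wdisc \<alpha>)
      \<le> (\<integral>\<^sup>+z. ennreal c * ennreal (norm (1 - z) powr 0 * (norm (1 - z)
          + (1 - a)) powr (- (real n * p))) \<partial>wdisc \<alpha>)"
    proof (intro nn_integral_mono)
      fix z assume "z \<in> space (wdisc \<alpha>)"
      then have z: "norm z < 1" by simp
      then have z1: "z \<noteq> 1" by auto
      have pos: "0 < norm (1 - of_real a * z)" using kernel_comparison[OF z a] by simp
      have "norm (bergman_test ((\<alpha> + 2) / p) n a z)
          = (1 - a) powr (real n - (\<alpha> + 2) / p) * norm (1 - of_real a * z) powr (- real n)"
        using pos by (simp add: bergman_test_def norm_divide norm_power powr_minus powr_realpow) (simp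
            add: divide_inverse)
      then have "norm (bergman_test ((\<alpha> + 2) / p) n a z) powr p
          = (1 - a) powr ((real n - (\<alpha> + 2) / p) * p) * norm (1 - of_real a * z) powr (- real n * p)"
        by (simp add: powr_mult powr_powr)
      also have "(real n - (\<alpha> + 2) / p) * p = real n * p - (\<alpha> + 2)" using p by (simp add: field_simps)
      also have "- real n * p = - (real n * p)" by simp
      also have "(1 - a) powr (real n * p - (\<alpha> + 2)) * norm (1 - of_real a * z) powr (- (real n * p))
         \<le> (1 - a) powr (real n * p - (\<alpha> + 2)) * (3 powr (real n * p) * ((1 - a)
             + norm (1 - z)) powr (- (real n * p)))"
        using z a p by (intro mult_left_mono kernel_norm_bound) auto
      also have "\<dots> = c * (norm (1 - z) powr 0 * (norm (1 - z) + (1 - a)) powr (- (real n * p)))"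
        unfolding c_def using z1 by (simp add: add.commute)
      finally show "ennreal (norm (bergman_test ((\<alpha> + 2) / p) n a z) powr p)
         \<le> ennreal c * ennreal (norm (1 - z) powr 0 * (norm (1 - z) + (1 - a)) powr (- (real n * p)))"
        using c by (simp only: ennreal_mult'[symmetric] ennreal_leI)
    qed
    also have "\<dots> = ennreal c * (\<integral>\<^sup>+z. ennreal (norm (1 - z) powr 0 * (norm (1 - z)
        + (1 - a)) powr (- (real n * p))) \<partial>wdisc \<alpha>)"
      by (rule nn_integral_cmult) measurable
    also have "\<dots> \<le> ennreal c * ennreal (w * V * (1 - a) powr (0 + (\<alpha> + 2) - real n * p))"
    proof (intro mult_left_mono)
      show "(\<integral>\<^sup>+z. ennreal (norm (1 - z) powr 0 * (norm (1 - z) + (1 - a)) powr (- (real n * p))) \<partial>wdisc \<alpha>)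
         \<le> ennreal (w * V * (1 - a) powr (0 + (\<alpha> + 2) - real n * p))"
        unfolding w_def
      proof (rule powr_weight_kernel)
        show "0 < norm (1 - w)" if "w \<in> space (wdisc \<alpha>)" for w using that by auto
      qed (use \<alpha> n V a p in auto)
    qed simp
    also have "\<dots> = ennreal (3 powr (real n * p) * w * V * ((1 - a) powr (real n * p - (\<alpha>
        + 2)) * (1 - a) powr (\<alpha> + 2 - real n * p)))"
      unfolding c_def using w V by (subst ennreal_mult[symmetric]) (auto simp: mult_ac)
    also have "(1 - a) powr (real n * p - (\<alpha> + 2)) * (1 - a) powr (\<alpha> + 2 - real n * p) = 1"
      using a by (simp add: powr_add[symmetric])
    finally show ?thesis by simp
  qed
  then show ?thesis using that[of "3 powr (real n * p) * w * V"] w V by simp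
qed

text \<open>The power series converges beyond the closed disc, so its coefficients are absolutely
  summable and the sum over k is bounded uniformly in t. This gives the integral formula for test
  functions against any finite measure.\<close>

lemma bergman_test_coeff_sum_finite:
  assumes \<mu>: "on_radius \<mu>" "finite_measure \<mu>" and a: "0 \<le> a" "a < 1"
  shows "(\<integral>\<^sup>+t. (\<Sum>k. ennreal (norm (taylor_coeff (bergman_test s n a) k) * t ^ k)) \<partial>\<mu>) < \<infinity>"
proof -
  interpret M: finite_measure \<mu> by (rule \<mu>)
  have sp: "space \<mu> = {0..<1}" by (rule space_radius[OF \<mu>(1)])
  \<comment> \<open>For a > 0 its reciprocal is a radius strictly between 1 and the pole
    1/a.\<close>
  define a' where "a' = (a + 1) / 2"
  have a': "0 < a'" "a' < 1" "a < a'" unfolding a'_def using a by auto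
  define x where "x = 1 / a'"
  have x: "1 < x" unfolding x_def using a' by simp
  have "(\<lambda>k. taylor_coeff (bergman_test s n a) k * of_real x ^ k) sums bergman_test s n a (of_real x)"
  \<comment> \<open>At a = 0 the function is constant, but \<open>1 / a\<close> evaluates to 0 and
    the ball of the general case would be empty.\<close>
  proof (cases "a = 0")
    case True
    have "(\<lambda>z. of_real ((1 - a) powr (real n - s))) holomorphic_on ball (0::complex) (x + 1)"
        by (intro holomorphic_intros)
    then have "bergman_test s n a holomorphic_on ball 0 (x + 1)"
      unfolding bergman_test_def using True by simp
    from holomorphic_power_series[OF this, of "of_real x"] x show ?thesis by (simp add: taylor_coeff_def)
  next
    case False
    then have "x < 1 / a" unfolding x_def using a a' by (simp add: frac_less2)
    then show ?thesis
      using holomorphic_power_series[OF bergman_test_holomorphic(1)[OF a], of "of_real x"] x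
          by (simp add: taylor_coeff_def)
  qed
  then have sm: "summable (\<lambda>k. norm (taylor_coeff (bergman_test s n a) k))"
    using powser_insidea[OF sums_summable, of "taylor_coeff (bergman_test s n a)" "of_real x" _ 1] x by simp
  define S where "S = (\<Sum>k. norm (taylor_coeff (bergman_test s n a) k))"
  have "(\<integral>\<^sup>+t. (\<Sum>k. ennreal (norm (taylor_coeff (bergman_test s n a) k) * t ^ k)) \<partial>\<mu>) \<le> (\<integral>\<^sup>+t. ennreal S \<partial>\<mu>)"
  proof (intro nn_integral_mono)
    fix t assume t: "t \<in> space \<mu>"
    have "(\<Sum>k. ennreal (norm (taylor_coeff (bergman_test s n a) k) * t ^ k))
        \<le> (\<Sum>k. ennreal (norm (taylor_coeff (bergman_test s n a) k)))"
      using t sp by (intro suminf_le summableI ennreal_leI) (auto simp: power_le_one mult_left_le)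
    also have "\<dots> = ennreal S" unfolding S_def by (rule suminf_ennreal2[OF norm_ge_zero sm])
    finally show "(\<Sum>k. ennreal (norm (taylor_coeff (bergman_test s n a) k) * t ^ k)) \<le> ennreal S" .
  qed
  also have "\<dots> = ennreal (S * measure \<mu> (space \<mu>))"
    by (simp add: M.emeasure_eq_measure ennreal_mult'')
  also have "\<dots> < \<infinity>" by simp
  finally show ?thesis .
qed

text \<open>Near the radius at \<open>b\<close> the kernel \<open>(1 - tz)\<^bsup>-\<beta>\<^esup>\<close> has argument bounded away from \<open>\<pm>\<pi>/2\<close>, so nothing
  cancels in the integral of the positive function \<open>bergman_test\<close>.\<close>
lemma hilbert_op_test_lower_bound:
  fixes \<beta> s :: real and n :: nat
  assumes \<beta>: "1 < \<beta>"
  obtains \<eta> c where "0 < \<eta>" "\<eta> \<le> 1 / 8" "0 < c"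
    "\<And>\<mu> a b z. on_radius \<mu> \<Longrightarrow> finite_measure \<mu> \<Longrightarrow>
      0 \<le> b \<Longrightarrow> b \<le> a \<Longrightarrow> a < 1 \<Longrightarrow> z \<in> cball (of_real b) (\<eta> * (1 - b)) \<Longrightarrow>
      c * (1 - a) powr (- s) * measure \<mu> {a..<1} * (1 - b) powr (- \<beta>)
          \<le> norm (hilbert_op \<mu> \<beta> (bergman_test s n a) z)"
proof -
  \<comment> \<open>Continuity at 0 keeps the perturbed kernel factor within 1/2 of 1, so its real
    part is at least 1/2; this fixes the relative radius \<eta>.\<close>
  have "continuous (at 0) (\<lambda>w::complex. (1 + w) powr (- of_real \<beta>))"
    by (intro continuous_intros) auto
  then obtain d where d: "0 < d" "\<And>w::complex. norm w < d \<Longrightarrow> norm ((1 + w) powr (- of_real \<beta>) - 1) < 1 / 2"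
    unfolding continuous_at_eps_delta dist_norm
    by (metis (no_types, lifting) add.right_neutral diff_zero half_gt_zero powr_one_eq_one zero_less_one)
  define \<eta> where "\<eta> = min (d / 2) (1 / 8)"
  have \<eta>: "0 < \<eta>" "\<eta> \<le> 1 / 8" "\<eta> < d" unfolding \<eta>_def using d by auto
  have re: "1 / 2 \<le> Re ((1 + w) powr (- of_real \<beta>))" if "norm w \<le> \<eta>" for w :: complex
  proof -
    have "\<bar>Re ((1 + w) powr (- of_real \<beta>) - 1)\<bar> \<le> norm ((1 + w) powr (- of_real \<beta>) - 1)"
        by (rule abs_Re_le_cmod)
    also have "\<dots> < 1 / 2" using d(2)[of w] that \<eta> by simp
    finally show ?thesis unfolding minus_complex.sel one_complex.sel by linarith
  qed
  \<comment> \<open>1/2 from the real part, 2^(-n) from 1 - at \<le> 2(1 - a), and 2^(-\<beta>) from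
    1 - tb \<le> 2(1 - b), the last two for t \<ge> a.\<close>
  define c where "c = (1 / 2) * 2 powr (- real n) * 2 powr (- \<beta>)"
  have c: "0 < c" unfolding c_def by simp
  have main: "c * (1 - a) powr (- s) * measure \<mu> {a..<1} * (1 - b) powr (- \<beta>)
      \<le> norm (hilbert_op \<mu> \<beta> (bergman_test s n a) z)"
    if \<mu>: "on_radius \<mu>" "finite_measure \<mu>"
      and b: "0 \<le> b" "b \<le> a" and a1: "a < 1" and z: "z \<in> cball (of_real b) (\<eta> * (1 - b))" for \<mu> a b z
  proof -
    interpret M: finite_measure \<mu> by (rule \<mu>)
    have sp: "space \<mu> = {0..<1}" by (rule space_radius[OF \<mu>(1)])
    have a: "0 \<le> a" "a < 1" using b a1 by auto
    have zb: "norm (z - of_real b) \<le> \<eta> * (1 - b)" using z by (simp add: dist_norm norm_minus_commute)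
    have b1: "0 < 1 - b" using b a by simp
    have "norm z \<le> b + \<eta> * (1 - b)" using norm_triangle_ineq[of "z - of_real b" "of_real b"] zb b by simp
    also have "\<dots> < b + 1 * (1 - b)" using \<eta> b1 by (intro add_strict_left_mono mult_strict_right_mono) auto
    finally have z1: "norm z < 1" by simp
    define f where "f = bergman_test s n a"
    note rep = hilbert_representation[OF \<mu> _ bergman_test_holomorphic(2)[OF a]
        bergman_test_coeff_sum_finite[OF \<mu> a, where s = s and n = n], where \<beta> = \<beta>, folded f_def]
    define g where "g t = f (of_real t) * (1 - of_real t * z) powr (- of_real \<beta>)" for t :: real
    have gi: "integrable \<mu> g" unfolding g_def using rep(3)[OF _ z1] \<beta> by simp
    have Hz: "hilbert_op \<mu> \<beta> f z = (\<integral>t. g t \<partial>\<mu>)" unfolding g_def using rep(4)[OF _ z1] \<beta> by simp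
    define \<phi> where "\<phi> t = (1 - a) powr (real n - s) / (1 - a * t) ^ n" for t :: real
    have f\<phi>: "f (of_real t) = of_real (\<phi> t)" for t unfolding f_def bergman_test_def \<phi>_def by simp
    have Reg: "\<phi> t * ((1 - t * b) powr (- \<beta>) / 2) \<le> Re (g t)" "0
        \<le> \<phi> t" "0 < 1 - t * b" if t: "t \<in> space \<mu>" for t
    proof -
      have t01: "0 \<le> t" "t < 1" using t sp by auto
      have tb: "t * b \<le> b" using t01 b by (simp add: mult_left_le_one_le)
      then show pos: "0 < 1 - t * b" using b1 by simp
      have "a * t \<le> a" using t01 a by (simp add: mult_left_le)
      then show \<phi>0: "0 \<le> \<phi> t" unfolding \<phi>_def using a by (intro divide_nonneg_nonneg) auto
      \<comment> \<open>The relative perturbation in 1 - tz = (1 - tb)(1 + w); since 1 - tb \<ge> 1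
        - b, it is at most \<eta>.\<close>
      define w where "w = - (of_real t * (z - of_real b)) / of_real (1 - t * b)"
      have "norm w = t * norm (z - of_real b) / (1 - t * b)"
        unfolding w_def using t01 pos by (simp only: norm_divide norm_minus_cancel norm_mult
            norm_of_real) simp
      also have "\<dots> \<le> 1 * (\<eta> * (1 - b)) / (1 - t * b)" using t01 zb pos
          by (intro divide_right_mono mult_mono) auto
      also have "\<dots> \<le> 1 * (\<eta> * (1 - t * b)) / (1 - t * b)" using tb \<eta> pos
          by (intro divide_right_mono mult_left_mono) auto
      also have "\<dots> = \<eta>" using pos by simp
      finally have w: "norm w \<le> \<eta>" .
      have w1: "1 + w \<noteq> 0"
      proof
        assume "1 + w = 0"
        then have "w = -1" by (simp add: add_eq_0_iff)
        then show False using w \<eta> by simp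
      qed
      have e: "1 - of_real t * z = of_real (1 - t * b) * (1 + w)"
      proof -
        have "of_real (1 - t * b) * w = - (of_real t * (z - of_real b))" unfolding w_def using pos
            by (simp del: of_real_diff)
        then show ?thesis by (simp add: distrib_left algebra_simps)
      qed
      have "(1 - of_real t * z) powr (- of_real \<beta>)
          = of_real ((1 - t * b) powr (- \<beta>)) * (1 + w) powr (- of_real \<beta>)"
      proof -
        have "(1 - of_real t * z) powr (- of_real \<beta>)
            = of_real (1 - t * b) powr (of_real (- \<beta>)) * (1 + w) powr (- of_real \<beta>)"
          unfolding e using pos by (subst powr_times_real_left) auto
        also have "complex_of_real (1 - t * b) powr (of_real (- \<beta>)) = of_real ((1 - t * b) powr (- \<beta>))"
          using pos by (intro powr_of_real) simp
        finally show ?thesis .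
      qed
      then have "Re (g t) = \<phi> t * ((1 - t * b) powr (- \<beta>) * Re ((1 + w) powr (- of_real \<beta>)))"
        unfolding g_def f\<phi> by simp
      moreover have "(1 - t * b) powr (- \<beta>) / 2 \<le> (1 - t * b) powr (- \<beta>) * Re ((1 + w) powr (- of_real \<beta>))"
        using mult_left_mono[OF re[OF w], of "(1 - t * b) powr (- \<beta>)"] by simp
      ultimately show "\<phi> t * ((1 - t * b) powr (- \<beta>) / 2) \<le> Re (g t)"
        using \<phi>0 by (simp only: mult_left_mono)
    qed
    define k where "k = c * (1 - a) powr (- s) * (1 - b) powr (- \<beta>)"
    \<comment> \<open>The real part is nonnegative on the whole radius, so the part below a can be
      discarded.\<close>
    have low: "k * indicator {a..<1} t \<le> Re (g t)" if t: "t \<in> space \<mu>" for t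
    proof (cases "a \<le> t")
      case False
      then show ?thesis using Reg[OF t] by (simp add: order_trans[OF _ Reg(1)[OF t]])
    next
      case True
      have t01: "0 \<le> t" "t < 1" using t sp by auto
      have "a * a \<le> a * t" using True a by (intro mult_left_mono) auto
      moreover have "2 * a - 1 \<le> a * a" using zero_le_power2[of "a - 1"]
          by (simp add: power2_eq_square algebra_simps)
      ultimately have at: "1 - a * t \<le> 2 * (1 - a)" by simp
      have "a * t \<le> a" using t01 a by (simp add: mult_left_le)
      then have at0: "0 < 1 - a * t" using a by simp
      have "2 powr (- real n) * (1 - a) powr (- s)
          = 2 powr (- real n) * ((1 - a) powr (real n - s) * (1 - a) powr (- real n))"
        unfolding powr_add[symmetric] by simp
      also have "\<dots> = (1 - a) powr (real n - s) * (2 * (1 - a)) powr (- real n)"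
        unfolding powr_mult by simp
      also have "\<dots> \<le> (1 - a) powr (real n - s) * (1 - a * t) powr (- real n)"
        using at at0 by (intro mult_left_mono powr_mono2') auto
      also have "\<dots> = \<phi> t" unfolding \<phi>_def using at0 by (simp add: powr_minus powr_realpow divide_inverse)
      finally have \<phi>l: "2 powr (- real n) * (1 - a) powr (- s) \<le> \<phi> t" .
      have "b * (1 - t) \<le> 1 * (1 - b)" using b t01 True a by (intro mult_mono) auto
      then have tb: "1 - t * b \<le> 2 * (1 - b)" by (simp add: algebra_simps)
      have "2 powr (- \<beta>) * (1 - b) powr (- \<beta>) = (2 * (1 - b)) powr (- \<beta>)" unfolding powr_mult ..
      also have "\<dots> \<le> (1 - t * b) powr (- \<beta>)" using tb Reg(3)[OF t] \<beta> by (intro powr_mono2') auto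
      finally have "(2 powr (- real n) * (1 - a) powr (- s)) * (2 powr (- \<beta>) * (1 - b) powr (- \<beta>) / 2)
          \<le> \<phi> t * ((1 - t * b) powr (- \<beta>) / 2)"
        using \<phi>l Reg(2)[OF t] by (intro mult_mono) auto
      also have "\<dots> \<le> Re (g t)" by (rule Reg(1)[OF t])
      finally show ?thesis using True t01 by (simp add: k_def c_def mult_ac)
    qed
    have as: "{a..<1} \<in> sets \<mu>" unfolding \<mu>(1) using a by (auto simp: sets_restrict_space_iff)
    have "k * measure \<mu> {a..<1} = (\<integral>t. k * indicator {a..<1} t \<partial>\<mu>)" using as by simp
    also have "\<dots> \<le> (\<integral>t. Re (g t) \<partial>\<mu>)"
    proof (rule integral_mono)
      show "integrable \<mu> (\<lambda>t. k * indicator {a..<1} t)"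
        using as by (intro integrable_mult_right integrable_real_indicator) (auto simp: M.emeasure_eq_measure)
      show "integrable \<mu> (\<lambda>t. Re (g t))" using gi by simp
    qed (rule low)
    also have "\<dots> = Re (hilbert_op \<mu> \<beta> f z)" unfolding Hz using gi by simp
    also have "\<dots> \<le> norm (hilbert_op \<mu> \<beta> f z)" by (rule complex_Re_le_cmod)
    finally show ?thesis unfolding k_def f_def by (simp add: mult_ac)
  qed
  show ?thesis by (rule that[OF \<eta>(1,2) c]) (use main in auto)
qed

text \<open>Since \<eta> \<le> 1/8, on the disc 1 - |z| stays between 7/8 and 9/8 of 1 - b. The
  weight is thus comparable to (1 - b)^\<gamma>, and the area contributes (1 - b)^2.\<close>

lemma wdisc_ball_lower_bound:
  assumes \<eta>: "0 < \<eta>" "\<eta> \<le> 1 / 8"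
  obtains c where "0 < c" "\<And>b. 0 \<le> b \<Longrightarrow> b < 1 \<Longrightarrow> cball (of_real b) (\<eta> * (1 - b)) \<subseteq> ball (0::complex) 1 \<and>
     ennreal (c * (1 - b) powr (\<gamma> + 2)) \<le> emeasure (wdisc \<gamma>) (cball (of_real b) (\<eta> * (1 - b)))"
proof -
  define c where "c = pi * \<eta>\<^sup>2 / (4 powr \<bar>\<gamma>\<bar> * 2 powr \<bar>\<gamma>\<bar>)"
  have c: "0 < c" unfolding c_def using \<eta> by simp
  have "cball (of_real b) (\<eta> * (1 - b)) \<subseteq> ball (0::complex) 1 \<and>
     ennreal (c * (1 - b) powr (\<gamma> + 2)) \<le> emeasure (wdisc \<gamma>) (cball (of_real b) (\<eta> * (1 - b)))" if b: "0
         \<le> b" "b < 1" for b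
  proof -
    define B where "B = cball (complex_of_real b) (\<eta> * (1 - b))"
    have \<eta>b: "\<eta> * (1 - b) \<le> 1 / 8 * (1 - b)" using \<eta> b by (intro mult_right_mono) auto
    have nz: "8 * norm z \<le> 1 + 7 * b" "9 * b \<le> 8 * norm z + 1" if "z \<in> B" for z
    proof -
      have "norm (z - of_real b) \<le> (1 - b) / 8" using that \<eta>b
          by (simp add: B_def dist_norm norm_minus_commute)
      then have "8 * norm (z - of_real b) \<le> 1 - b" by simp
      moreover have "\<bar>norm z - norm (complex_of_real b)\<bar> \<le> norm (z - of_real b)" by (rule norm_triangle_ineq3)
      moreover have "norm (complex_of_real b) = b" using b by simp
      ultimately show "8 * norm z \<le> 1 + 7 * b" "9 * b \<le> 8 * norm z + 1" by linarith+
    qed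
    have sub: "B \<subseteq> ball 0 1"
    proof
      fix z assume "z \<in> B"
      then have "norm z < 1" using nz(1) b by fastforce
      then show "z \<in> ball 0 1" by simp
    qed
    have Bs: "B \<in> sets disc" unfolding sets_disc_iff using sub by (simp add: B_def)
    have wm: "(\<lambda>z. ennreal ((1 - (norm z)\<^sup>2) powr \<gamma>)) \<in> borel_measurable disc"
      by (rule measurable_disc) measurable
    have "ennreal (c * (1 - b) powr (\<gamma> + 2)) = ennreal ((1 - b) powr \<gamma> / (4 powr \<bar>\<gamma>\<bar> * 2 powr \<bar>\<gamma>\<bar>))
        * ennreal (pi * (\<eta> * (1 - b))\<^sup>2)"
    proof -
      have "c * (1 - b) powr (\<gamma> + 2) = (1 - b) powr \<gamma> / (4 powr \<bar>\<gamma>\<bar> * 2 powr \<bar>\<gamma>\<bar>) * (pi * (\<eta> * (1 - b))\<^sup>2)"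
        unfolding c_def using b by (simp add: powr_add powr_numeral power_mult_distrib)
      then show ?thesis by (simp only:) (rule ennreal_mult, auto)
    qed
    also have "ennreal (pi * (\<eta> * (1 - b))\<^sup>2) = emeasure lborel B"
      unfolding B_def using \<eta> b by (simp add: emeasure_cball unit_ball_vol_2)
    also have "emeasure lborel B = emeasure disc B"
      unfolding disc_def using sub by (intro emeasure_restrict_space[symmetric]) auto
    also have "ennreal ((1 - b) powr \<gamma> / (4 powr \<bar>\<gamma>\<bar> * 2 powr \<bar>\<gamma>\<bar>)) * emeasure disc B
       = (\<integral>\<^sup>+z. ennreal ((1 - b) powr \<gamma> / (4 powr \<bar>\<gamma>\<bar> * 2 powr \<bar>\<gamma>\<bar>)) * indicator B z \<partial>disc)"
      using Bs by (simp add: nn_integral_cmult_indicator)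
    also have "\<dots> \<le> (\<integral>\<^sup>+z. ennreal ((1 - (norm z)\<^sup>2) powr \<gamma>) * indicator B z \<partial>disc)"
    proof (intro nn_integral_mono)
      fix z
      show "ennreal ((1 - b) powr \<gamma> / (4 powr \<bar>\<gamma>\<bar> * 2 powr \<bar>\<gamma>\<bar>)) * indicator B z
          \<le> ennreal ((1 - (norm z)\<^sup>2) powr \<gamma>) * indicator B z"
      proof (cases "z \<in> B")
        case True
        note n = nz[OF True]
        have n1: "norm z < 1" using sub True by auto
        have "(1 - b) powr \<gamma> \<le> 4 powr \<bar>\<gamma>\<bar> * (1 - norm z) powr \<gamma>"
          using n b n1 by (intro powr_comparable) auto
        also have "\<dots> \<le> 4 powr \<bar>\<gamma>\<bar> * (2 powr \<bar>\<gamma>\<bar> * (1 - (norm z)\<^sup>2) powr \<gamma>)"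
          using n1 by (intro mult_left_mono disc_weight_bounds) auto
        finally have "(1 - b) powr \<gamma> / (4 powr \<bar>\<gamma>\<bar> * 2 powr \<bar>\<gamma>\<bar>) \<le> (1 - (norm z)\<^sup>2) powr \<gamma>"
          by (simp add: field_simps)
        then show ?thesis using True by (simp add: ennreal_leI)
      qed simp
    qed
    also have "\<dots> = emeasure (wdisc \<gamma>) B" unfolding wdisc_def by (rule emeasure_density[OF wm Bs, symmetric])
    finally show ?thesis using sub unfolding B_def by simp
  qed
  then show ?thesis using that[OF c] by blast
qed

text \<open>The regions |1 - z| \<le> 1/k shrink to nothing inside the open disc, so dominated
  convergence with majorant |g|^q applies.\<close>

lemma bergman_integral_small_near_one:
  assumes "g holomorphic_on ball 0 1" "bergman_mass q \<gamma> g < \<infinity>" "0 < e"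
  obtains \<rho> where "0 < \<rho>" "(\<integral>\<^sup>+z. ennreal (norm (g z) powr q) * indicator {z. norm (1 - z)
      \<le> \<rho>} z \<partial>wdisc \<gamma>) \<le> ennreal e"
proof -
  have [measurable]: "g \<in> borel_measurable (wdisc \<gamma>)"
    using holomorphic_disc_measurable[OF assms(1)] by (simp add: measurable_cong_sets[OF sets_wdisc refl])
  have "(\<lambda>k. \<integral>\<^sup>+z. ennreal (norm (g z) powr q) * indicator {z. norm (1 - z)
      \<le> 1 / real (Suc k)} z \<partial>wdisc \<gamma>) \<longlonglongrightarrow> (\<integral>\<^sup>+z. 0 \<partial>wdisc \<gamma>)"
  proof (rule nn_integral_dominated_convergence[where w = "\<lambda>z. ennreal (norm (g z) powr q)"])
    show "AE z in wdisc \<gamma>. (\<lambda>k. ennreal (norm (g z) powr q) * indicator {z. norm (1 - z)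
        \<le> 1 / real (Suc k)} z) \<longlonglongrightarrow> 0"
    proof (rule AE_I2)
      fix z assume "z \<in> space (wdisc \<gamma>)"
      then have "0 < norm (1 - z)" by auto
      then obtain K where "inverse (real (Suc K)) < norm (1 - z)"
        using reals_Archimedean by blast
      then have K: "1 / real (Suc K) < norm (1 - z)" by (simp only: inverse_eq_divide)
      have "\<forall>\<^sub>F k in sequentially. ennreal (norm (g z) powr q) * indicator {z. norm (1 - z)
          \<le> 1 / real (Suc k)} z = 0"
        using eventually_ge_at_top[of K]
      proof eventually_elim
        case (elim k)
        then have "1 / real (Suc k) \<le> 1 / real (Suc K)" by (intro divide_left_mono) auto
        then show ?case using K by simp
      qed
      then show "(\<lambda>k. ennreal (norm (g z) powr q) * indicator {z. norm (1 - z) \<le> 1 / real (Suc k)} z) \<longlonglongrightarrow> 0"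
        by (rule tendsto_eventually)
    qed
  qed (use assms in \<open>auto simp: indicator_def\<close>)
  then have "(\<lambda>k. \<integral>\<^sup>+z. ennreal (norm (g z) powr q) * indicator {z. norm (1 - z)
      \<le> 1 / real (Suc k)} z \<partial>wdisc \<gamma>) \<longlonglongrightarrow> 0" by simp
  from order_tendstoD(2)[OF this, of "ennreal e"] assms
  have "\<forall>\<^sub>F k in sequentially. (\<integral>\<^sup>+z. ennreal (norm (g z) powr q) * indicator {z. norm (1 - z)
      \<le> 1 / real (Suc k)} z \<partial>wdisc \<gamma>) < ennreal e" by simp
  then obtain k where "(\<integral>\<^sup>+z. ennreal (norm (g z) powr q) * indicator {z. norm (1 - z)
      \<le> 1 / real (Suc k)} z \<partial>wdisc \<gamma>) < ennreal e"
    by (auto simp: eventually_sequentially)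
  then show ?thesis by (intro that[of "1 / real (Suc k)"]) auto
qed

text \<open>Test functions concentrate at \<open>1\<close>, while a limit \<open>g\<close> of their images has little mass there. The
  finite family \<open>J\<close> of disjoint discs is \<open>{a}\<close> for \<open>q > 1\<close>; for \<open>q = 1\<close> every dyadic scale
  contributes equally, which produces the logarithm.\<close>
lemma hilbert_compact_necessary:
  assumes p: "0 < p" and \<alpha>: "-1 < \<alpha>" and \<beta>: "1 < \<beta>" and q: "0 < q"
    and \<mu>: "on_radius \<mu>" "finite_measure \<mu>"
    and comp: "hilbert_compact \<mu> \<beta> p \<alpha> q (\<beta> - 2)"
  obtains \<eta> where "0 < \<eta>" "\<eta> \<le> 1 / 8" "\<And>e. 0 < e \<Longrightarrow>
      \<exists>\<delta>. 0 < \<delta> \<and> \<delta> < 1 \<and> (\<forall>a J. 1 - \<delta> < a \<longrightarrow> a < 1 \<longrightarrow> finite J \<longrightarrow> J \<subseteq> {1 - \<delta>..a} \<longrightarrow>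
      disjoint_family_on (\<lambda>b. cball (complex_of_real b) (\<eta> * (1 - b))) J \<longrightarrow>
      ((1 - a) powr (- ((\<alpha> + 2) / p)) * measure \<mu> {a..<1}) powr q * (\<Sum>b\<in>J. (1 - b) powr (\<beta> - \<beta> * q)) \<le> e)"
proof -
  have \<beta>2: "-1 < \<beta> - 2" using \<beta> by simp
  define s where "s = (\<alpha> + 2) / p"
  \<comment> \<open>This exponent makes the test functions bounded in the source space.\<close>
  obtain n :: nat where "s < real n" using reals_Archimedean2 by blast
  then have n: "\<alpha> + 2 < real n * p" unfolding s_def using p by (simp add: field_simps)
  obtain \<eta> c where \<eta>: "0 < \<eta>" "\<eta> \<le> 1 / 8" and c: "0 < c" and low:
    "\<And>\<mu> a b z. on_radius \<mu> \<Longrightarrow> finite_measure \<mu> \<Longrightarrow>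
      0 \<le> b \<Longrightarrow> b \<le> a \<Longrightarrow> a < 1 \<Longrightarrow> z \<in> cball (of_real b) (\<eta> * (1 - b)) \<Longrightarrow>
      c * (1 - a) powr (- s) * measure \<mu> {a..<1} * (1 - b) powr (- \<beta>)
          \<le> norm (hilbert_op \<mu> \<beta> (bergman_test s n a) z)"
    using hilbert_op_test_lower_bound[OF \<beta>, of s n] by metis
  obtain c2 where c2: "0 < c2" and ball: "\<And>b. 0 \<le> b \<Longrightarrow> b < 1 \<Longrightarrow>
      cball (of_real b) (\<eta> * (1 - b)) \<subseteq> ball (0::complex) 1 \<and>
     ennreal (c2 * (1 - b) powr (\<beta> - 2 + 2)) \<le> emeasure (wdisc (\<beta> - 2)) (cball (of_real b) (\<eta> * (1 - b)))"
    using wdisc_ball_lower_bound[OF \<eta>] by metis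
  obtain B where B: "0 \<le> B" "\<And>a. 0 \<le> a \<Longrightarrow> a < 1 \<Longrightarrow>
    bergman_mass p \<alpha> (bergman_test s n a) \<le> ennreal B"
    using bergman_test_integral_bound[OF p \<alpha> n] unfolding s_def by blast
  have test: "bergman_test s n a \<in> bergman_space p \<alpha>" "bergman_norm p \<alpha> (bergman_test s n a)
      \<le> ((\<alpha> + 1) / pi * B) powr (1 / p)"
    if a: "0 \<le> a" "a < 1" for a
  proof -
    have hol: "bergman_test s n a holomorphic_on ball 0 1" by (rule bergman_test_holomorphic(2)[OF a])
    show "bergman_test s n a \<in> bergman_space p \<alpha>"
      unfolding bergman_space_iff[OF \<alpha>] using hol le_less_trans[OF B(2)[OF a]] by auto
    have "bergman_int p \<alpha> (bergman_test s n a) \<le> ennreal ((\<alpha> + 1) / pi) * ennreal B"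
      unfolding bergman_int_eq[OF hol] by (intro mult_left_mono B a) simp
    also have "\<dots> = ennreal ((\<alpha> + 1) / pi * B)" using B by (intro ennreal_mult''[symmetric])
    finally have "enn2real (bergman_int p \<alpha> (bergman_test s n a)) \<le> (\<alpha> + 1) / pi * B"
      using \<alpha> B by (intro enn2real_leI) auto
    then show "bergman_norm p \<alpha> (bergman_test s n a) \<le> ((\<alpha> + 1) / pi * B) powr (1 / p)"
      unfolding bergman_norm_def using p by (intro powr_mono2) auto
  qed
  have claim: "\<exists>\<delta>. 0 < \<delta> \<and> \<delta> < 1 \<and> (\<forall>a J. 1 - \<delta> < a \<longrightarrow> a < 1 \<longrightarrow> finite J \<longrightarrow> J \<subseteq> {1 - \<delta>..a} \<longrightarrow>
      disjoint_family_on (\<lambda>b. cball (complex_of_real b) (\<eta> * (1 - b))) J \<longrightarrow>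
      ((1 - a) powr (- s) * measure \<mu> {a..<1}) powr q * (\<Sum>b\<in>J. (1 - b) powr (\<beta> - \<beta> * q))
          \<le> e)" if e: "0 < e" for e
  proof (rule ccontr)
    assume neg: "\<not> ?thesis"
    \<comment> \<open>Failure of the claim at \<delta> = 1/(j+2), which lies strictly between 0 and
      1 even for j = 0, produces bad points tending to 1.\<close>
    define P where "P j a J \<longleftrightarrow> 1 - 1 / real (j + 2) < a \<and> a < 1 \<and> finite J \<and> J \<subseteq> {1 - 1 / real (j + 2)..a} \<and>
      disjoint_family_on (\<lambda>b. cball (complex_of_real b) (\<eta> * (1 - b))) J \<and>
      e < ((1 - a) powr (- s) * measure \<mu> {a..<1}) powr q * (\<Sum>b\<in>J. (1 - b) powr (\<beta> - \<beta>
          * q))" for j :: nat and a J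
    have "\<exists>a J. P j a J" for j
    proof -
      have "0 < 1 / real (j + 2)" "1 / real (j + 2) < 1" by auto
      with neg show ?thesis unfolding P_def by (meson not_less)
    qed
    then obtain a J where P: "\<And>j. P j (a j) (J j)"
      by metis
    then have aJ: "\<And>j::nat. 1 - 1 / real (j + 2) < a j" "\<And>j. a j < 1" "\<And>j. finite (J j)" "\<And>j. J j \<subseteq> {1 -
        1 / real (j + 2)..a j}"
      "\<And>j. disjoint_family_on (\<lambda>b. cball (complex_of_real b) (\<eta> * (1 - b))) (J j)"
      "\<And>j. e < ((1 - a j) powr (- s) * measure \<mu> {a j..<1}) powr q * (\<Sum>b\<in>J j. (1 - b) powr (\<beta> - \<beta> * q))"
      unfolding P_def by blast+
    have inv01: "1 / real (j + 2) \<le> 1" for j by simp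
    have a0: "0 \<le> a j" for j using aJ(1)[of j] inv01[of j] by linarith
    define F where "F j = bergman_test s n (a j)" for j
    have "\<forall>j. F j \<in> bergman_space p \<alpha> \<and> bergman_norm p \<alpha> (F j) \<le> ((\<alpha> + 1) / pi * B) powr (1 / p)"
      unfolding F_def using test a0 aJ(2) by blast
    with comp obtain r g where r: "strict_mono r" and g: "g \<in> bergman_space q (\<beta> - 2)"
      and conv: "(\<lambda>j. bergman_norm q (\<beta> - 2) (\<lambda>z. hilbert_op \<mu> \<beta> (F (r j)) z - g z)) \<longlonglongrightarrow> 0"
      unfolding hilbert_compact_def by meson
    have HF: "hilbert_op \<mu> \<beta> (F j) \<in> bergman_space q (\<beta> - 2)" for j
      using comp test(1)[OF a0 aJ(2)] unfolding hilbert_compact_def F_def by blast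
    have hol: "hilbert_op \<mu> \<beta> (F j) holomorphic_on ball 0 1" "g holomorphic_on ball 0 1" for j
      using HF g by (auto simp: bergman_space_iff[OF \<beta>2])
    define X where "X j = (\<integral>\<^sup>+z. ennreal (norm (hilbert_op \<mu> \<beta> (F (r j)) z - g z) powr q) \<partial>wdisc (\<beta> -
        2))" for j
    have X: "X \<longlonglongrightarrow> 0"
      unfolding X_def
      by (rule bergman_norm_tendsto_zero_iff[OF \<beta>2 q, THEN iffD1, OF _ conv])
        (use \<beta>2 q HF g in \<open>auto intro!: bergman_space_diff\<close>)
    define e1 where "e1 = c powr q * c2 * e"
    have e1: "0 < e1" unfolding e1_def using c c2 e by simp
    \<comment> \<open>Chosen so that 2^q (e2 + e2) = e1/2, half of the lower bound to be
      contradicted.\<close>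
    define e2 where "e2 = e1 / (4 * 2 powr q)"
    have e2: "0 < e2" unfolding e2_def using e1 by simp
    obtain \<rho> where \<rho>: "0 < \<rho>" "(\<integral>\<^sup>+z. ennreal (norm (g z) powr q) * indicator {z. norm (1 - z)
        \<le> \<rho>} z \<partial>wdisc (\<beta> - 2)) \<le> ennreal e2"
      using bergman_integral_small_near_one[where q = q
          and \<gamma> = "\<beta> - 2", OF hol(2) _ e2] g bergman_space_iff[OF \<beta>2, of g q] by blast
    have "\<forall>\<^sub>F j in sequentially. X j < ennreal e2"
      using order_tendstoD(2)[OF X, of "ennreal e2"] e2 by simp
    moreover have "\<forall>\<^sub>F j in sequentially. 2 / \<rho> \<le> real j"
      using filterlim_real_sequentially by (simp add: filterlim_at_top)
    ultimately have "\<forall>\<^sub>F j in sequentially. X j < ennreal e2 \<and> 2 / \<rho> \<le> real j" by eventually_elim simp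
    then obtain j where j: "X j < ennreal e2" "2 / \<rho> \<le> real j" by (auto simp: eventually_sequentially)
    define a' where "a' = a (r j)"
    define J' where "J' = J (r j)"
    define \<delta> where "\<delta> = 1 / real (r j + 2)"
    have "j \<le> r j" by (rule seq_suble[OF r])
    then have "2 / \<rho> \<le> real (r j + 2)" using j(2) by simp
    \<comment> \<open>On the disc centred at b one has |1 - z| \<le> 2(1 - b) \<le> 2\<delta>, so
      all the discs lie where g has little mass.\<close>
    then have \<delta>: "2 * \<delta> \<le> \<rho>" unfolding \<delta>_def using \<rho>(1) by (simp add: field_simps)
    have \<delta>1: "\<delta> \<le> 1" unfolding \<delta>_def by (rule inv01)
    have J': "finite J'" "\<And>b. b \<in> J' \<Longrightarrow> 1 - \<delta> \<le> b \<and> b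
        \<le> a'" "disjoint_family_on (\<lambda>b. cball (complex_of_real b) (\<eta> * (1 - b))) J'"
      using aJ(3)[of "r j"] aJ(4)[of "r j"] aJ(5)[of "r j"] unfolding J'_def \<delta>_def a'_def by auto
    have a': "0 \<le> a'" "a' < 1" unfolding a'_def using a0 aJ(2) by auto
    define \<kappa> where "\<kappa> = c * (1 - a') powr (- s) * measure \<mu> {a'..<1}"
    have \<kappa>: "0 \<le> \<kappa>" unfolding \<kappa>_def using c by simp
    define D where "D b = cball (complex_of_real b) (\<eta> * (1 - b))" for b
    have b01: "0 \<le> b" "b < 1" "b \<le> a'" if "b \<in> J'" for b using J'(2)[OF that] \<delta>1 a' by auto
    have Dsub: "D b \<subseteq> ball 0 1" "ennreal (c2 * (1 - b) powr \<beta>)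
        \<le> emeasure (wdisc (\<beta> - 2)) (D b)" if "b \<in> J'" for b
      using ball[OF b01(1,2)[OF that]] unfolding D_def by auto
    have Dm: "D b \<in> sets (wdisc (\<beta> - 2))" if "b \<in> J'" for b
      using Dsub(1)[OF that] by (simp add: sets_disc_iff D_def)
    have D\<rho>: "norm (1 - z) \<le> \<rho>" if "b \<in> J'" "z \<in> D b" for b z
    proof -
      have "norm (of_real b - z) \<le> \<eta> * (1 - b)" using that(2) by (simp add: D_def dist_norm)
      also have "\<dots> \<le> 1 * (1 - b)" using \<eta> b01[OF that(1)] by (intro mult_right_mono) auto
      finally have "norm (complex_of_real b - z) \<le> 1 - b" by simp
      moreover have "norm (1 - complex_of_real b) = 1 - b"
      proof -
        have "1 - complex_of_real b = of_real (1 - b)" by simp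
        then show ?thesis using b01[OF that(1)] by (simp only: norm_of_real)
      qed
      moreover have "norm (1 - z) \<le> norm (1 - complex_of_real b) + norm (complex_of_real b - z)"
        using norm_triangle_ineq[of "1 - complex_of_real b" "complex_of_real b - z"] by simp
      ultimately show ?thesis using J'(2)[OF that(1)] \<delta> by linarith
    qed
    define H where "H = hilbert_op \<mu> \<beta> (F (r j))"
    have m: "H \<in> borel_measurable (wdisc (\<beta> - 2))" "g \<in> borel_measurable (wdisc (\<beta> - 2))"
      using holomorphic_disc_measurable hol unfolding H_def
          by (auto simp: measurable_cong_sets[OF sets_wdisc refl])
    note [measurable] = m
    have Hlow: "\<kappa> * (1 - b) powr (- \<beta>) \<le> norm (H z)" if "b \<in> J'" "z \<in> D b" for b z
      using low[OF \<mu> b01(1,3)[OF that(1)] a'(2) that(2)[unfolded D_def]]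
          unfolding H_def F_def a'_def[symmetric] \<kappa>_def .
    \<comment> \<open>On the disc at b the image is at least \<kappa> (1-b)^(-\<beta>) and the
      weighted area at least c2 (1-b)^\<beta>; this explains the summand
      (1-b)^(\<beta>-\<beta>q).\<close>
    have "ennreal e1 \<le> ennreal (\<Sum>b\<in>J'. (\<kappa> * (1 - b) powr (- \<beta>)) powr q * (c2 * (1 - b) powr \<beta>))"
    proof (rule ennreal_leI)
      have "e1 \<le> c powr q * c2 * (((1 - a') powr (- s) * measure \<mu> {a'..<1}) powr q
          * (\<Sum>b\<in>J'. (1 - b) powr (\<beta> - \<beta> * q)))"
        unfolding e1_def using aJ(6)[of "r j"] c c2 unfolding a'_def J'_def by (intro mult_left_mono) auto
      also have "\<dots> = c2 * \<kappa> powr q * (\<Sum>b\<in>J'. (1 - b) powr (\<beta> - \<beta> * q))"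
        unfolding \<kappa>_def by (simp add: powr_mult mult_ac)
      also have "\<dots> = (\<Sum>b\<in>J'. (\<kappa> * (1 - b) powr (- \<beta>)) powr q * (c2 * (1 - b) powr \<beta>))"
        unfolding sum_distrib_left
      proof (intro sum.cong refl)
        fix b assume "b \<in> J'"
        have "(\<kappa> * (1 - b) powr (- \<beta>)) powr q * (c2 * (1 - b) powr \<beta>)
            = c2 * \<kappa> powr q * ((1 - b) powr (- \<beta> * q) * (1 - b) powr \<beta>)"
          by (simp add: powr_mult powr_powr)
        also have "(1 - b) powr (- \<beta> * q) * (1 - b) powr \<beta> = (1 - b) powr (\<beta> - \<beta> * q)"
          by (simp add: powr_add[symmetric])
        finally show "c2 * \<kappa> powr q * (1 - b) powr (\<beta> - \<beta> * q)
            = (\<kappa> * (1 - b) powr (- \<beta>)) powr q * (c2 * (1 - b) powr \<beta>)" by (rule sym)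
      qed
      finally show "e1 \<le> (\<Sum>b\<in>J'. (\<kappa> * (1 - b) powr (- \<beta>)) powr q * (c2 * (1 - b) powr \<beta>))" .
    qed
    also have "\<dots> = (\<Sum>b\<in>J'. ennreal ((\<kappa> * (1 - b) powr (- \<beta>)) powr q * (c2 * (1 - b) powr \<beta>)))"
      using c2 by (intro sum_ennreal[symmetric]) auto
    also have "\<dots> \<le> (\<Sum>b\<in>J'. \<integral>\<^sup>+z. ennreal (norm (H z) powr q) * indicator (D b) z \<partial>wdisc (\<beta> - 2))"
    proof (rule sum_mono)
      fix b assume b: "b \<in> J'"
      have "ennreal ((\<kappa> * (1 - b) powr (- \<beta>)) powr q * (c2 * (1 - b) powr \<beta>))
          \<le> ennreal ((\<kappa> * (1 - b) powr (- \<beta>)) powr q) * emeasure (wdisc (\<beta> - 2)) (D b)"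
        using c2 by (subst ennreal_mult) (auto intro!: mult_left_mono Dsub(2)[OF b])
      also have "\<dots> = (\<integral>\<^sup>+z. ennreal ((\<kappa> * (1 - b) powr (- \<beta>)) powr q) * indicator (D b) z \<partial>wdisc (\<beta> - 2))"
        by (rule nn_integral_cmult_indicator[OF Dm[OF b], symmetric])
      also have "\<dots> \<le> (\<integral>\<^sup>+z. ennreal (norm (H z) powr q) * indicator (D b) z \<partial>wdisc (\<beta> - 2))"
        using Hlow[OF b] q \<kappa> by (intro nn_integral_mono) (auto simp: indicator_def intro!: ennreal_leI
            powr_mono2)
      finally show "ennreal ((\<kappa> * (1 - b) powr (- \<beta>)) powr q * (c2 * (1 - b) powr \<beta>))
          \<le> (\<integral>\<^sup>+z. ennreal (norm (H z) powr q) * indicator (D b) z \<partial>wdisc (\<beta> - 2))" .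
    qed
    also have "\<dots> = (\<integral>\<^sup>+z. (\<Sum>b\<in>J'. ennreal (norm (H z) powr q) * indicator (D b) z) \<partial>wdisc (\<beta> - 2))"
      using Dm by (intro nn_integral_sum[symmetric]) auto
    also have "\<dots> \<le> (\<integral>\<^sup>+z. ennreal (2 powr q) * (ennreal (norm (H z - g z) powr q)
        + ennreal (norm (g z) powr q) * indicator {z. norm (1 - z) \<le> \<rho>} z) \<partial>wdisc (\<beta> - 2))"
    proof (rule nn_integral_mono)
      fix z
      \<comment> \<open>Disjointness merges the indicators into one, so no point of the disc is
        counted twice.\<close>
      have "(\<Sum>b\<in>J'. ennreal (norm (H z) powr q) * indicator (D b) z)
          = ennreal (norm (H z) powr q) * indicator (\<Union>(D ` J')) z"
        using J'(1,3) unfolding D_def[abs_def] by (simp add: sum_distrib_left[symmetric]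
            indicator_UN_disjoint)
      also have "\<dots> \<le> ennreal (2 powr q) * (ennreal (norm (H z - g z) powr q)
          + ennreal (norm (g z) powr q) * indicator {z. norm (1 - z) \<le> \<rho>} z)"
      proof (cases "z \<in> \<Union>(D ` J')")
        case True
        then have "norm (1 - z) \<le> \<rho>" using D\<rho> by auto
        have "norm (H z) powr q \<le> (norm (H z - g z) + norm (g z)) powr q"
          using q norm_triangle_ineq[of "H z - g z" "g z"] by (intro powr_mono2) auto
        also have "\<dots> \<le> 2 powr q * (norm (H z - g z) powr q + norm (g z) powr q)"
          using q by (intro powr_add_le) auto
        finally have "ennreal (norm (H z) powr q) \<le> ennreal (2 powr q)
            * (ennreal (norm (H z - g z) powr q) + ennreal (norm (g z) powr q))"
          by (simp add: ennreal_plus[symmetric] ennreal_mult'[symmetric] ennreal_leI del: ennreal_plus)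
        then show ?thesis using True \<open>norm (1 - z) \<le> \<rho>\<close> by simp
      qed simp
      finally show "(\<Sum>b\<in>J'. ennreal (norm (H z) powr q) * indicator (D b) z)
        \<le> ennreal (2 powr q) * (ennreal (norm (H z - g z) powr q)
            + ennreal (norm (g z) powr q) * indicator {z. norm (1 - z) \<le> \<rho>} z)" .
    qed
    also have "\<dots> = ennreal (2 powr q) * (X j + (\<integral>\<^sup>+z. ennreal (norm (g z) powr q)
        * indicator {z. norm (1 - z) \<le> \<rho>} z \<partial>wdisc (\<beta> - 2)))"
      unfolding X_def H_def[symmetric] by (subst nn_integral_cmult; (subst nn_integral_add)?) auto
    also have "\<dots> \<le> ennreal (2 powr q) * (ennreal e2 + ennreal e2)"
      using j(1) by (intro mult_left_mono add_mono \<rho>) auto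
    also have "\<dots> = ennreal (2 powr q * (e2 + e2))"
      using e2 by (simp add: ennreal_plus[symmetric] ennreal_mult'[symmetric] del: ennreal_plus)
    also have "2 powr q * (e2 + e2) = e1 / 2" unfolding e2_def by simp
    finally have "e1 \<le> e1 / 2" using e1 by (subst (asm) ennreal_le_iff) auto
    then show False using e1 by simp
  qed
  show ?thesis by (rule that[OF \<eta>]) (use claim in \<open>auto simp: s_def\<close>)
qed

theorem compact_imp_vanishing_carleson:
  assumes p: "0 < p" and \<alpha>: "-1 < \<alpha>" and \<beta>: "1 < \<beta>" and q: "0 < q"
    and \<mu>: "on_radius \<mu>" "finite_measure \<mu>"
    and comp: "hilbert_compact \<mu> \<beta> p \<alpha> q (\<beta> - 2)"
  shows "vanishing_carleson \<mu> ((\<alpha> + 2) / p + \<beta> * (1 - 1 / q))"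
  unfolding vanishing_carleson_def
proof (intro allI impI)
  fix \<epsilon> :: real assume \<epsilon>: "0 < \<epsilon>"
  define s where "s = (\<alpha> + 2) / p"
  obtain \<eta> where "0 < \<eta>" "\<eta> \<le> 1 / 8" and "\<And>e. 0 < e \<Longrightarrow>
      \<exists>\<delta>. 0 < \<delta> \<and> \<delta> < 1 \<and> (\<forall>a J. 1 - \<delta> < a \<longrightarrow> a < 1 \<longrightarrow> finite J \<longrightarrow> J \<subseteq> {1 - \<delta>..a} \<longrightarrow>
      disjoint_family_on (\<lambda>b. cball (complex_of_real b) (\<eta> * (1 - b))) J \<longrightarrow>
      ((1 - a) powr (- s) * measure \<mu> {a..<1}) powr q * (\<Sum>b\<in>J. (1 - b) powr (\<beta> - \<beta> * q)) \<le> e)"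
    by (rule hilbert_compact_necessary[OF p \<alpha> \<beta> q \<mu> comp, folded s_def], rule that, assumption,
        assumption, blast)
  from this(3)[of "\<epsilon> powr q"] \<epsilon> obtain \<delta> where \<delta>: "0 < \<delta>" and key: "\<And>a J. 1 - \<delta> < a \<Longrightarrow> a < 1 \<Longrightarrow> finite J \<Longrightarrow>
      J \<subseteq> {1 - \<delta>..a} \<Longrightarrow>
      disjoint_family_on (\<lambda>b. cball (complex_of_real b) (\<eta> * (1 - b))) J \<Longrightarrow>
      ((1 - a) powr (- s) * measure \<mu> {a..<1}) powr q * (\<Sum>b\<in>J. (1 - b) powr (\<beta> - \<beta> * q)) \<le> \<epsilon> powr q"
    by auto
  have "emeasure \<mu> {a..<1} \<le> ennreal (\<epsilon> * (1 - a) powr ((\<alpha> + 2) / p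
      + \<beta> * (1 - 1 / q)))" if a: "1 - \<delta> < a" "a < 1" for a
  proof -
    define m where "m = measure \<mu> {a..<1}"
    have m: "emeasure \<mu> {a..<1} = ennreal m" unfolding m_def
        by (rule finite_measure.emeasure_eq_measure[OF \<mu>(2)])
    \<comment> \<open>For q > 1 the exponent \<beta> - \<beta>q is negative, so the disc at b = a
      carries the largest summand.\<close>
    have "((1 - a) powr (- s) * m) powr q * (1 - a) powr (\<beta> - \<beta> * q) \<le> \<epsilon> powr q"
      using key[OF a, of "{a}"] a by (simp add: disjoint_family_on_def m_def)
    also have "(1 - a) powr (\<beta> - \<beta> * q) = ((1 - a) powr (- (\<beta> * (1 - 1 / q)))) powr q"
    proof -
      have "- (\<beta> * (1 - 1 / q)) * q = \<beta> - \<beta> * q" using q by (simp add: field_simps)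
      then show ?thesis by (simp only: powr_powr)
    qed
    finally have "((1 - a) powr (- s) * m * (1 - a) powr (- (\<beta> * (1 - 1 / q)))) powr q \<le> \<epsilon> powr q"
      by (simp only: powr_mult)
    then have "(1 - a) powr (- s) * m * (1 - a) powr (- (\<beta> * (1 - 1 / q))) \<le> \<epsilon>"
      using q \<epsilon> by (meson not_less powr_less_mono2 less_imp_le)
    then have "(1 - a) powr (s + \<beta> * (1 - 1 / q)) * ((1 - a) powr (- s) * m * (1 - a) powr (- (\<beta>
        * (1 - 1 / q)))) \<le> (1 - a) powr (s + \<beta> * (1 - 1 / q)) * \<epsilon>"
      by (intro mult_left_mono) auto
    also have "(1 - a) powr (s + \<beta> * (1 - 1 / q)) * ((1 - a) powr (- s) * m * (1 - a) powr (- (\<beta>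
        * (1 - 1 / q))))
       = m * ((1 - a) powr (s + \<beta> * (1 - 1 / q)) * (1 - a) powr (- s) * (1 - a) powr (- (\<beta>
           * (1 - 1 / q))))" by simp
    also have "(1 - a) powr (s + \<beta> * (1 - 1 / q)) * (1 - a) powr (- s) * (1 - a) powr (- (\<beta>
        * (1 - 1 / q))) = 1"
      unfolding powr_add[symmetric] using a by simp
    finally show ?thesis unfolding m s_def by (intro ennreal_leI) (simp add: mult.commute)
  qed
  then show "\<exists>\<delta>>0. \<forall>t. 1 - \<delta> < t \<and> t < 1 \<longrightarrow> emeasure \<mu> {t..<1}
      \<le> ennreal (\<epsilon> * (1 - t) powr ((\<alpha> + 2) / p + \<beta> * (1 - 1 / q)))"
    using \<delta> by blast
qed

text \<open>For j < k put x = 2^(-j) and y = 2^(-k) \<le> x/2: the centres are x - y \<ge> x/2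
  apart, while the radii add up to at most (x + y)/8 \<le> 3x/16.\<close>

lemma disjoint_dyadic_discs:
  assumes "0 < \<eta>" "\<eta> \<le> 1 / 8"
  shows "disjoint_family_on (\<lambda>b. cball (complex_of_real b) (\<eta>
      * (1 - b))) ((\<lambda>j::nat. 1 - 1 / (2::real) ^ j) ` I)"
proof -
  have *: "cball (complex_of_real (1 - 1 / 2 ^ j)) (\<eta>
      * (1 / 2 ^ j)) \<inter> cball (complex_of_real (1 - 1 / 2 ^ k)) (\<eta> * (1 / 2 ^ k)) = {}"
    if "j < k" for j k :: nat
  proof (rule ccontr)
    define x where "x = 1 / (2::real) ^ j"
    define y where "y = 1 / (2::real) ^ k"
    assume "\<not> ?thesis"
    then obtain z where z: "norm (complex_of_real (1 - x) - z)
        \<le> \<eta> * x" "norm (complex_of_real (1 - y) - z) \<le> \<eta> * y"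
      by (auto simp: x_def y_def dist_norm)
    have x: "0 < x" and y: "0 < y" unfolding x_def y_def by auto
    have "(2::real) ^ Suc j \<le> 2 ^ k" using that by (intro power_increasing) auto
    then have yx: "y \<le> x / 2" unfolding x_def y_def by (simp add: field_simps)
    have "norm (complex_of_real (1 - x) - of_real (1 - y))
        \<le> norm (of_real (1 - x) - z) + norm (of_real (1 - y) - z)"
      using norm_triangle_ineq4[of "of_real (1 - x) - z" "of_real (1 - y) - z"] by simp
    also have "\<dots> \<le> \<eta> * x + \<eta> * y" using z by linarith
    also have "\<dots> \<le> 1 / 8 * x + 1 / 8 * y" using assms x y by (intro add_mono mult_right_mono) auto
    also have "norm (complex_of_real (1 - x) - of_real (1 - y)) = \<bar>y - x\<bar>"
    proof -
      have "complex_of_real (1 - x) - of_real (1 - y) = of_real (y - x)" by simp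
      then show ?thesis by (simp only: norm_of_real)
    qed
    finally show False using yx x y by linarith
  qed
  show ?thesis
    unfolding disjoint_family_on_def
  proof (intro ballI impI)
    fix b b' assume "b \<in> (\<lambda>j::nat. 1 - 1 / (2::real) ^ j) ` I" "b' \<in> (\<lambda>j::nat. 1 - 1 / (2::real) ^ j) `
        I" "b \<noteq> b'"
    then obtain j k :: nat where jk: "b = 1 - 1 / 2 ^ j" "b' = 1 - 1 / 2 ^ k" "j \<noteq> k" by blast
    then consider "j < k" | "k < j" by linarith
    then show "cball (complex_of_real b) (\<eta> * (1 - b)) \<inter> cball (complex_of_real b') (\<eta> * (1 - b')) = {}"
    proof cases
      case 1 then show ?thesis using *[of j k] unfolding jk by simp
    next
      case 2 then show ?thesis using *[of k j] unfolding jk by (simp add: Int_commute)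
    qed
  qed
qed

theorem compact_imp_vanishing_log_carleson:
  assumes p: "0 < p" and \<alpha>: "-1 < \<alpha>" and \<beta>: "1 < \<beta>"
    and \<mu>: "on_radius \<mu>" "finite_measure \<mu>"
    and comp: "hilbert_compact \<mu> \<beta> p \<alpha> 1 (\<beta> - 2)"
  shows "vanishing_log_carleson \<mu> 1 ((\<alpha> + 2) / p)"
  unfolding vanishing_log_carleson_def
proof (intro allI impI)
  fix \<epsilon> :: real assume \<epsilon>: "0 < \<epsilon>"
  define s where "s = (\<alpha> + 2) / p"
  obtain \<eta> where \<eta>: "0 < \<eta>" "\<eta> \<le> 1 / 8" and "\<And>e. 0 < e \<Longrightarrow>
      \<exists>\<delta>. 0 < \<delta> \<and> \<delta> < 1 \<and> (\<forall>a J. 1 - \<delta> < a \<longrightarrow> a < 1 \<longrightarrow> finite J \<longrightarrow> J \<subseteq> {1 - \<delta>..a} \<longrightarrow>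
      disjoint_family_on (\<lambda>b. cball (complex_of_real b) (\<eta> * (1 - b))) J \<longrightarrow>
      ((1 - a) powr (- s) * measure \<mu> {a..<1}) powr 1 * (\<Sum>b\<in>J. (1 - b) powr (\<beta> - \<beta> * 1)) \<le> e)"
    by (rule hilbert_compact_necessary[OF p \<alpha> \<beta> zero_less_one \<mu> comp, folded s_def], rule that,
        assumption, assumption, blast)
  from this(3)[of "\<epsilon> / 2"] \<epsilon> obtain \<delta> where \<delta>: "0 < \<delta>" "\<delta> < 1" and key: "\<And>a J. 1 - \<delta> < a \<Longrightarrow> a < 1 \<Longrightarrow>
      finite J \<Longrightarrow> J \<subseteq> {1 - \<delta>..a} \<Longrightarrow>
      disjoint_family_on (\<lambda>b. cball (complex_of_real b) (\<eta> * (1 - b))) J \<Longrightarrow>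
      ((1 - a) powr (- s) * measure \<mu> {a..<1}) powr 1 * (\<Sum>b\<in>J. (1 - b) powr (\<beta> - \<beta> * 1)) \<le> \<epsilon> / 2"
    by auto
  \<comment> \<open>From this index on, the dyadic points lie within \<delta> of 1.\<close>
  define j0 where "j0 = nat \<lceil>log 2 (1 / \<delta>)\<rceil>"
  have j0: "1 / 2 ^ j \<le> \<delta>" if "j0 \<le> j" for j
  proof -
    have "log 2 (1 / \<delta>) \<le> real j" using that unfolding j0_def by linarith
    then have "1 / \<delta> \<le> 2 powr real j" using \<delta> by (subst (asm) log_le_iff) auto
    then show ?thesis using \<delta> by (simp add: powr_realpow field_simps)
  qed
  \<comment> \<open>Forces the logarithm at a to be at least 2 j0, so that leaving out the first j0
    scales costs no more than half of it.\<close>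
  define \<delta>' where "\<delta>' = min \<delta> (exp (- 2 * real j0))"
  have \<delta>': "0 < \<delta>'" "\<delta>' \<le> \<delta>" unfolding \<delta>'_def using \<delta> by auto
  have "emeasure \<mu> {a..<1} * ennreal (ln (1 / (1 - a)) powr 1)
      \<le> ennreal (\<epsilon> * (1 - a) powr s)" if a: "1 - \<delta>' < a" "a < 1" for a
  proof -
    define m where "m = measure \<mu> {a..<1}"
    have m: "emeasure \<mu> {a..<1} = ennreal m" "0 \<le> m" unfolding m_def
        by (auto intro: finite_measure.emeasure_eq_measure[OF \<mu>(2)])
    define L where "L = ln (1 / (1 - a))"
    have L: "2 * real j0 \<le> L"
    proof -
      have "1 - a \<le> exp (- 2 * real j0)" using a unfolding \<delta>'_def by simp
      then have "ln (1 - a) \<le> ln (exp (- 2 * real j0))" using a by (subst ln_le_cancel_iff) auto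
      then have "ln (1 - a) \<le> - 2 * real j0" by simp
      then show ?thesis unfolding L_def using a by (simp add: ln_div)
    qed
    have L0: "0 \<le> L" using L by (rule order_trans[rotated]) simp
    \<comment> \<open>The last dyadic point not beyond a.\<close>
    define j1 where "j1 = nat \<lfloor>log 2 (1 / (1 - a))\<rfloor>"
    have Llog: "L \<le> log 2 (1 / (1 - a))"
    proof -
      have "L * ln 2 \<le> L * 1" using L0 ln_2_less_1 by (intro mult_left_mono) auto
      then show ?thesis unfolding log_def L_def[symmetric] by (simp add: le_divide_eq)
    qed
    have j1: "log 2 (1 / (1 - a)) \<le> real j1 + 1" "real j1 \<le> log 2 (1 / (1 - a))"
      unfolding j1_def using Llog L0 by linarith+
    have j1': "1 - a \<le> 1 / 2 ^ j" if "j \<le> j1" for j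
    proof -
      have "real j \<le> log 2 (1 / (1 - a))" using that j1(2) by linarith
      then have "2 powr real j \<le> 1 / (1 - a)" using a by (subst (asm) le_log_iff) auto
      then show ?thesis using a by (simp add: powr_realpow field_simps)
    qed
    define J where "J = (\<lambda>j::nat. 1 - 1 / (2::real) ^ j) ` {j0..j1}"
    have inj: "inj_on (\<lambda>j::nat. 1 - 1 / (2::real) ^ j) {j0..j1}" by (intro inj_onI) simp
    have cardJ: "card J = j1 + 1 - j0" unfolding J_def using card_image[OF inj] by simp
    \<comment> \<open>The number of points is j1 + 1 - j0 \<ge> L - j0 \<ge> L/2, the natural
      logarithm being below the binary one.\<close>
    have half: "L / 2 \<le> real (card J)"
      unfolding cardJ using Llog j1(1) L by linarith
    have "J \<subseteq> {1 - \<delta>..a}" unfolding J_def using j0 j1' by (auto simp: algebra_simps)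
    then have "((1 - a) powr (- s) * measure \<mu> {a..<1}) powr 1 * (\<Sum>b\<in>J. (1 - b) powr (\<beta> - \<beta> * 1)) \<le> \<epsilon> / 2"
      using a \<delta>' by (intro key) (auto simp: J_def intro!: disjoint_dyadic_discs \<eta>)
    \<comment> \<open>With exponent 0 and b < 1 each summand is 1, and the sum becomes the number of
      scales.\<close>
    also have "(\<Sum>b\<in>J. (1 - b) powr (\<beta> - \<beta> * 1)) = (\<Sum>b\<in>J. 1)"
      by (intro sum.cong refl) (auto simp: J_def)
    finally have bound: "(1 - a) powr (- s) * m * real (card J) \<le> \<epsilon> / 2" using m by (simp add: m_def)
    have "(1 - a) powr (- s) * m * (L / 2) \<le> (1 - a) powr (- s) * m * real (card J)"
      using half m by (intro mult_left_mono) auto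
    also note bound
    finally have "(1 - a) powr s * ((1 - a) powr (- s) * m * L) \<le> (1 - a) powr s * \<epsilon>"
      by (intro mult_left_mono) auto
    also have "(1 - a) powr s * ((1 - a) powr (- s) * m * L) = m * L"
      using a by (simp add: powr_minus)
    finally have "m * L \<le> \<epsilon> * (1 - a) powr s" by (simp add: mult.commute)
    then show ?thesis unfolding m L_def[symmetric] using L0 m
        by (simp add: ennreal_mult[symmetric] ennreal_leI)
  qed
  then show "\<exists>\<delta>>0. \<forall>t. 1 - \<delta> < t \<and> t < 1 \<longrightarrow> emeasure \<mu> {t..<1} * ennreal (ln (1 / (1 - t)) powr 1)
      \<le> ennreal (\<epsilon> * (1 - t) powr ((\<alpha> + 2) / p))"
    using \<delta>'(1) unfolding s_def by blast
qed

text \<open>Every p falls under one of the clauses, so some Carleson bound holds, and its instance t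
  = 0 bounds the total mass.\<close>

lemma cond_W_finite_measure:
  assumes "on_radius \<mu>" "cond_W \<mu> p \<alpha>"
  shows "finite_measure \<mu>"
proof -
  have "\<exists>s. carleson \<mu> s"
    using assms(2) unfolding cond_W_def by (meson linear)
  then show ?thesis using carleson_finite_measure[OF assms(1)] by blast
qed

theorem theorem5p1:
  fixes \<mu> :: "real measure" and p \<alpha> \<beta> :: real
  assumes "0 < p" and "\<alpha> > -1" and "\<beta> > 1"
    and "sets \<mu> = sets (restrict_space borel {0..<1::real})"
    and "cond_W \<mu> p \<alpha>"
  shows "(\<forall>q. q \<ge> p \<and> q > 1 \<longrightarrow>
            (hilbert_compact \<mu> \<beta> p \<alpha> q (\<beta> - 2) \<longrightarrow>
               vanishing_carleson \<mu> ((\<alpha> + 2) / p + \<beta> * (1 - 1 / q))) \<and>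
            (vanishing_carleson \<mu> (max (\<alpha> + 2) \<beta> * (1 / p + (1 - 1 / q))) \<longrightarrow>
               hilbert_compact \<mu> \<beta> p \<alpha> q (\<beta> - 2)))
       \<and> (1 \<ge> p \<longrightarrow>
            (hilbert_compact \<mu> \<beta> p \<alpha> 1 (\<beta> - 2) \<longleftrightarrow>
               vanishing_log_carleson \<mu> 1 ((\<alpha> + 2) / p)))"
proof -
  have fm: "finite_measure \<mu>" by (rule cond_W_finite_measure[OF assms(4,5)])
  show ?thesis
  proof (intro conjI allI impI iffI)
    fix q assume q: "p \<le> q \<and> 1 < q"
    show "vanishing_carleson \<mu> ((\<alpha> + 2) / p + \<beta> * (1 - 1 / q))" if "hilbert_compact \<mu> \<beta> p \<alpha> q (\<beta> - 2)"
      using compact_imp_vanishing_carleson[OF assms(1,2,3) _ assms(4) fm that] q by simp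
    show "hilbert_compact \<mu> \<beta> p \<alpha> q (\<beta> - 2)" if "vanishing_carleson \<mu> (max (\<alpha> + 2) \<beta> * (1 / p + (1 - 1 / q)))"
      using vanishing_carleson_imp_compact[OF assms(1,2,3,4) fm _ _ that] q by simp
  next
    assume p1: "p \<le> 1"
    show "vanishing_log_carleson \<mu> 1 ((\<alpha> + 2) / p)" if "hilbert_compact \<mu> \<beta> p \<alpha> 1 (\<beta> - 2)"
      by (rule compact_imp_vanishing_log_carleson[OF assms(1,2,3,4) fm that])
    \<comment> \<open>As p \<le> 1, the first clause of \<open>cond_W\<close> supplies the Carleson
      exponent (\<alpha>+2)/p under which the operator is defined on the source space.\<close>
    show "hilbert_compact \<mu> \<beta> p \<alpha> 1 (\<beta> - 2)" if "vanishing_log_carleson \<mu> 1 ((\<alpha> + 2) / p)"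
      using vanishing_log_carleson_imp_compact[OF assms(1) p1 assms(2,3,4) _ that] assms(5) p1 unfolding cond_W_def by simp
  qed
qed

end
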